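(* Let $1\le p<\infty$. For any $M>0$, there exists at least one $a^{\star}\in\mathscr{U}^M_{\rm ad}$ such that $$J(a^{\star})=\min_{a\in\mathscr{U}^M_{\rm ad}}J(a).$$
   Context: Weighted hypergraph: $G=(V,E,w)$ with $V=\{1,\dots,N\}$, $E\subset 2^V$ a family of subsets with $\#e\ge 2$ for every $e\in E$, and $w:E\to(0,\infty)$. Here $N=n+m$, $0<T<\infty$, and $\|\cdot\|$ is the Euclidean norm of $\mathbb{R}^N$. For $x\in\mathbb{R}^N$, $f_e(x)=\max_{i,j\in e}|x_i-x_j|$ and $\varphi_{G,p}(x)=\frac1p\sum_{e\in E}w(e)(f_e(x))^p$. For a proper lower semicontinuous convex $\phi:\mathbb{R}^N\to(-\infty,+\infty]$, $\partial\phi(x)=\{\eta\in\mathbb{R}^N:\ \eta\cdot(z-x)\le\phi(z)-\phi(x)\ \forall z\in\mathbb{R}^N\}$. $\mathscr{C}=\{a\in W^{1,2}(0,T;\mathbb{R}^N):\ a(\cdot)=(0,\dots,0,a_1(\cdot),\dots,a_m(\cdot))\}$ (first $n$ components vanish). For $a\in\mathscr{C}$ and $t\in[0,T]$, $K_a(t)=\{x\in\mathbb{R}^N:\ x_{n+j}=a_j(t),\ j=1,\dots,m\}$, and $I_{K_a(t)}$ is its indicator function ($0$ on $K_a(t)$, $+\infty$ elsewhere). Fix $h\in L^2(0,T;\mathbb{R}^N)$ and real numbers $x_{01},\dots,x_{0n}$. For $a\in\mathscr{C}$ put $x_0=(x_{01},\dots,x_{0n},a_1(0),\dots,a_m(0))\in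 K_a(0)$. Consider the problem $$x'(t)+\partial\varphi_{G,p}(x(t))+\partial I_{K_a(t)}(x(t))\ni h(t)\ \ (t\in(0,T)),\qquad x(0)=x_0 .$$ A solution is $x\in W^{1,2}(0,T;\mathbb{R}^N)$ with $x(t)\in K_a(t)$ for all $t\in[0,T]$, $x(0)=x_0$, satisfying the inclusion for a.e. $t$. It is known that there is a unique solution; it is denoted $\Lambda(a)$. For a given target $x_\ast\in L^2(0,T;\mathbb{R}^N)$, the cost function is $$J(a)=\frac12\int_0^T\|\Lambda(a)(t)-x_\ast(t)\|^2dt+\frac12\int_0^T\|a(t)\|^2dt ,\qquad a\in\mathscr{C}.$$ For $M>0$, $\mathscr{U}^M_{\rm ad}=\{a\in\mathscr{C}:\ \int_0^T\|a'(t)\|^2dt\le M\}$. *)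

theory Defs
  imports "HOL-Analysis.Analysis"
begin

text \<open>The vertex set is the universe of the finite type \<^typ>\<open>'v\<close>. The hypergraph is given by its
  set of hyperedges and a weight function, which is relevant on the hyperedges only.\<close>

definition weighted_hypergraph :: "'v::finite set set \<Rightarrow> ('v set \<Rightarrow> real) \<Rightarrow> bool" where
  "weighted_hypergraph E w \<longleftrightarrow> (\<forall>e\<in>E. 2 \<le> card e \<and> 0 < w e)"

definition edge_diff :: "'v::finite set \<Rightarrow> real^'v \<Rightarrow> real" where
  "edge_diff e x = Max {\<bar>x $ i - x $ j\<bar> | i j. i \<in> e \<and> j \<in> e}"

definition hypergraph_energy ::
    "'v::finite set set \<Rightarrow> ('v set \<Rightarrow> real) \<Rightarrow> real \<Rightarrow> real^'v \<Rightarrow> real" where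
  "hypergraph_energy E w p x = (1 / p) * (\<Sum>e\<in>E. w e * edge_diff e x powr p)"

text \<open>Off the effective domain of a proper function this set is empty, because
  \<open>r - \<infinity> = - \<infinity>\<close> for finite \<open>r\<close>.\<close>

definition subdifferential :: "('a::real_inner \<Rightarrow> ereal) \<Rightarrow> 'a \<Rightarrow> 'a set" where
  "subdifferential \<phi> x = {\<eta>. \<forall>z. ereal (\<eta> \<bullet> (z - x)) \<le> \<phi> z - \<phi> x}"

definition indicator_fun :: "'a set \<Rightarrow> 'a \<Rightarrow> ereal" where
  "indicator_fun K x = (if x \<in> K then 0 else \<infinity>)"

definition L2 :: "real \<Rightarrow> (real \<Rightarrow> 'a::euclidean_space) set" where
  "L2 T = {f. f \<in> borel_measurable (lebesgue_on {0<..<T}) \<and>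
              integrable (lebesgue_on {0<..<T}) (\<lambda>t. (norm (f t))\<^sup>2)}"

text \<open>Compactly supported $C^1$ functions on the open interval, extended by zero.\<close>

definition test_function :: "real \<Rightarrow> (real \<Rightarrow> real) \<Rightarrow> bool" where
  "test_function T \<phi> \<longleftrightarrow> \<phi> C1_differentiable_on UNIV \<and>
     (\<exists>K. compact K \<and> K \<subseteq> {0<..<T} \<and> (\<forall>t. t \<notin> K \<longrightarrow> \<phi> t = 0))"

definition has_weak_derivative ::
    "real \<Rightarrow> (real \<Rightarrow> 'a::euclidean_space) \<Rightarrow> (real \<Rightarrow> 'a) \<Rightarrow> bool" where
  "has_weak_derivative T u g \<longleftrightarrow>
     (\<forall>\<phi>. test_function T \<phi> \<longrightarrow>
        (LINT t|lebesgue_on {0<..<T}. deriv \<phi> t *\<^sub>R u t) =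
        - (LINT t|lebesgue_on {0<..<T}. \<phi> t *\<^sub>R g t))"

text \<open>The Sobolev space of square integrable functions with square integrable weak derivative.
  Each class is represented by functions continuous on the closed interval, so that point values
  make sense; values outside the closed interval are irrelevant.\<close>

definition W12 :: "real \<Rightarrow> (real \<Rightarrow> 'a::euclidean_space) set" where
  "W12 T = {u. u \<in> L2 T \<and> continuous_on {0..T} u \<and> (\<exists>g\<in>L2 T. has_weak_derivative T u g)}"

text \<open>The weak derivative is determined up to a null set only, and is used below only under
  integrals and in statements holding almost everywhere.\<close>

definition weak_deriv :: "real \<Rightarrow> (real \<Rightarrow> 'a::euclidean_space) \<Rightarrow> real \<Rightarrow> 'a" where
  "weak_deriv T u = (SOME g. g \<in> L2 T \<and> has_weak_derivative T u g)"

text \<open>The vertices are labelled by \<open>node\<close>, a bijection from \<open>{1..n + m}\<close> onto the vertex type;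
  the \<open>k\<close>-th component of a vector \<open>x\<close> is \<open>x $ node k\<close>. Controls act on the last \<open>m\<close> components.\<close>

definition controls :: "(nat \<Rightarrow> 'v::finite) \<Rightarrow> nat \<Rightarrow> real \<Rightarrow> (real \<Rightarrow> real^'v) set" where
  "controls node n T = {a \<in> W12 T. \<forall>t\<in>{0..T}. \<forall>i\<in>{1..n}. a t $ node i = 0}"

definition constraint_set ::
    "(nat \<Rightarrow> 'v::finite) \<Rightarrow> nat \<Rightarrow> nat \<Rightarrow> (real \<Rightarrow> real^'v) \<Rightarrow> real \<Rightarrow> (real^'v) set" where
  "constraint_set node n m a t = {x. \<forall>j\<in>{1..m}. x $ node (n + j) = a t $ node (n + j)}"

definition initial_state ::
    "(nat \<Rightarrow> 'v::finite) \<Rightarrow> nat \<Rightarrow> nat \<Rightarrow> (nat \<Rightarrow> real) \<Rightarrow> (real \<Rightarrow> real^'v) \<Rightarrow> real^'v" where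
  "initial_state node n m \<xi> a =
     (\<chi> v. let k = inv_into {1..n + m} node v in if k \<le> n then \<xi> k else a 0 $ v)"

definition is_solution ::
    "'v::finite set set \<Rightarrow> ('v set \<Rightarrow> real) \<Rightarrow> real \<Rightarrow> (nat \<Rightarrow> 'v) \<Rightarrow> nat \<Rightarrow> nat \<Rightarrow> real \<Rightarrow>
     (real \<Rightarrow> real^'v) \<Rightarrow> (nat \<Rightarrow> real) \<Rightarrow> (real \<Rightarrow> real^'v) \<Rightarrow> (real \<Rightarrow> real^'v) \<Rightarrow> bool" where
  "is_solution E w p node n m T h \<xi> a x \<longleftrightarrow>
     x \<in> W12 T \<and>
     (\<forall>t\<in>{0..T}. x t \<in> constraint_set node n m a t) \<and>
     x 0 = initial_state node n m \<xi> a \<and>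
     (AE t in lebesgue_on {0<..<T}.
        \<exists>\<eta> \<in> subdifferential (\<lambda>z. ereal (hypergraph_energy E w p z)) (x t).
        \<exists>\<zeta> \<in> subdifferential (indicator_fun (constraint_set node n m a t)) (x t).
          weak_deriv T x t + \<eta> + \<zeta> = h t)"

text \<open>The solution is unique on the closed interval only, hence a choice instead of a definite
  description: two solutions may differ outside it.\<close>

definition solution_map ::
    "'v::finite set set \<Rightarrow> ('v set \<Rightarrow> real) \<Rightarrow> real \<Rightarrow> (nat \<Rightarrow> 'v) \<Rightarrow> nat \<Rightarrow> nat \<Rightarrow> real \<Rightarrow>
     (real \<Rightarrow> real^'v) \<Rightarrow> (nat \<Rightarrow> real) \<Rightarrow> (real \<Rightarrow> real^'v) \<Rightarrow> real \<Rightarrow> real^'v" where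
  "solution_map E w p node n m T h \<xi> a = (SOME x. is_solution E w p node n m T h \<xi> a x)"

definition cost ::
    "'v::finite set set \<Rightarrow> ('v set \<Rightarrow> real) \<Rightarrow> real \<Rightarrow> (nat \<Rightarrow> 'v) \<Rightarrow> nat \<Rightarrow> nat \<Rightarrow> real \<Rightarrow>
     (real \<Rightarrow> real^'v) \<Rightarrow> (nat \<Rightarrow> real) \<Rightarrow> (real \<Rightarrow> real^'v) \<Rightarrow> (real \<Rightarrow> real^'v) \<Rightarrow> real" where
  "cost E w p node n m T h \<xi> x_target a =
     1 / 2 * (LINT t|lebesgue_on {0<..<T}.
                (norm (solution_map E w p node n m T h \<xi> a t - x_target t))\<^sup>2) +
     1 / 2 * (LINT t|lebesgue_on {0<..<T}. (norm (a t))\<^sup>2)"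

definition admissible_controls ::
    "(nat \<Rightarrow> 'v::finite) \<Rightarrow> nat \<Rightarrow> real \<Rightarrow> real \<Rightarrow> (real \<Rightarrow> real^'v) set" where
  "admissible_controls node n T M =
     {a \<in> controls node n T.
        (LINT t|lebesgue_on {0<..<T}. (norm (weak_deriv T a t))\<^sup>2) \<le> M}"

end

theory Submission
  imports Defs "HOL-Complex_Analysis.Great_Picard"
begin

text \<open>
The proof is the direct method of the calculus of variations. Along a minimising sequence the controls
are bounded in the Sobolev norm, so a subsequence converges uniformly to a control that is again admissible
(\<open>admissible_controls_compact\<close>). The solution map is continuous for uniform convergence of the
controls (\<open>solution_map_continuous\<close>); hence the cost converges along the subsequence and the limit is
optimal.

Since the solution map is defined by a choice, it means something only where solutions exist, so the
existence of solutions is part of the proof. The constraint and the initial condition leave only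
the free coordinates to be determined, and these follow the gradient flow of a convex function that
depends on time through the control (\<open>reduced_solution\<close>). If this function is Lipschitz, the explicit
Euler polygons converge by monotonicity of the subdifferential (\<open>gradient_flow_exists\<close>). The general
case is reduced to this one by an a priori bound and a Lipschitz convex minorant
(\<open>reduced_solution_bound\<close>, \<open>Lipschitz_convex_minorant\<close>). Continuous dependence is the same
monotonicity argument, applied to two controls (\<open>reduced_solution_difference\<close>).

Both the limit of the polygons and the limit control need a square integrable derivative. It comes
from the criterion of Riesz that the squared increments over the grids sum to at most a constant times
the mesh (\<open>Riesz_bounded_quadratic_variation\<close>), a condition that passes to pointwise limits. Functions with square integrable weak derivative are handled throughout as indefinite
integrals (\<open>W12_weak_deriv\<close>, \<open>primitive_W12\<close>), with a product rule (\<open>primitive_product_rule\<close>) in place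
of pointwise differentiation.
\<close>

section \<open>Square integrable functions on an interval\<close>

text \<open>Lebesgue integrals over the open interval are traded for gauge integrals over the closed one, so that
indefinite integrals are additive over adjacent intervals sharing an endpoint.\<close>

lemma integrable_lebesgue_on_Ioo_iff:
  fixes f :: "real \<Rightarrow> 'a::euclidean_space"
  shows "integrable (lebesgue_on {a<..<b}) f \<longleftrightarrow> f absolutely_integrable_on {a..b}"
  by (subst absolutely_integrable_on_Icc_iff_Ioo)
     (simp add: set_integrable_def integrable_restrict_space)

lemma LINT_Ioo_eq_integral:
  fixes f :: "real \<Rightarrow> 'a::euclidean_space"
  assumes "f absolutely_integrable_on {a..b}"
  shows "(LINT t|lebesgue_on {a<..<b}. f t) = integral {a..b} f"
  using assms lebesgue_integral_eq_integral[of "{a<..<b}" f]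
  by (simp add: integrable_lebesgue_on_Ioo_iff integral_open_interval_real)

lemma AE_lebesgue_on_iff_negligible:
  fixes S :: "'a::euclidean_space set"
  assumes "S \<in> sets lebesgue"
  shows "(AE t in lebesgue_on S. P t) \<longleftrightarrow> (\<exists>N. negligible N \<and> (\<forall>t\<in>S - N. P t))"
  using assms by (auto simp: AE_restrict_space_iff eventually_ae_filter_negligible)

lemma L2_iff_absolutely_integrable:
  fixes g :: "real \<Rightarrow> 'a::euclidean_space"
  shows "g \<in> L2 T \<longleftrightarrow> g absolutely_integrable_on {0..T} \<and>
           (\<lambda>t. (norm (g t))\<^sup>2) absolutely_integrable_on {0..T}"
proof -
  have "integrable (lebesgue_on {0<..<T}) g"
    if g: "g \<in> borel_measurable (lebesgue_on {0<..<T})"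
      "integrable (lebesgue_on {0<..<T}) (\<lambda>t. (norm (g t))\<^sup>2)"
  proof (rule Bochner_Integration.integrable_bound)
    show "integrable (lebesgue_on {0<..<T}) (\<lambda>t. 1 + (norm (g t))\<^sup>2)"
      using g by (simp add: integrable_lebesgue_on_Ioo_iff)
    have "norm (g t) \<le> 1 + (norm (g t))\<^sup>2" for t
      using zero_le_power2[of "norm (g t) - 1"] norm_ge_zero[of "g t"]
      unfolding power2_diff power_one mult_1_right by linarith
    then show "AE t in lebesgue_on {0<..<T}. norm (g t) \<le> norm (1 + (norm (g t))\<^sup>2)"
      by (auto intro!: AE_I2)
  qed (use g in auto)
  then show ?thesis
    unfolding L2_def integrable_lebesgue_on_Ioo_iff[symmetric] mem_Collect_eq
    by (metis (no_types, lifting) borel_measurable_integrable)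
qed

lemma L2_D:
  assumes "g \<in> L2 T"
  shows "g absolutely_integrable_on {0..T}" "(\<lambda>t. (norm (g t))\<^sup>2) absolutely_integrable_on {0..T}"
  using assms by (auto simp: L2_iff_absolutely_integrable)

lemma L2_add:
  assumes "f \<in> L2 T" "g \<in> L2 T"
  shows "(\<lambda>t. f t + g t) \<in> L2 T"
proof -
  have *: "(norm (f t + g t))\<^sup>2 \<le> 2 * (norm (f t))\<^sup>2 + 2 * (norm (g t))\<^sup>2" for t
    using zero_le_power2[of "norm (f t - g t)"]
    unfolding power2_norm_eq_inner by (simp add: algebra_simps inner_commute)
  show ?thesis
    unfolding L2_iff_absolutely_integrable
  proof
    show 1: "(\<lambda>t. f t + g t) absolutely_integrable_on {0..T}"
      using L2_D(1)[OF assms(1)] L2_D(1)[OF assms(2)] by (rule set_integral_add)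
    show "(\<lambda>t. (norm (f t + g t))\<^sup>2) absolutely_integrable_on {0..T}"
    proof (rule measurable_bounded_by_integrable_imp_absolutely_integrable)
      show "(\<lambda>t. 2 * (norm (f t))\<^sup>2 + 2 * (norm (g t))\<^sup>2) integrable_on {0..T}"
        using assms
        by (intro integrable_add integrable_on_cmult_left) (auto dest!: L2_D(2) set_lebesgue_integral_eq_integral(1))
      show "(\<lambda>t. (norm (f t + g t))\<^sup>2) \<in> borel_measurable (lebesgue_on {0..T})"
        using absolutely_integrable_imp_borel_measurable[OF 1] by auto
    qed (use * in auto)
  qed
qed

lemma L2_bounded_linear:
  fixes A :: "'a::euclidean_space \<Rightarrow> 'b::euclidean_space"
  assumes g: "g \<in> L2 T" and A: "bounded_linear A"
  shows "(\<lambda>t. A (g t)) \<in> L2 T"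
proof -
  obtain K where K: "\<And>x. norm (A x) \<le> norm x * K" "0 \<le> K"
    using bounded_linear.nonneg_bounded[OF A] by blast
  show ?thesis
    unfolding L2_iff_absolutely_integrable
  proof
    show 1: "(\<lambda>t. A (g t)) absolutely_integrable_on {0..T}"
      using absolutely_integrable_linear[OF L2_D(1)[OF g] A] by (simp add: o_def)
    show "(\<lambda>t. (norm (A (g t)))\<^sup>2) absolutely_integrable_on {0..T}"
    proof (rule measurable_bounded_by_integrable_imp_absolutely_integrable)
      show "(\<lambda>t. (norm (g t))\<^sup>2 * K\<^sup>2) integrable_on {0..T}"
        using L2_D(2)[OF g] by (intro integrable_on_mult_left) (auto dest!: set_lebesgue_integral_eq_integral(1))
      show "(\<lambda>t. (norm (A (g t)))\<^sup>2) \<in> borel_measurable (lebesgue_on {0..T})"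
        using absolutely_integrable_imp_borel_measurable[OF 1] by auto
      show "norm ((norm (A (g t)))\<^sup>2) \<le> (norm (g t))\<^sup>2 * K\<^sup>2" for t
        using power_mono[OF K(1), of "g t" 2] by (simp add: power_mult_distrib)
    qed auto
  qed
qed

lemma L2_scaleR: "g \<in> L2 T \<Longrightarrow> (\<lambda>t. c *\<^sub>R g t) \<in> L2 T"
  by (rule L2_bounded_linear[OF _ bounded_linear_scaleR_right])

lemma L2_diff: "f \<in> L2 T \<Longrightarrow> g \<in> L2 T \<Longrightarrow> (\<lambda>t. f t - g t) \<in> L2 T"
  using L2_add[of f T "\<lambda>t. (-1) *\<^sub>R g t"] L2_scaleR[of g T "-1"] by simp

lemma L2_bounded:
  fixes g :: "real \<Rightarrow> 'a::euclidean_space"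
  assumes g: "g absolutely_integrable_on {0..T}" and B: "\<And>t. t \<in> {0..T} \<Longrightarrow> norm (g t) \<le> B"
  shows "g \<in> L2 T"
  unfolding L2_iff_absolutely_integrable
proof
  show "(\<lambda>t. (norm (g t))\<^sup>2) absolutely_integrable_on {0..T}"
  proof (rule measurable_bounded_by_integrable_imp_absolutely_integrable)
    show "(\<lambda>t. (norm (g t))\<^sup>2) \<in> borel_measurable (lebesgue_on {0..T})"
      using absolutely_integrable_imp_borel_measurable[OF g] by auto
    show "(\<lambda>t. B\<^sup>2) integrable_on {0..T}" by auto
  qed (use B power_mono in fastforce)+
qed (rule g)

lemma L2_continuous:
  fixes u :: "real \<Rightarrow> 'a::euclidean_space"
  assumes "continuous_on {0..T} u"
  shows "u \<in> L2 T"
proof -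
  have "compact (u ` {0..T})"
    using assms by (intro compact_continuous_image) auto
  then obtain B where "\<And>t. t \<in> {0..T} \<Longrightarrow> norm (u t) \<le> B"
    using compact_imp_bounded bounded_iff by (metis imageI)
  then show ?thesis
    using absolutely_integrable_continuous_real[OF assms] L2_bounded by blast
qed

lemma L2_inner:
  fixes f g :: "real \<Rightarrow> 'a::euclidean_space"
  assumes "f \<in> L2 T" "g \<in> L2 T"
  shows "(\<lambda>t. f t \<bullet> g t) absolutely_integrable_on {0..T}"
proof (rule measurable_bounded_by_integrable_imp_absolutely_integrable)
  show "(\<lambda>t. f t \<bullet> g t) \<in> borel_measurable (lebesgue_on {0..T})"
    using assms[THEN L2_D(1), THEN absolutely_integrable_imp_borel_measurable] by auto
  show "(\<lambda>t. (norm (f t))\<^sup>2 + (norm (g t))\<^sup>2) integrable_on {0..T}"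
    using assms by (intro integrable_add) (auto dest!: L2_D(2) set_lebesgue_integral_eq_integral(1))
  show "norm (f t \<bullet> g t) \<le> (norm (f t))\<^sup>2 + (norm (g t))\<^sup>2" for t
  proof -
    have "\<bar>f t \<bullet> g t\<bar> \<le> norm (f t) * norm (g t)" by (rule Cauchy_Schwarz_ineq2)
    also have "\<dots> \<le> (norm (f t))\<^sup>2 + (norm (g t))\<^sup>2"
      using sum_squares_bound[of "norm (f t)" "norm (g t)"] mult_nonneg_nonneg[OF norm_ge_zero norm_ge_zero, of "f t" "g t"]
      unfolding mult.assoc by linarith
    finally show ?thesis by simp
  qed
qed auto

lemma L2_norm_sq_integrable:
  "g \<in> L2 T \<Longrightarrow> (\<lambda>t. (norm (g t))\<^sup>2) integrable_on {0..T}"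
  by (auto dest!: L2_D(2) set_lebesgue_integral_eq_integral(1))

lemma L2_integrable: "g \<in> L2 T \<Longrightarrow> g integrable_on {0..T}"
  by (auto dest!: L2_D(1) set_lebesgue_integral_eq_integral(1))

section \<open>Functions defined cell by cell\<close>

text \<open>Functions given by a separate formula on each cell of a uniform grid. They serve three purposes: as
discretised indicator functions, as difference quotients of a curve, and as the frozen
subgradients of an Euler scheme. The right endpoint of a cell belongs to the next one, which is harmless up to a null
set.\<close>

lemma cellwise_absolutely_integrable:
  fixes G :: "nat \<Rightarrow> real \<Rightarrow> 'a::euclidean_space"
  assumes d: "0 < d"
    and G: "\<And>i. i < N \<Longrightarrow> G i absolutely_integrable_on {real i * d..real (Suc i) * d}"
  shows "(\<lambda>t. G (nat \<lfloor>t / d\<rfloor>) t) absolutely_integrable_on {0..real N * d}"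
    and "integral {0..real N * d} (\<lambda>t. G (nat \<lfloor>t / d\<rfloor>) t) =
           (\<Sum>i<N. integral {real i * d..real (Suc i) * d} (G i))"
  using G
proof (induction N)
  case 0
  {
    case 1
    show ?case by (auto intro: absolutely_integrable_negligible)
  next
    case 2
    show ?case by simp
  }
next
  case (Suc N)
  let ?f = "\<lambda>t. G (nat \<lfloor>t / d\<rfloor>) t"
  {
    fix G :: "nat \<Rightarrow> real \<Rightarrow> 'a"
    let ?f = "\<lambda>t. G (nat \<lfloor>t / d\<rfloor>) t"
    have "?f t = G N t" if "t \<in> {real N * d..real (Suc N) * d} - {real (Suc N) * d}" for t
    proof -
      have "t / d < real (Suc N)" "real N \<le> t / d"
        using that d by (auto simp: field_simps simp del: of_nat_Suc)
      then have "\<lfloor>t / d\<rfloor> = int N" by (auto simp: floor_eq_iff)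
      then show ?thesis by simp
    qed
  }
  note cell = this[of _ G]
  have le: "0 \<le> real N * d" "real N * d \<le> real (Suc N) * d"
    using d by auto
  {
    case 1
    have a: "?f absolutely_integrable_on {real N * d..real (Suc N) * d}"
      by (rule absolutely_integrable_spike[where S="{real (Suc N) * d}"]) (use 1 cell in auto)
    have b: "?f absolutely_integrable_on {0..real N * d}"
      using Suc.IH(1) 1 by auto
    show ?case using absolutely_integrable_on_combine[OF b a le] .
  next
    case 2
    have a: "?f absolutely_integrable_on {real N * d..real (Suc N) * d}"
      by (rule absolutely_integrable_spike[where S="{real (Suc N) * d}"]) (use 2 cell in auto)
    have b: "?f absolutely_integrable_on {0..real N * d}"
      using Suc.IH(1) 2 by auto
    have c: "integral {real N * d..real (Suc N) * d} ?f = integral {real N * d..real (Suc N) * d} (G N)"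
      by (rule integral_spike[where S="{real (Suc N) * d}"]) (use cell in auto)
    have "?f integrable_on {0..real (Suc N) * d}"
      using absolutely_integrable_on_combine[OF b a le] set_lebesgue_integral_eq_integral(1) by blast
    then show ?case
      using Henstock_Kurzweil_Integration.integral_combine[OF le, of ?f] Suc.IH(2) 2 c by auto
  }
qed

lemma absolutely_integrable_on_sub_Icc:
  fixes f :: "real \<Rightarrow> 'a::euclidean_space"
  assumes "f absolutely_integrable_on {a..b}" "a \<le> c" "d \<le> b"
  shows "f absolutely_integrable_on {c..d}"
  by (rule absolutely_integrable_on_subinterval[OF assms(1)]) (use assms in auto)

lemma negligible_nonzero_if_integral_zero:
  fixes f :: "'a::euclidean_space \<Rightarrow> real"
  assumes f: "f integrable_on S" "\<And>x. x \<in> S \<Longrightarrow> 0 \<le> f x" "integral S f = 0" and S: "S \<in> sets lebesgue"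
  shows "negligible {x \<in> S. f x \<noteq> 0}"
proof -
  have "f absolutely_integrable_on S"
    using f by (auto intro: nonnegative_absolutely_integrable_1)
  then have i: "integrable (lebesgue_on S) f"
    using S by (simp add: set_integrable_def integrable_restrict_space)
  then have "integral\<^sup>L (lebesgue_on S) f = 0"
    using lebesgue_integral_eq_integral[OF i S] f by simp
  moreover have "AE x in lebesgue_on S. 0 \<le> f x"
    using f(2) by (auto intro: AE_I2)
  ultimately have "AE x in lebesgue_on S. f x = 0"
    using integral_nonneg_eq_0_iff_AE[OF i] by simp
  then obtain N where "negligible N" "\<forall>x\<in>S - N. f x = 0"
    using AE_lebesgue_on_iff_negligible[OF S] by blast
  then show ?thesis
    by (elim negligible_subset) auto
qed

section \<open>Integrands determined by their interval integrals\<close>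

text \<open>By inner regularity it is enough to show that every compact subset of the set of negativity is
null. The indicator of a compact set is the pointwise limit of the indicators of the grid cells that
meet it, and these have a nonnegative integral against \<open>F\<close> by hypothesis; dominated convergence
passes this to the compact set. The lemma replaces the differentiation of indefinite integrals: it
localises in time an inequality that is known on all time intervals.\<close>

lemma AE_nonneg_if_interval_integrals_nonneg:
  fixes F :: "real \<Rightarrow> real"
  assumes T: "0 < T" and F: "F absolutely_integrable_on {0..T}"
    and pos: "\<And>s t. 0 \<le> s \<Longrightarrow> s \<le> t \<Longrightarrow> t \<le> T \<Longrightarrow> 0 \<le> integral {s..t} F"
  shows "negligible {t \<in> {0..T}. F t < 0}"
proof -
  let ?S = "{t \<in> {0..T}. F t < 0}"
  have "?S = {t \<in> space (lebesgue_on {0..T}). F t < 0}" by auto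
  also have "\<dots> \<in> sets (lebesgue_on {0..T})"
    by (rule borel_measurable_less[OF absolutely_integrable_imp_borel_measurable[OF F]]) auto
  finally have "?S \<in> sets lebesgue"
    by (simp add: sets_restrict_space_iff)
  then obtain K C where K: "negligible K" "\<And>n::nat. compact (C n)" "?S = (\<Union>n. C n) \<union> K"
    using lebesgue_regular_inner by metis
  have "negligible (C n)" for n
  proof -
    define d where "d k = T / real (Suc k)" for k
    define c where "c k i = of_bool ({real i * d k..real (Suc i) * d k} \<inter> C n \<noteq> {}) * (1::real)" for k i
    have d: "0 < d k" "real (Suc k) * d k = T" for k
      using T by (auto simp: d_def simp del: of_nat_Suc)
    have Csub: "C n \<subseteq> ?S" using K by auto
    \<comment> \<open>\<open>c k\<close> selects the cells of mesh \<open>d k\<close> that meet the compact set\<close>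
    let ?f = "\<lambda>k t. c k (nat \<lfloor>t / d k\<rfloor>) * F t"
    have sub: "F absolutely_integrable_on {real i * d k..real (Suc i) * d k}"
      and nn: "0 \<le> integral {real i * d k..real (Suc i) * d k} F"
      if "i < Suc k" for i k
    proof -
      have "real (Suc i) * d k \<le> real (Suc k) * d k"
        using that d(1)[of k] by (intro mult_right_mono) auto
      then have *: "0 \<le> real i * d k" "real i * d k \<le> real (Suc i) * d k" "real (Suc i) * d k \<le> T"
        using d(1)[of k] unfolding d(2) by auto
      show "F absolutely_integrable_on {real i * d k..real (Suc i) * d k}"
        using absolutely_integrable_on_sub_Icc[OF F] * by blast
      show "0 \<le> integral {real i * d k..real (Suc i) * d k} F"
        using pos * by blast
    qed
    have int: "?f k absolutely_integrable_on {0..T}"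
      and le: "0 \<le> integral {0..T} (?f k)" for k
    proof -
      have *: "(\<lambda>t. c k i * F t) absolutely_integrable_on {real i * d k..real (Suc i) * d k}" if "i < Suc k" for i
        using sub[OF that] by (rule set_integrable_mult_right)
      show "?f k absolutely_integrable_on {0..T}"
        using cellwise_absolutely_integrable(1)[OF d(1)[of k], of "Suc k" "\<lambda>i t. c k i * F t"] *
        unfolding d(2) by blast
      have "integral {0..T} (?f k) = (\<Sum>i<Suc k. integral {real i * d k..real (Suc i) * d k} (\<lambda>t. c k i * F t))"
        using cellwise_absolutely_integrable(2)[OF d(1)[of k], of "Suc k" "\<lambda>i t. c k i * F t"] *
        unfolding d(2) by blast
      also have "\<dots> \<ge> 0"
        using nn by (intro sum_nonneg) (auto simp: c_def)
      finally show "0 \<le> integral {0..T} (?f k)" .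
    qed
    let ?g = "\<lambda>t. indicat_real (C n) t * F t"
    have lim: "(\<lambda>k. ?f k t) \<longlonglongrightarrow> ?g t" if t: "t \<in> {0..T}" for t
    proof (rule tendsto_mult[OF tendsto_eventually tendsto_const])
      have cell: "t \<in> {real (nat \<lfloor>t / d k\<rfloor>) * d k..real (Suc (nat \<lfloor>t / d k\<rfloor>)) * d k}" for k
      proof -
        have "0 \<le> t / d k" using t d(1)[of k] by auto
        then have "real (nat \<lfloor>t / d k\<rfloor>) \<le> t / d k" "t / d k \<le> real (Suc (nat \<lfloor>t / d k\<rfloor>))"
          by linarith+
        then show ?thesis using d(1)[of k] by (auto simp: field_simps simp del: of_nat_Suc)
      qed
      show "\<forall>\<^sub>F k in sequentially. c k (nat \<lfloor>t / d k\<rfloor>) = indicat_real (C n) t"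
      proof (cases "t \<in> C n")
        case True
        then have "c k (nat \<lfloor>t / d k\<rfloor>) = 1" for k
          using cell[of k] unfolding c_def by auto
        then show ?thesis using True by simp
      next
        case False
        have "closed (C n)" using K(2) compact_imp_closed by blast
        then have "open (- C n)" "t \<in> - C n" using False by auto
        then obtain e where "e > 0" "ball t e \<subseteq> - C n"
          using open_contains_ball by blast
        then have e: "e > 0" "ball t e \<inter> C n = {}" by auto
        have "d \<longlonglongrightarrow> 0"
          unfolding d_def using lim_const_over_n[of T] by (rule LIMSEQ_Suc)
        then have "\<forall>\<^sub>F k in sequentially. d k < e"
          using e order_tendstoD(2) by blast
        then show ?thesis
        proof eventually_elim
          case (elim k)
          have "{real i * d k..real (Suc i) * d k} \<inter> C n = {}" if "i = nat \<lfloor>t / d k\<rfloor>" for i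
          proof -
            have "{real i * d k..real (Suc i) * d k} \<subseteq> ball t e"
            proof
              fix r assume "r \<in> {real i * d k..real (Suc i) * d k}"
              then have "\<bar>t - r\<bar> \<le> real (Suc i) * d k - real i * d k"
                using cell[of k] unfolding that[symmetric] by auto
              also have "\<dots> = d k" by (simp add: algebra_simps)
              finally show "r \<in> ball t e" using elim by (auto simp: dist_real_def)
            qed
            then show ?thesis using e by auto
          qed
          then show ?case using False by (auto simp: c_def)
        qed
      qed
    qed
    have absF: "(\<lambda>t. \<bar>F t\<bar>) integrable_on {0..T}"
      using set_integrable_abs[OF F] by (rule set_lebesgue_integral_eq_integral(1))
    have int': "?f k integrable_on {0..T}" for k
      using int by (rule set_lebesgue_integral_eq_integral(1))
    have bd: "norm (?f k t) \<le> \<bar>F t\<bar>" for k t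
      by (auto simp: c_def abs_mult)
    note dc = dominated_convergence[where f = ?f and h = "\<lambda>t. \<bar>F t\<bar>", OF int' absF bd lim]
    have "0 \<le> integral {0..T} ?g"
      by (rule LIMSEQ_le_const[OF dc(2)]) (use le in auto)
    moreover have le0: "?g t \<le> 0" for t
      using Csub by (auto simp: indicator_def)
    then have "integral {0..T} ?g \<le> 0"
      using integral_le[OF dc(1) integrable_0] by simp
    ultimately have "negligible {t \<in> {0..T}. - ?g t \<noteq> 0}"
      using le0 dc(1) integrable_neg[OF dc(1)]
      by (intro negligible_nonzero_if_integral_zero) (auto simp del: neg_equal_0_iff_equal)
    moreover have "C n \<subseteq> {t \<in> {0..T}. - ?g t \<noteq> 0}"
      using Csub by (auto simp: indicator_def)
    ultimately show ?thesis using negligible_subset by blast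
  qed
  then show ?thesis
    using K by (auto intro!: negligible_countable_Union)
qed

section \<open>Product rule for indefinite integrals\<close>

text \<open>A function whose increments are \<open>o(1)\<close> times those of a fixed function \<open>N\<close>, uniformly over short
intervals, is constant: sum over a fine partition.\<close>

lemma eq_if_increments_dominated:
  fixes H :: "real \<Rightarrow> 'a::real_normed_vector" and N :: "real \<Rightarrow> real"
  assumes ab: "a \<le> b"
    and inc: "\<And>e. 0 < e \<Longrightarrow> \<exists>d>0. \<forall>s t. a \<le> s \<and> s \<le> t \<and> t \<le> b \<and> t - s < d \<longrightarrow>
                norm (H t - H s) \<le> e * (N t - N s)"
  shows "H b = H a"
proof -
  have bnd: "norm (H b - H a) \<le> e * (N b - N a)" if e: "0 < e" for e
  proof -
    obtain d where d: "0 < d" "\<And>s t. a \<le> s \<Longrightarrow> s \<le> t \<Longrightarrow> t \<le> b \<Longrightarrow> t - s < d \<Longrightarrow>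
                norm (H t - H s) \<le> e * (N t - N s)"
      using inc[OF e] by blast
    obtain n where n: "(b - a) / d < real n" using reals_Archimedean2 by blast
    define x where "x k = a + real k * ((b - a) / real n)" for k
    have n0: "0 < real n" using n ab d(1) by (meson divide_nonneg_pos diff_ge_0_iff_ge le_less_trans)
    have "norm (H (x k) - H a) \<le> e * (N (x k) - N a)" if "k \<le> n" for k
      using that
    proof (induction k)
      case (Suc k)
      have "real (Suc k) * ((b - a) / real n) \<le> real n * ((b - a) / real n)"
        using Suc.prems ab n0 by (intro mult_right_mono) auto
      then have "x (Suc k) \<le> b" using n0 by (simp add: x_def)
      moreover have step: "x (Suc k) - x k = (b - a) / real n"
        unfolding x_def of_nat_Suc distrib_right by simp
      moreover have "0 \<le> (b - a) / real n" using ab n0 by auto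
      then have "a \<le> x k" "x k \<le> x (Suc k)"
        using step mult_nonneg_nonneg[OF of_nat_0_le_iff \<open>0 \<le> (b - a) / real n\<close>, of k]
        unfolding x_def by linarith+
      moreover have "x (Suc k) - x k < d" unfolding step using n d(1) n0 by (simp add: field_simps)
      ultimately have "norm (H (x (Suc k)) - H (x k)) \<le> e * (N (x (Suc k)) - N (x k))"
        using d(2) by blast
      moreover have "norm (H (x k) - H a) \<le> e * (N (x k) - N a)"
        using Suc by auto
      ultimately show ?case
        using norm_triangle_ineq[of "H (x (Suc k)) - H (x k)" "H (x k) - H a"]
        by (simp add: algebra_simps)
    qed (simp add: x_def)
    from this[of n] show ?thesis using n0 by (simp add: x_def)
  qed
  have "norm (H b - H a) \<le> 0"
  proof (rule field_le_epsilon)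
    fix e :: real assume e: "0 < e"
    have "norm (H b - H a) \<le> e / (\<bar>N b - N a\<bar> + 1) * (N b - N a)"
      using e by (intro bnd) auto
    also have "\<dots> \<le> e / (\<bar>N b - N a\<bar> + 1) * (\<bar>N b - N a\<bar> + 1)"
      using e by (intro mult_left_mono) auto
    also have "\<dots> = e" by simp
    finally show "norm (H b - H a) \<le> 0 + e" by simp
  qed
  then show ?thesis by simp
qed

lemma integral_Icc_diff:
  fixes F :: "real \<Rightarrow> 'a::euclidean_space"
  assumes "F integrable_on {a..b}" "a \<le> s" "s \<le> t" "t \<le> b"
  shows "integral {a..t} F - integral {a..s} F = integral {s..t} F"
proof -
  have "F integrable_on {a..t}"
    by (rule integrable_subinterval_real[OF assms(1)]) (use assms in auto)
  from Henstock_Kurzweil_Integration.integral_combine[OF assms(2,3) this]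
  show ?thesis by (simp add: algebra_simps)
qed

lemma primitive_continuous:
  fixes F :: "real \<Rightarrow> 'a::banach"
  assumes "F integrable_on {a..b}" and U: "\<And>t. t \<in> {a..b} \<Longrightarrow> U t = U a + integral {a..t} F"
  shows "continuous_on {a..b} U"
proof (rule continuous_on_eq)
  show "continuous_on {a..b} (\<lambda>t. U a + integral {a..t} F)"
    by (intro continuous_intros indefinite_integral_continuous_1 assms)
qed (rule U[symmetric])

text \<open>The defect \<open>U \<odot> V - \<integral>(F \<odot> V + U \<odot> G)\<close> has on a short interval an increment bounded by the
oscillation of \<open>U\<close> and \<open>V\<close> times the integral of \<open>norm F + norm G\<close>, hence is constant.\<close>

lemma primitive_product_rule:
  fixes U F :: "real \<Rightarrow> 'a::euclidean_space" and V G :: "real \<Rightarrow> 'b::euclidean_space"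
    and prod :: "'a \<Rightarrow> 'b \<Rightarrow> 'c::euclidean_space" (infixl \<open>\<odot>\<close> 70)
  assumes "bounded_bilinear prod" and ab: "a \<le> b"
    and F: "F absolutely_integrable_on {a..b}" and G: "G absolutely_integrable_on {a..b}"
    and U: "\<And>t. t \<in> {a..b} \<Longrightarrow> U t = U a + integral {a..t} F"
    and V: "\<And>t. t \<in> {a..b} \<Longrightarrow> V t = V a + integral {a..t} G"
  shows "(\<lambda>r. F r \<odot> V r + U r \<odot> G r) absolutely_integrable_on {a..b}"
    and "integral {a..b} (\<lambda>r. F r \<odot> V r + U r \<odot> G r) = U b \<odot> V b - U a \<odot> V a"
proof -
  interpret bounded_bilinear prod by fact
  have int: "F integrable_on {a..b}" "G integrable_on {a..b}"
    using F G by (auto dest: set_lebesgue_integral_eq_integral(1))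
  have cont: "continuous_on {a..b} U" "continuous_on {a..b} V"
    by (rule primitive_continuous[OF int(1)], erule U) (rule primitive_continuous[OF int(2)], erule V)
  have bil: "bilinear prod" "bilinear (\<lambda>y x. x \<odot> y)"
    using bilinear_conv_bounded_bilinear assms(1) bounded_bilinear.flip[OF assms(1)] by auto
  have m: "U \<in> borel_measurable (lebesgue_on {a..b})" "V \<in> borel_measurable (lebesgue_on {a..b})"
    "bounded (U ` {a..b})" "bounded (V ` {a..b})"
    using cont by (auto intro!: continuous_imp_measurable_on_sets_lebesgue compact_imp_bounded compact_continuous_image)
  have FV: "(\<lambda>r. F r \<odot> V r) absolutely_integrable_on {a..b}"
    using absolutely_integrable_bounded_measurable_product[OF bil(2) m(2) _ m(4) F] by simp
  have UG: "(\<lambda>r. U r \<odot> G r) absolutely_integrable_on {a..b}"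
    using absolutely_integrable_bounded_measurable_product[OF bil(1) m(1) _ m(3) G] by simp
  show FVUG: "(\<lambda>r. F r \<odot> V r + U r \<odot> G r) absolutely_integrable_on {a..b}"
    using FV UG by (rule set_integral_add)
  let ?f = "\<lambda>r. F r \<odot> V r + U r \<odot> G r"
  obtain K where K: "0 < K" "\<And>x y. norm (x \<odot> y) \<le> norm x * norm y * K"
    using pos_bounded by blast
  have nint: "(\<lambda>r. norm (F r) + norm (G r)) integrable_on {a..b}"
    by (intro integrable_add set_lebesgue_integral_eq_integral(1) set_integrable_norm F G)
  let ?N = "\<lambda>t. integral {a..t} (\<lambda>r. norm (F r) + norm (G r))"
  let ?H = "\<lambda>t. U t \<odot> V t - integral {a..t} ?f"
  have "?H b = ?H a"
  proof (rule eq_if_increments_dominated[OF ab, where N = ?N])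
    fix e :: real assume e: "0 < e"
    have "uniformly_continuous_on {a..b} U" "uniformly_continuous_on {a..b} V"
      using cont by (auto intro: compact_uniformly_continuous)
    moreover have "0 < e / K" using e K(1) by simp
    ultimately obtain d1 d2 where d0: "0 < d1" "0 < d2"
      "\<forall>s\<in>{a..b}. \<forall>t\<in>{a..b}. dist t s < d1 \<longrightarrow> dist (U t) (U s) < e / K"
      "\<forall>s\<in>{a..b}. \<forall>t\<in>{a..b}. dist t s < d2 \<longrightarrow> dist (V t) (V s) < e / K"
      unfolding uniformly_continuous_on_def by blast
    then have d: "0 < d1" "0 < d2"
      "\<And>s t. s \<in> {a..b} \<Longrightarrow> t \<in> {a..b} \<Longrightarrow> dist s t < d1 \<Longrightarrow> dist (U s) (U t) < e / K"
      "\<And>s t. s \<in> {a..b} \<Longrightarrow> t \<in> {a..b} \<Longrightarrow> dist s t < d2 \<Longrightarrow> dist (V s) (V t) < e / K"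
      by auto
    have "norm (?H t - ?H s) \<le> e * (?N t - ?N s)"
      if st: "a \<le> s" "s \<le> t" "t \<le> b" "t - s < min d1 d2" for s t
    proof -
      have sub: "f integrable_on {s..t}" if "f integrable_on {a..b}" for f :: "real \<Rightarrow> 'd::banach"
        by (rule integrable_subinterval_real[OF that]) (use st in auto)
      have FVUG_sub: "?f integrable_on {s..t}"
        by (rule sub) (use FVUG in \<open>auto dest: set_lebesgue_integral_eq_integral(1)\<close>)
      have UV: "U t - U s = integral {s..t} F" "V t - V s = integral {s..t} G"
        using integral_Icc_diff[OF int(1) st(1-3)] integral_Icc_diff[OF int(2) st(1-3)]
          U[of t] U[of s] V[of t] V[of s] st by auto
      have i1: "((\<lambda>r. F r \<odot> V t) has_integral (U t - U s) \<odot> V t) {s..t}"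
        using has_integral_linear[OF integrable_integral[OF sub[OF int(1)]] bounded_linear_left[of "V t"]]
        by (simp add: UV o_def)
      have i2: "((\<lambda>r. U s \<odot> G r) has_integral U s \<odot> (V t - V s)) {s..t}"
        using has_integral_linear[OF integrable_integral[OF sub[OF int(2)]] bounded_linear_right[of "U s"]]
        by (simp add: UV o_def)
      have "(U t - U s) \<odot> V t + U s \<odot> (V t - V s) = U t \<odot> V t - U s \<odot> V s"
        by (simp add: diff_left diff_right)
      with has_integral_diff[OF has_integral_add[OF i1 i2] integrable_integral[OF FVUG_sub]]
      have "((\<lambda>r. F r \<odot> V t + U s \<odot> G r - ?f r) has_integral
            (U t \<odot> V t - U s \<odot> V s - integral {s..t} ?f)) {s..t}" by simp
      also have "U t \<odot> V t - U s \<odot> V s - integral {s..t} ?f = ?H t - ?H s"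
        using integral_Icc_diff[of ?f, OF set_lebesgue_integral_eq_integral(1)[OF FVUG] st(1-3)]
        by (simp add: algebra_simps)
      also have "(\<lambda>r. F r \<odot> V t + U s \<odot> G r - ?f r) = (\<lambda>r. F r \<odot> (V t - V r) - (U r - U s) \<odot> G r)"
        by (simp add: diff_left diff_right algebra_simps)
      finally have H: "((\<lambda>r. F r \<odot> (V t - V r) - (U r - U s) \<odot> G r) has_integral ?H t - ?H s) {s..t}" .
      have le: "norm (F r \<odot> (V t - V r) - (U r - U s) \<odot> G r) \<le> e * (norm (F r) + norm (G r))"
        if r: "r \<in> {s..t}" for r
      proof -
        have "dist r t < d2" "dist r s < d1" using r st by (auto simp: dist_real_def)
        then have *: "norm (V t - V r) \<le> e / K" "norm (U r - U s) \<le> e / K"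
          using d(3)[of r s] d(4)[of t r] r st by (auto simp: dist_norm norm_minus_commute dist_commute)
        have "norm (F r \<odot> (V t - V r)) \<le> norm (F r) * norm (V t - V r) * K" by (rule K)
        also have "\<dots> \<le> norm (F r) * (e / K) * K"
          using * K(1) by (intro mult_right_mono mult_left_mono) auto
        finally have 1: "norm (F r \<odot> (V t - V r)) \<le> e * norm (F r)" using K(1) by (simp add: mult.commute)
        have "norm ((U r - U s) \<odot> G r) \<le> norm (U r - U s) * norm (G r) * K" by (rule K)
        also have "\<dots> \<le> (e / K) * norm (G r) * K"
          using * K(1) by (intro mult_right_mono) auto
        finally have "norm ((U r - U s) \<odot> G r) \<le> e * norm (G r)" using K(1) by simp
        with 1 show ?thesis
          using norm_triangle_ineq4[of "F r \<odot> (V t - V r)" "(U r - U s) \<odot> G r"]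
          by (simp add: algebra_simps)
      qed
      have "norm (integral {s..t} (\<lambda>r. F r \<odot> (V t - V r) - (U r - U s) \<odot> G r)) \<le>
            integral {s..t} (\<lambda>r. e * (norm (F r) + norm (G r)))"
        using H le sub[OF nint]
        by (intro Henstock_Kurzweil_Integration.integral_norm_bound_integral) (auto intro!: integrable_on_mult_right)
      also have "\<dots> = e * (?N t - ?N s)"
        using integral_Icc_diff[OF nint st(1-3)] by simp
      finally show ?thesis using integral_unique[OF H] by simp
    qed
    then show "\<exists>d>0. \<forall>s t. a \<le> s \<and> s \<le> t \<and> t \<le> b \<and> t - s < d \<longrightarrow> norm (?H t - ?H s) \<le> e * (?N t - ?N s)"
      using d(1,2) by (intro exI[of _ "min d1 d2"]) auto
  qed
  then show "integral {a..b} ?f = U b \<odot> V b - U a \<odot> V a" by (simp add: algebra_simps)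
qed

section \<open>Weak derivatives are integrands of primitives\<close>

lemma integral_eq_zeroI:
  fixes f :: "real \<Rightarrow> 'a::banach"
  assumes "\<And>t. t \<in> S \<Longrightarrow> f t = 0" shows "integral S f = 0"
  using integral_cong[of S f "\<lambda>_. 0"] assms by simp

lemma test_function_deriv:
  assumes "test_function T \<phi>"
  shows "(\<phi> has_real_derivative deriv \<phi> t) (at t)" "continuous_on UNIV (deriv \<phi>)"
proof -
  obtain D where D: "\<And>x. (\<phi> has_vector_derivative D x) (at x)" "continuous_on UNIV D"
    using assms by (auto simp: test_function_def C1_differentiable_on_def)
  then have d: "(\<phi> has_real_derivative D x) (at x)" for x
    by (simp add: has_real_derivative_iff_has_vector_derivative)
  then have "deriv \<phi> = D"
    using DERIV_imp_deriv by blast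
  then show "(\<phi> has_real_derivative deriv \<phi> t) (at t)" "continuous_on UNIV (deriv \<phi>)"
    using d D by auto
qed

lemma primitive_has_weak_derivative:
  fixes u g :: "real \<Rightarrow> 'a::euclidean_space"
  assumes T: "0 < T" and g: "g \<in> L2 T"
    and u: "\<And>t. t \<in> {0..T} \<Longrightarrow> u t = u 0 + integral {0..t} g"
  shows "has_weak_derivative T u g"
  unfolding has_weak_derivative_def
proof (intro allI impI)
  fix \<phi> assume \<phi>: "test_function T \<phi>"
  note d = test_function_deriv[OF \<phi>]
  obtain K where "K \<subseteq> {0<..<T}" "\<And>t. t \<notin> K \<Longrightarrow> \<phi> t = 0"
    using \<phi> by (auto simp: test_function_def)
  then have z: "\<phi> 0 = 0" "\<phi> T = 0" by fastforce+
  have dint: "deriv \<phi> absolutely_integrable_on {0..T}"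
    by (intro absolutely_integrable_continuous_real continuous_on_subset[OF d(2)]) auto
  have prim: "\<phi> t = \<phi> 0 + integral {0..t} (deriv \<phi>)" if "t \<in> {0..T}" for t
  proof -
    have "(deriv \<phi> has_integral \<phi> t - \<phi> 0) {0..t}"
      using that d(1) by (intro fundamental_theorem_of_calculus)
        (auto simp: has_real_derivative_iff_has_vector_derivative[symmetric] intro: has_field_derivative_at_within)
    then show ?thesis by (simp add: integral_unique)
  qed
  have cont: "continuous_on {0..T} \<phi>" "continuous_on {0..T} u"
    by (rule primitive_continuous[OF set_lebesgue_integral_eq_integral(1)[OF dint] prim], assumption)
       (rule primitive_continuous[OF L2_integrable[OF g] u], assumption)
  have m: "\<phi> \<in> borel_measurable (lebesgue_on {0..T})" "bounded (\<phi> ` {0..T})"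
    using cont by (auto intro!: continuous_imp_measurable_on_sets_lebesgue compact_imp_bounded compact_continuous_image)
  have bl: "bilinear ((*\<^sub>R) :: real \<Rightarrow> 'a \<Rightarrow> 'a)"
    using bilinear_conv_bounded_bilinear bounded_bilinear_scaleR by blast
  have i2: "(\<lambda>t. \<phi> t *\<^sub>R g t) absolutely_integrable_on {0..T}"
    using absolutely_integrable_bounded_measurable_product[OF bl m(1) _ m(2) L2_D(1)[OF g]] by simp
  have i1: "(\<lambda>t. deriv \<phi> t *\<^sub>R u t) absolutely_integrable_on {0..T}"
    by (intro absolutely_integrable_continuous_real continuous_intros cont continuous_on_subset[OF d(2)]) auto
  have "integral {0..T} (\<lambda>r. deriv \<phi> r *\<^sub>R u r + \<phi> r *\<^sub>R g r) = \<phi> T *\<^sub>R u T - \<phi> 0 *\<^sub>R u 0"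
    by (rule primitive_product_rule(2)[OF bounded_bilinear_scaleR _ dint L2_D(1)[OF g] prim u]) (use T in auto)
  then have "integral {0..T} (\<lambda>r. deriv \<phi> r *\<^sub>R u r) + integral {0..T} (\<lambda>r. \<phi> r *\<^sub>R g r) = 0"
    using i1 i2 by (subst integral_add[symmetric]) (auto dest: set_lebesgue_integral_eq_integral(1) simp: z)
  then show "(LINT t|lebesgue_on {0<..<T}. deriv \<phi> t *\<^sub>R u t) = - (LINT t|lebesgue_on {0<..<T}. \<phi> t *\<^sub>R g t)"
    using i1 i2 by (simp add: LINT_Ioo_eq_integral eq_neg_iff_add_eq_0)
qed

text \<open>The lemma of du Bois-Reymond. The derivative of the test function is a bump times the deviation of a component of \<open>w\<close> from
its mean weighted by the bump. Testing gives that the weighted variance vanishes.\<close>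

lemma weak_derivative_zero_imp_constant:
  fixes w :: "real \<Rightarrow> 'a::euclidean_space"
  assumes T: "0 < T" and w: "continuous_on {0..T} w"
    and weak: "has_weak_derivative T w (\<lambda>_. 0)"
    and t: "t \<in> {0..T}"
  shows "w t = w 0"
proof -
  have loc: "\<exists>c. \<forall>r\<in>{\<alpha><..<\<beta>}. w r \<bullet> b = c" if ab: "0 < \<alpha>" "\<alpha> < \<beta>" "\<beta> < T" and b: "b \<in> Basis" for \<alpha> \<beta> b
  proof -
    \<comment> \<open>a component of \<open>w\<close>, continuously extended so that the test function is continuously differentiable on the whole line\<close>
    define W where "W r = w (max 0 (min T r)) \<bullet> b" for r
    define \<theta> where "\<theta> r = max 0 ((r - \<alpha>) * (\<beta> - r))" for r :: real
    have W: "continuous_on UNIV W"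
      unfolding W_def using T
      by (intro continuous_intros continuous_on_compose2[OF w]) auto
    have \<theta>: "continuous_on UNIV \<theta>" unfolding \<theta>_def by (intro continuous_intros)
    have \<theta>0: "\<theta> r = 0" if "r \<notin> {\<alpha>..\<beta>}" for r
      using that ab by (auto simp: \<theta>_def max_def mult_le_0_iff zero_le_mult_iff)
    have \<theta>pos: "0 < \<theta> r" if "r \<in> {\<alpha><..<\<beta>}" for r using that by (auto simp: \<theta>_def)
    have \<theta>nn: "0 \<le> \<theta> r" for r by (simp add: \<theta>_def)
    have i: "f integrable_on {0..T}" if "continuous_on UNIV f" for f :: "real \<Rightarrow> real"
      by (intro integrable_continuous_real continuous_on_subset[OF that]) auto
    have "integral {0..T} \<theta> \<noteq> 0"
    proof
      assume "integral {0..T} \<theta> = 0"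
      then have "\<theta> ((\<alpha> + \<beta>) / 2) = 0"
        using integral_eq_0_iff[of 0 T \<theta>] continuous_on_subset[OF \<theta>] T \<theta>nn ab by auto
      then show False using \<theta>pos[of "(\<alpha> + \<beta>) / 2"] ab by simp
    qed
    \<comment> \<open>the mean of \<open>W\<close> weighted by \<open>\<theta>\<close>, so that the primitive \<open>\<phi>\<close> of \<open>\<psi>\<close> has compact support\<close>
    define c where "c = integral {0..T} (\<lambda>r. \<theta> r * W r) / integral {0..T} \<theta>"
    define \<psi> where "\<psi> r = \<theta> r * (W r - c)" for r
    have \<psi>: "continuous_on UNIV \<psi>"
      unfolding \<psi>_def by (intro continuous_intros W \<theta>)
    have \<psi>int: "integral {0..T} \<psi> = 0"
    proof -
      have "integral {0..T} \<psi> = integral {0..T} (\<lambda>r. \<theta> r * W r - \<theta> r * c)"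
        unfolding \<psi>_def right_diff_distrib ..
      also have "\<dots> = integral {0..T} (\<lambda>r. \<theta> r * W r) - integral {0..T} (\<lambda>r. \<theta> r * c)"
        by (intro integral_diff i continuous_intros W \<theta>)
      also have "\<dots> = 0" using \<open>integral {0..T} \<theta> \<noteq> 0\<close> by (simp add: c_def)
      finally show ?thesis .
    qed
    have \<psi>0: "\<psi> r = 0" if "r \<notin> {\<alpha>..\<beta>}" for r using \<theta>0[OF that] by (simp add: \<psi>_def)
    define \<phi> where "\<phi> r = integral {0..r} \<psi>" for r
    have \<phi>0: "\<phi> r = 0" if "r \<notin> {\<alpha>..\<beta>}" for r
    proof (cases "r < \<alpha>")
      case True
      then show ?thesis unfolding \<phi>_def by (intro integral_eq_zeroI \<psi>0) auto
    next
      case False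
      with that have r: "\<beta> < r" by auto
      have split: "integral {0..\<beta>} \<psi> + integral {\<beta>..s} \<psi> = integral {0..s} \<psi>" if "\<beta> \<le> s" for s
        using ab that
        by (intro Henstock_Kurzweil_Integration.integral_combine integrable_continuous_real continuous_on_subset[OF \<psi>]) auto
      have tail: "integral {\<beta>..s} \<psi> = 0" for s
      proof (rule integral_eq_zeroI)
        fix x assume "x \<in> {\<beta>..s}"
        then show "\<psi> x = 0" using \<psi>0[of x] by (cases "x = \<beta>") (auto simp: \<psi>_def \<theta>_def)
      qed
      show ?thesis using split[of T] split[of r] tail \<psi>int ab r by (simp add: \<phi>_def)
    qed
    have \<phi>d: "(\<phi> has_real_derivative \<psi> r) (at r)" for r
    proof (cases "r < \<alpha>")
      case True
      have "((\<lambda>_. 0) has_real_derivative \<psi> r) (at r)" using \<psi>0[of r] True by simp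
      then show ?thesis
        by (rule has_field_derivative_transform_within_open[where S = "{..<\<alpha>}"])
           (use True \<phi>0 in auto)
    next
      case False
      have "(\<phi> has_real_derivative \<psi> r) (at r within {0..r + 1})"
        unfolding \<phi>_def using False ab
        by (intro integral_has_real_derivative continuous_on_subset[OF \<psi>]) auto
      moreover have "at r within {0..r + 1} = at r"
        using False ab by (intro at_within_interior) auto
      ultimately show ?thesis by simp
    qed
    have "test_function T \<phi>"
      unfolding test_function_def C1_differentiable_on_def
      using \<phi>d \<psi> \<phi>0 ab
      by (auto simp: has_real_derivative_iff_has_vector_derivative intro!: exI[of _ \<psi>] exI[of _ "{\<alpha>..\<beta>}"])
    moreover have "deriv \<phi> = \<psi>" using \<phi>d DERIV_imp_deriv by blast
    ultimately have "(LINT t|lebesgue_on {0<..<T}. \<psi> t *\<^sub>R w t) = 0"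
      using weak unfolding has_weak_derivative_def by auto
    moreover have iw: "(\<lambda>t. \<psi> t *\<^sub>R w t) absolutely_integrable_on {0..T}"
      by (intro absolutely_integrable_continuous_real continuous_intros w continuous_on_subset[OF \<psi>]) auto
    ultimately have "integral {0..T} (\<lambda>t. \<psi> t *\<^sub>R w t) = 0"
      by (simp add: LINT_Ioo_eq_integral)
    then have "integral {0..T} (\<lambda>t. (\<psi> t *\<^sub>R w t) \<bullet> b) = 0"
      using integral_linear[OF set_lebesgue_integral_eq_integral(1)[OF iw] bounded_linear_inner_left[of b]]
      by (simp add: o_def)
    also have "integral {0..T} (\<lambda>t. (\<psi> t *\<^sub>R w t) \<bullet> b) = integral {0..T} (\<lambda>t. \<psi> t * W t)"
      by (intro integral_cong) (auto simp: W_def max_def min_def)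
    finally have "integral {0..T} (\<lambda>t. \<psi> t * W t) - integral {0..T} (\<lambda>t. \<psi> t * c) = 0"
      using \<psi>int by simp
    then have "integral {0..T} (\<lambda>t. \<psi> t * W t - \<psi> t * c) = 0"
      by (subst integral_diff) (auto intro!: i continuous_intros W \<psi>)
    also have "(\<lambda>t. \<psi> t * W t - \<psi> t * c) = (\<lambda>t. \<theta> t * (W t - c)\<^sup>2)"
      by (auto simp: \<psi>_def power2_eq_square algebra_simps)
    finally have "integral {0..T} (\<lambda>t. \<theta> t * (W t - c)\<^sup>2) = 0" .
    moreover have "continuous_on {0..T} (\<lambda>t. \<theta> t * (W t - c)\<^sup>2)"
      by (rule continuous_on_subset[of UNIV]) (auto intro!: continuous_intros W \<theta>)
    ultimately have z: "\<forall>t\<in>{0..T}. \<theta> t * (W t - c)\<^sup>2 = 0"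
      using integral_eq_0_iff[of 0 T "\<lambda>t. \<theta> t * (W t - c)\<^sup>2"] T \<theta>nn by auto
    have "w r \<bullet> b = c" if "r \<in> {\<alpha><..<\<beta>}" for r
    proof -
      have "\<theta> r * (W r - c)\<^sup>2 = 0" using z that ab by auto
      then have "W r = c" using \<theta>pos[OF that] by simp
      then show ?thesis using that ab by (auto simp: W_def max_def min_def)
    qed
    then show ?thesis by blast
  qed
  have inner_eq: "w r = w s" if rs: "0 < r" "r < s" "s < T" for r s
  proof (rule euclidean_eqI)
    fix b :: 'a assume "b \<in> Basis"
    with loc[of "r / 2" "(s + T) / 2" b] rs
    obtain c where "\<And>x. x \<in> {r / 2<..<(s + T) / 2} \<Longrightarrow> w x \<bullet> b = c" by auto
    from this[of r] this[of s] show "w r \<bullet> b = w s \<bullet> b" using rs by auto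
  qed
  define c where "c = w (T / 2)"
  have "w r = c" if "r \<in> {0<..<T}" for r
  proof (cases r "T / 2" rule: linorder_cases)
    case less
    then show ?thesis using inner_eq[of r "T / 2"] that by (auto simp: c_def)
  next
    case greater
    then show ?thesis using inner_eq[of "T / 2" r] that T unfolding c_def by auto
  next
    case equal
    show ?thesis unfolding c_def equal ..
  qed
  then have "w r = c" if "r \<in> closure {0<..<T}" for r
    using continuous_constant_on_closure[of "{0<..<T}" w c r] w that T by (auto simp: closure_greaterThanLessThan)
  then show ?thesis using t T by (auto simp: closure_greaterThanLessThan)
qed

lemma weak_derivative_imp_primitive:
  fixes u g :: "real \<Rightarrow> 'a::euclidean_space"
  assumes T: "0 < T" and u: "continuous_on {0..T} u" and g: "g \<in> L2 T"
    and weak: "has_weak_derivative T u g" and t: "t \<in> {0..T}"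
  shows "u t = u 0 + integral {0..t} g"
proof -
  define G where "G t = integral {0..t} g" for t
  have G: "continuous_on {0..T} G"
    unfolding G_def by (rule indefinite_integral_continuous_1[OF L2_integrable[OF g]])
  have "has_weak_derivative T G g"
    by (rule primitive_has_weak_derivative[OF T g]) (auto simp: G_def)
  have "has_weak_derivative T (\<lambda>t. u t - G t) (\<lambda>_. 0)"
    unfolding has_weak_derivative_def
  proof (intro allI impI)
    fix \<phi> assume \<phi>: "test_function T \<phi>"
    note d = test_function_deriv[OF \<phi>]
    have i: "integrable (lebesgue_on {0<..<T}) (\<lambda>t. deriv \<phi> t *\<^sub>R v t)" if "continuous_on {0..T} v" for v :: "real \<Rightarrow> 'a"
      unfolding integrable_lebesgue_on_Ioo_iff
      by (intro absolutely_integrable_continuous_real continuous_intros that continuous_on_subset[OF d(2)]) auto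
    show "(LINT t|lebesgue_on {0<..<T}. deriv \<phi> t *\<^sub>R (u t - G t)) = - (LINT t|lebesgue_on {0<..<T}. \<phi> t *\<^sub>R 0)"
      using weak \<open>has_weak_derivative T G g\<close> \<phi> i[OF u] i[OF G]
      by (simp add: has_weak_derivative_def scaleR_diff_right)
  qed
  from weak_derivative_zero_imp_constant[OF T _ this t]
  show ?thesis using u G by (simp add: G_def continuous_on_diff algebra_simps)
qed

text \<open>The weak derivative is an arbitrary representative; through its primitive it is identified almost
everywhere.\<close>

lemma primitive_density_unique:
  fixes f g :: "real \<Rightarrow> 'a::euclidean_space"
  assumes T: "0 < T" and f: "f absolutely_integrable_on {0..T}" and g: "g absolutely_integrable_on {0..T}"
    and eq: "\<And>t. t \<in> {0..T} \<Longrightarrow> integral {0..t} f = integral {0..t} g"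
  shows "negligible {t \<in> {0..T}. f t \<noteq> g t}"
proof -
  have z: "negligible {t \<in> {0..T}. (f t - g t) \<bullet> v < 0}" for v
  proof (rule AE_nonneg_if_interval_integrals_nonneg[OF T])
    have fg: "(\<lambda>t. f t - g t) absolutely_integrable_on {0..T}"
      using f g by (rule set_integral_diff)
    show "(\<lambda>t. (f t - g t) \<bullet> v) absolutely_integrable_on {0..T}"
      using absolutely_integrable_linear[OF fg bounded_linear_inner_left[of v]] by (simp add: o_def)
    fix s t :: real assume st: "0 \<le> s" "s \<le> t" "t \<le> T"
    have i: "f integrable_on {0..T}" "g integrable_on {0..T}"
      using f g by (auto dest: set_lebesgue_integral_eq_integral(1))
    have j: "f integrable_on {s..t}" "g integrable_on {s..t}"
      by (rule integrable_subinterval_real[OF i(1)], use st in simp)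
         (rule integrable_subinterval_real[OF i(2)], use st in simp)
    have "integral {s..t} f = integral {s..t} g"
      using integral_Icc_diff[OF i(1) st] integral_Icc_diff[OF i(2) st] eq[of s] eq[of t] st by auto
    then have "integral {s..t} (\<lambda>t. f t - g t) = 0"
      using j by (simp add: integral_diff)
    then show "0 \<le> integral {s..t} (\<lambda>t. (f t - g t) \<bullet> v)"
      using integral_linear[OF integrable_diff[OF j] bounded_linear_inner_left[of v]] by (simp add: o_def)
  qed
  have "negligible (\<Union>b\<in>Basis. {t \<in> {0..T}. (f t - g t) \<bullet> b < 0} \<union> {t \<in> {0..T}. (f t - g t) \<bullet> (- b) < 0})"
    by (intro negligible_Union finite_imageI ballI) (auto intro!: negligible_Un z[unfolded atLeastAtMost_iff conj_assoc] simp del: inner_minus_right)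
  then show ?thesis
  proof (rule negligible_subset)
    show "{t \<in> {0..T}. f t \<noteq> g t} \<subseteq> (\<Union>b\<in>Basis. {t \<in> {0..T}. (f t - g t) \<bullet> b < 0} \<union> {t \<in> {0..T}. (f t - g t) \<bullet> (- b) < 0})"
    proof
      fix t assume "t \<in> {t \<in> {0..T}. f t \<noteq> g t}"
      then have "t \<in> {0..T}" "f t \<noteq> g t" by auto
      then obtain b where "b \<in> Basis" "f t \<bullet> b \<noteq> g t \<bullet> b"
        using euclidean_eqI by blast
      then show "t \<in> (\<Union>b\<in>Basis. {t \<in> {0..T}. (f t - g t) \<bullet> b < 0} \<union> {t \<in> {0..T}. (f t - g t) \<bullet> (- b) < 0})"
        using \<open>t \<in> {0..T}\<close> by (auto simp: inner_diff_left intro!: bexI[of _ b])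
    qed
  qed
qed

lemma W12_weak_deriv:
  fixes u :: "real \<Rightarrow> 'a::euclidean_space"
  assumes T: "0 < T" and u: "u \<in> W12 T"
  shows "continuous_on {0..T} u" "weak_deriv T u \<in> L2 T"
    and "\<And>t. t \<in> {0..T} \<Longrightarrow> u t = u 0 + integral {0..t} (weak_deriv T u)"
proof -
  show c: "continuous_on {0..T} u" using u by (simp add: W12_def)
  have "\<exists>g. g \<in> L2 T \<and> has_weak_derivative T u g" using u by (auto simp: W12_def)
  from someI_ex[OF this] have *: "weak_deriv T u \<in> L2 T" "has_weak_derivative T u (weak_deriv T u)"
    by (auto simp: weak_deriv_def)
  show "weak_deriv T u \<in> L2 T" by fact
  show "u t = u 0 + integral {0..t} (weak_deriv T u)" if "t \<in> {0..T}" for t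
    by (rule weak_derivative_imp_primitive[OF T c * that])
qed

lemma primitive_W12:
  fixes u g :: "real \<Rightarrow> 'a::euclidean_space"
  assumes T: "0 < T" and g: "g \<in> L2 T"
    and u: "\<And>t. t \<in> {0..T} \<Longrightarrow> u t = u 0 + integral {0..t} g"
  shows "u \<in> W12 T" and "negligible {t \<in> {0..T}. weak_deriv T u t \<noteq> g t}"
proof -
  have "continuous_on {0..T} u" by (rule primitive_continuous[OF L2_integrable[OF g] u])
  then show W: "u \<in> W12 T"
    using primitive_has_weak_derivative[OF T g u] g L2_continuous by (auto simp: W12_def)
  show "negligible {t \<in> {0..T}. weak_deriv T u t \<noteq> g t}"
  proof (rule primitive_density_unique[OF T])
    fix t assume t: "t \<in> {0..T}"
    show "integral {0..t} (weak_deriv T u) = integral {0..t} g"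
      using u[OF t] W12_weak_deriv(3)[OF T W t] by (metis add_left_cancel)
  qed (use g W12_weak_deriv[OF T W] L2_D in auto)
qed

section \<open>Curves of bounded quadratic variation\<close>

lemma summable_L1_imp_AE_summable:
  fixes f :: "nat \<Rightarrow> 'a \<Rightarrow> 'b::{banach, second_countable_topology}"
  assumes f: "\<And>k. integrable M (f k)" and sum: "summable (\<lambda>k. \<integral>x. norm (f k x) \<partial>M)"
  shows "AE x in M. summable (\<lambda>k. norm (f k x))"
proof -
  have [measurable]: "f k \<in> borel_measurable M" for k using f by auto
  have "(\<integral>\<^sup>+x. (\<Sum>k. ennreal (norm (f k x))) \<partial>M) = (\<Sum>k. \<integral>\<^sup>+x. ennreal (norm (f k x)) \<partial>M)"
    by (rule nn_integral_suminf) auto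
  also have "\<dots> = (\<Sum>k. ennreal (\<integral>x. norm (f k x) \<partial>M))"
    by (intro arg_cong[where f = suminf] ext nn_integral_eq_integral integrable_norm f) auto
  also have "\<dots> \<noteq> \<infinity>"
    unfolding infinity_ennreal_def by (rule ennreal_suminf_neq_top[OF sum]) simp
  finally have "AE x in M. (\<Sum>k. ennreal (norm (f k x))) \<noteq> \<infinity>"
    by (intro nn_integral_PInf_AE) measurable
  then show ?thesis
  proof eventually_elim
    case (elim x)
    then show ?case by (intro summable_suminf_not_top) (auto simp: infinity_ennreal_def)
  qed
qed

text \<open>This criterion plays the role of weak compactness of balls in the space of square integrable
functions, since its hypothesis survives pointwise limits of \<open>u\<close>. Let \<open>g n\<close> be the difference quotients of \<open>u\<close> on
the dyadic grid of level \<open>n\<close>. Averaging \<open>g l\<close> over a coarser cell returns \<open>g n\<close>, so \<open>g l - g n\<close> is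
orthogonal to \<open>g n\<close> and the squared distance of \<open>g n\<close> and \<open>g l\<close> is the difference of their squared
norms. These norms increase and are bounded by \<open>M\<close>; so \<open>g\<close> is a Cauchy sequence, and its limit is
the integrand.\<close>

proposition Riesz_bounded_quadratic_variation:
  fixes u :: "real \<Rightarrow> 'a::euclidean_space"
  assumes T: "0 < T" and u: "continuous_on {0..T} u"
    and M: "\<And>N. 0 < N \<Longrightarrow>
      (\<Sum>i<N. (norm (u (real (Suc i) * (T / real N)) - u (real i * (T / real N))))\<^sup>2) \<le> M * (T / real N)"
  obtains g where "g \<in> L2 T" "integral {0..T} (\<lambda>t. (norm (g t))\<^sup>2) \<le> M"
    "\<And>t. t \<in> {0..T} \<Longrightarrow> u t = u 0 + integral {0..t} g"
proof -
  define d where "d n = T / 2 ^ n" for n :: nat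
  define \<Delta> where "\<Delta> n i = u (real (Suc i) * d n) - u (real i * d n)" for n i
  define c where "c n i = (1 / d n) *\<^sub>R \<Delta> n i" for n i
  define g where "g n t = c n (nat \<lfloor>t / d n\<rfloor>)" for n t
  define S where "S n = (\<Sum>i<2^n. (norm (\<Delta> n i))\<^sup>2 / d n)" for n
  have d: "0 < d n" "real (2 ^ n) * d n = T" for n using T by (auto simp: d_def)
  have SM: "S n \<le> M" for n
  proof -
    have "(\<Sum>i<2^n. (norm (\<Delta> n i))\<^sup>2) \<le> M * d n"
      using M[of "2^n"] by (simp add: \<Delta>_def d_def)
    then have "(\<Sum>i<2^n. (norm (\<Delta> n i))\<^sup>2) / d n \<le> M"
      using d(1)[of n] by (simp add: divide_le_eq)
    then show ?thesis by (simp add: S_def sum_divide_distrib)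
  qed
  have cell_le: "real (Suc i) * d n \<le> T" if "i < 2^n" for i n
  proof -
    have "real (Suc i) * d n \<le> real (2^n) * d n"
      using that d(1)[of n] by (intro mult_right_mono of_nat_mono) auto
    then show ?thesis using d(2)[of n] by simp
  qed
  have g_int: "g n absolutely_integrable_on {0..T}" for n
    using cellwise_absolutely_integrable(1)[OF d(1)[of n], of "2^n" "\<lambda>i t. c n i"]
    unfolding d(2) g_def[abs_def] by auto
  have gsq_int: "(\<lambda>t. (norm (g n t))\<^sup>2) absolutely_integrable_on {0..T}" for n
    using cellwise_absolutely_integrable(1)[OF d(1)[of n], of "2^n" "\<lambda>i t. (norm (c n i))\<^sup>2"]
    unfolding d(2) g_def[abs_def] by auto
  have gL2: "g n \<in> L2 T" for n
    using g_int gsq_int by (simp add: L2_iff_absolutely_integrable)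
  have cell_len: "integral {real i * d n..real (Suc i) * d n} (\<lambda>t. x) = d n *\<^sub>R x" for i n and x :: "'b::euclidean_space"
    using d(1)[of n] by (simp add: algebra_simps)
  have gsq: "integral {0..T} (\<lambda>t. (norm (g n t))\<^sup>2) = S n" for n
  proof -
    have "integral {0..T} (\<lambda>t. (norm (g n t))\<^sup>2) = (\<Sum>i<2^n. d n *\<^sub>R (norm (c n i))\<^sup>2)"
      using cellwise_absolutely_integrable(2)[OF d(1)[of n], of "2^n" "\<lambda>i t. (norm (c n i))\<^sup>2"]
      unfolding d(2) g_def[abs_def] cell_len by auto
    also have "\<dots> = S n"
      unfolding S_def using d(1)[of n]
      by (intro sum.cong) (auto simp: c_def power_mult_distrib power2_eq_square divide_simps)
    finally show ?thesis .
  qed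
  have g_grid: "integral {0..real j * d n} (g n) = u (real j * d n) - u 0" for j n
  proof -
    have "integral {0..real j * d n} (g n) = (\<Sum>i<j. d n *\<^sub>R c n i)"
      using cellwise_absolutely_integrable(2)[OF d(1)[of n], of j "\<lambda>i t. c n i"]
      unfolding g_def[abs_def] cell_len by auto
    also have "\<dots> = (\<Sum>i<j. u (real (Suc i) * d n) - u (real i * d n))"
      using d(1)[of n] by (intro sum.cong) (auto simp: c_def \<Delta>_def)
    also have "\<dots> = u (real j * d n) - u 0"
      using sum_lessThan_telescope[of "\<lambda>i. u (real i * d n)" j] by simp
    finally show ?thesis .
  qed
  have g_coarse: "integral {0..real j * d n} (g l) = u (real j * d n) - u 0" if "n \<le> l" for j n l
  proof -
    have "(2::real) ^ l = 2 ^ n * 2 ^ (l - n)" using that by (simp add: power_add[symmetric])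
    then have "real j * d n = real (j * 2 ^ (l - n)) * d l" using T by (simp add: d_def)
    then show ?thesis using g_grid[of "j * 2 ^ (l - n)" l] by (simp del: of_nat_mult)
  qed
  \<comment> \<open>the finer difference quotients have the coarser ones as cell averages\<close>
  have cross: "integral {0..T} (\<lambda>t. g n t \<bullet> g l t) = S n" if "n \<le> l" for n l
  proof -
    have sub: "g l absolutely_integrable_on {real i * d n..real (Suc i) * d n}" if "i < 2^n" for i
      by (rule absolutely_integrable_on_sub_Icc[OF g_int]) (use cell_le[OF that] d(1)[of n] in auto)
    have "(\<lambda>t. c n i \<bullet> g l t) absolutely_integrable_on {real i * d n..real (Suc i) * d n}" if "i < 2^n" for i
      using absolutely_integrable_linear[OF sub[OF that] bounded_linear_inner_right[of "c n i"]] by (simp add: o_def)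
    then have "integral {0..T} (\<lambda>t. g n t \<bullet> g l t) =
        (\<Sum>i<2^n. integral {real i * d n..real (Suc i) * d n} (\<lambda>t. c n i \<bullet> g l t))"
      using cellwise_absolutely_integrable(2)[OF d(1)[of n], of "2^n" "\<lambda>i t. c n i \<bullet> g l t"]
      unfolding d(2) g_def[of n] by auto
    also have "\<dots> = (\<Sum>i<2^n. c n i \<bullet> \<Delta> n i)"
    proof (intro sum.cong refl)
      fix i :: nat assume "i \<in> {..<2^n}"
      then have i: "i < 2^n" by simp
      have "integral {real i * d n..real (Suc i) * d n} (g l) = \<Delta> n i"
        using integral_Icc_diff[of "g l" 0 T "real i * d n" "real (Suc i) * d n"] g_coarse[OF that]
          L2_integrable[OF gL2] cell_le[OF i] d(1)[of n]
        by (simp add: \<Delta>_def mult_right_mono del: of_nat_Suc)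
      then show "integral {real i * d n..real (Suc i) * d n} (\<lambda>t. c n i \<bullet> g l t) = c n i \<bullet> \<Delta> n i"
        using integral_linear[OF set_lebesgue_integral_eq_integral(1)[OF sub[OF i]] bounded_linear_inner_right[of "c n i"]]
        by (simp add: o_def)
    qed
    also have "\<dots> = S n"
      unfolding S_def by (intro sum.cong) (auto simp: c_def power2_norm_eq_inner)
    finally show ?thesis .
  qed
  have pyth: "integral {0..T} (\<lambda>t. (norm (g l t - g n t))\<^sup>2) = S l - S n" if "n \<le> l" for n l
  proof -
    have "(\<lambda>t. (norm (g l t - g n t))\<^sup>2) = (\<lambda>t. (norm (g l t))\<^sup>2 - 2 *\<^sub>R (g n t \<bullet> g l t) + (norm (g n t))\<^sup>2)"
      by (auto simp: power2_norm_eq_inner inner_diff inner_commute)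
    then show ?thesis
      using L2_norm_sq_integrable[OF gL2] L2_inner[OF gL2 gL2] cross[OF that] gsq
      by (simp add: integral_add integral_diff integrable_diff set_lebesgue_integral_eq_integral(1))
  qed
  have S_mono: "S n \<le> S l" if "n \<le> l" for n l
    using integral_nonneg[OF L2_norm_sq_integrable[OF L2_diff[OF gL2[of l] gL2[of n]]]] pyth[OF that] by simp
  \<comment> \<open>a subsequence along which the increments of \<open>g\<close> are absolutely summable almost everywhere\<close>
  obtain r :: "nat \<Rightarrow> nat" where r: "strict_mono r" "\<And>k. S (r (Suc k)) - S (r k) \<le> (1/4)^k"
  proof -
    obtain L where "S \<longlonglongrightarrow> L"
      by (rule incseq_convergent[of S M]) (use S_mono SM in \<open>auto simp: incseq_def\<close>)
    then have "convergent S" by (rule convergentI)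
    then have "Cauchy S" by (rule convergent_Cauchy)
    then have ex: "\<exists>N. \<forall>l\<ge>N. \<bar>S l - S N\<bar> < (1/4)^k" for k
      using \<open>Cauchy S\<close>[unfolded Cauchy_altdef2 dist_real_def, rule_format, of "(1/4)^k"] by auto
    have "\<exists>f. \<forall>k. (\<forall>l\<ge>f k. \<bar>S l - S (f k)\<bar> < (1/4)^k) \<and> f k < f (Suc k)"
    proof (rule dependent_nat_choice)
      fix x k
      obtain N where "\<forall>l\<ge>N. \<bar>S l - S N\<bar> < (1/4)^(Suc (Suc k))" using ex by blast
      then have *: "\<bar>S l - S N\<bar> < (1/4)^(Suc (Suc k))" if "l \<ge> N" for l using that by blast
      have "\<bar>S l - S (max N (Suc x))\<bar> < (1/4)^Suc k" if "l \<ge> max N (Suc x)" for l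
      proof -
        have "(1/4::real)^Suc (Suc k) = (1/4)^Suc k / 4" by simp
        moreover have "0 < (1/4::real)^Suc k" by simp
        ultimately show ?thesis using *[of l] *[of "max N (Suc x)"] that by linarith
      qed
      then show "\<exists>y. (\<forall>l\<ge>y. \<bar>S l - S y\<bar> < (1/4)^Suc k) \<and> x < y"
        by (intro exI[of _ "max N (Suc x)"]) auto
    qed (use ex in blast)
    then obtain f where f: "\<And>k l. l \<ge> f k \<Longrightarrow> \<bar>S l - S (f k)\<bar> < (1/4)^k" "\<And>k. f k < f (Suc k)" by blast
    show ?thesis
    proof (rule that)
      show "strict_mono f" using f(2) by (simp add: strict_mono_Suc_iff)
      show "S (f (Suc k)) - S (f k) \<le> (1/4)^k" for k
        using f(1)[of k "f (Suc k)"] f(2)[of k] by (simp add: abs_less_iff less_imp_le)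
    qed
  qed
  define f where "f k t = g (r (Suc k)) t - g (r k) t" for k t
  have fL2: "f k \<in> L2 T" for k unfolding f_def[abs_def] by (intro L2_diff gL2)
  have f_norm: "integral {0..T} (\<lambda>t. norm (f k t)) \<le> (1 + T) * (1/2)^k" for k
  proof -
    \<comment> \<open>weighted so that both terms are of order \<open>(1/2)^k\<close> after integration\<close>
    have "norm x \<le> 2^k * (norm x)\<^sup>2 + (1/2)^k" for x :: 'a
    proof -
      have "0 \<le> (2^k * norm x - 1)\<^sup>2" by simp
      then have "2 * (2^k * norm x) \<le> (2^k * norm x)\<^sup>2 + 1" by (simp add: power2_diff)
      moreover have "0 \<le> 2^k * norm x" by simp
      ultimately have "2^k * norm x \<le> (2^k * norm x)\<^sup>2 + 1" by linarith
      then have "(1/2)^k * (2^k * norm x) \<le> (1/2)^k * ((2^k * norm x)\<^sup>2 + 1)" by (intro mult_left_mono) auto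
      also have "(1/2)^k * (2^k * norm x) = norm x" by (simp add: power_divide)
      also have "(1/2)^k * ((2^k * norm x)\<^sup>2 + 1) = 2^k * (norm x)\<^sup>2 + (1/2)^k"
        by (simp add: power_divide field_simps power2_eq_square)
      finally show ?thesis .
    qed
    then have "integral {0..T} (\<lambda>t. norm (f k t)) \<le> integral {0..T} (\<lambda>t. 2^k * (norm (f k t))\<^sup>2 + (1/2)^k)"
      by (intro integral_le integrable_add integrable_on_mult_right L2_norm_sq_integrable[OF fL2]
          set_lebesgue_integral_eq_integral(1)[OF set_integrable_norm[OF L2_D(1)[OF fL2]]]) auto
    also have "\<dots> = 2^k * integral {0..T} (\<lambda>t. (norm (f k t))\<^sup>2) + T * (1/2)^k"
      using T by (subst integral_add) (auto intro!: integrable_on_mult_right L2_norm_sq_integrable[OF fL2])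
    also have "integral {0..T} (\<lambda>t. (norm (f k t))\<^sup>2) \<le> (1/4)^k"
      unfolding f_def using pyth[of "r k" "r (Suc k)"] r by (simp add: strict_mono_less_eq)
    then have "2^k * integral {0..T} (\<lambda>t. (norm (f k t))\<^sup>2) \<le> 2^k * (1/4)^k" by (intro mult_left_mono) auto
    also have "2^k * (1/4::real)^k = (1/2)^k" by (simp add: power_mult_distrib[symmetric])
    finally show ?thesis by (simp add: algebra_simps)
  qed
  have f_intM: "integrable (lebesgue_on {0..t}) (f k)" if "t \<in> {0..T}" for k t
  proof -
    have "f k absolutely_integrable_on {0..t}"
      by (rule absolutely_integrable_on_sub_Icc[OF L2_D(1)[OF fL2]]) (use that in auto)
    then show ?thesis by (simp add: set_integrable_def integrable_restrict_space)
  qed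
  have f_sum: "summable (\<lambda>k. LINT x|lebesgue_on {0..t}. norm (f k x))" if t: "t \<in> {0..T}" for t
  proof (rule summable_comparison_test)
    show "summable (\<lambda>k. (1 + T) * (1/2)^k)" by (intro summable_mult summable_geometric) auto
    have "norm (LINT x|lebesgue_on {0..t}. norm (f k x)) \<le> (1 + T) * (1/2)^k" for k
    proof -
      have i: "(\<lambda>x. norm (f k x)) integrable_on {0..T}"
        by (rule set_lebesgue_integral_eq_integral(1)[OF set_integrable_norm[OF L2_D(1)[OF fL2]]])
      have i': "(\<lambda>x. norm (f k x)) integrable_on {0..t}"
        by (rule integrable_subinterval_real[OF i]) (use t in auto)
      have "(LINT x|lebesgue_on {0..t}. norm (f k x)) = integral {0..t} (\<lambda>x. norm (f k x))"
        using f_intM[OF t] by (intro lebesgue_integral_eq_integral) auto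
      also have "\<dots> \<le> integral {0..T} (\<lambda>x. norm (f k x))"
        using t by (intro integral_subset_le i i') auto
      also have "\<dots> \<le> (1 + T) * (1/2)^k" by (rule f_norm)
      finally show ?thesis by simp
    qed
    then show "\<exists>N. \<forall>n\<ge>N. norm (LINT x|lebesgue_on {0..t}. norm (f n x)) \<le> (1 + T) * (1/2)^n" by blast
  qed
  have "AE x in lebesgue_on {0..T}. summable (\<lambda>k. norm (f k x))"
    using f_intM f_sum T by (intro summable_L1_imp_AE_summable) auto
  then obtain Z where Z: "negligible Z" "\<And>x. x \<in> {0..T} - Z \<Longrightarrow> summable (\<lambda>k. norm (f k x))"
    by (auto simp: AE_lebesgue_on_iff_negligible)
  define G where "G t = g (r 0) t + (\<Sum>k. f k t)" for t
  have f_partial: "(\<Sum>k<K. f k t) = g (r K) t - g (r 0) t" for K t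
    unfolding f_def by (rule sum_lessThan_telescope)
  have G_lim: "(\<lambda>K. g (r K) t) \<longlonglongrightarrow> G t" if "t \<in> {0..T} - Z" for t
  proof -
    have "(\<lambda>K. g (r 0) t + (\<Sum>k<K. f k t)) \<longlonglongrightarrow> G t"
      unfolding G_def
      by (rule tendsto_add[OF tendsto_const summable_LIMSEQ[OF summable_norm_cancel[OF Z(2)[OF that]]]])
    then show ?thesis by (simp add: f_partial)
  qed
  have AEt: "AE x in lebesgue_on {0..t}. summable (\<lambda>k. norm (f k x))" if "t \<in> {0..T}" for t
    using Z that by (auto simp: AE_lebesgue_on_iff_negligible intro!: exI[of _ Z])
  have sumf_int: "integrable (lebesgue_on {0..t}) (\<lambda>x. \<Sum>k. f k x)" if "t \<in> {0..T}" for t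
    by (rule integrable_suminf[OF f_intM[OF that] AEt[OF that] f_sum[OF that]])
  have G_int: "G absolutely_integrable_on {0..T}"
  proof -
    have "(\<lambda>x. \<Sum>k. f k x) absolutely_integrable_on {0..T}"
      using sumf_int[of T] T by (simp add: set_integrable_def integrable_restrict_space)
    then show ?thesis unfolding G_def[abs_def] using g_int by (intro set_integral_add(1))
  qed
  have int_lim: "(\<lambda>K. integral {0..t} (g (r K))) \<longlonglongrightarrow> integral {0..t} G" if t: "t \<in> {0..T}" for t
  proof -
    have i: "g n integrable_on {0..t}" for n
      by (rule integrable_subinterval_real[OF L2_integrable[OF gL2]]) (use t in auto)
    have sf: "(\<lambda>x. \<Sum>k. f k x) integrable_on {0..t}"
      by (rule integrable_on_lebesgue_on[OF sumf_int[OF t]]) auto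
    have "(\<lambda>k. LINT x|lebesgue_on {0..t}. f k x) sums (LINT x|lebesgue_on {0..t}. (\<Sum>k. f k x))"
      by (rule sums_integral[OF f_intM[OF t] AEt[OF t] f_sum[OF t]])
    moreover have "(LINT x|lebesgue_on {0..t}. f k x) = integral {0..t} (g (r (Suc k))) - integral {0..t} (g (r k))" for k
      unfolding lebesgue_integral_eq_integral[OF f_intM[OF t], simplified]
      unfolding f_def by (rule integral_diff[OF i i])
    moreover have "(LINT x|lebesgue_on {0..t}. (\<Sum>k. f k x)) = integral {0..t} (\<lambda>x. \<Sum>k. f k x)"
      using sumf_int[OF t] by (intro lebesgue_integral_eq_integral) auto
    ultimately have "(\<lambda>K. integral {0..t} (g (r K)) - integral {0..t} (g (r 0))) \<longlonglongrightarrow> integral {0..t} (\<lambda>x. \<Sum>k. f k x)"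
      by (simp add: sums_def sum_lessThan_telescope[of "\<lambda>k. integral {0..t} (g (r k))"])
    from tendsto_add[OF tendsto_const this, of "integral {0..t} (g (r 0))"]
    show ?thesis using i sf by (simp add: G_def[abs_def] integral_add)
  qed
  have G_grid: "u (real j * d n) = u 0 + integral {0..real j * d n} G" if "real j * d n \<le> T" for j n
  proof -
    have t: "real j * d n \<in> {0..T}" using that d(1)[of n] by auto
    have "\<forall>\<^sub>F K in sequentially. integral {0..real j * d n} (g (r K)) = u (real j * d n) - u 0"
      using eventually_ge_at_top[of n]
    proof eventually_elim
      case (elim K)
      then have "n \<le> r K" using seq_suble[OF r(1), of K] by linarith
      then show ?case by (rule g_coarse)
    qed
    then have "(\<lambda>K. integral {0..real j * d n} (g (r K))) \<longlonglongrightarrow> u (real j * d n) - u 0"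
      by (rule tendsto_eventually)
    with int_lim[OF t] have "integral {0..real j * d n} G = u (real j * d n) - u 0"
      using LIMSEQ_unique by blast
    then show ?thesis by simp
  qed
  have G_prim: "u t = u 0 + integral {0..t} G" if t: "t \<in> {0..T}" for t
  proof -
    define s where "s n = real (nat \<lfloor>t / d n\<rfloor>) * d n" for n
    have sn: "0 \<le> s n" "s n \<le> t" "t - d n \<le> s n" for n
    proof -
      have "0 \<le> t / d n" using t d(1)[of n] by simp
      then have "real (nat \<lfloor>t / d n\<rfloor>) \<le> t / d n" "t / d n - 1 \<le> real (nat \<lfloor>t / d n\<rfloor>)" by linarith+
      then show "0 \<le> s n" "s n \<le> t" "t - d n \<le> s n"
        using d(1)[of n] by (auto simp: s_def field_simps)
    qed
    have "d \<longlonglongrightarrow> 0"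
      unfolding d_def[abs_def] by (rule LIMSEQ_divide_realpow_zero) simp
    then have "(\<lambda>n. t - d n) \<longlonglongrightarrow> t" by (auto intro!: tendsto_eq_intros)
    then have "s \<longlonglongrightarrow> t"
      by (rule tendsto_sandwich[OF _ _ _ tendsto_const, rotated 2]) (use sn in auto)
    moreover have "s n \<in> {0..T}" for n using sn[of n] t by auto
    ultimately have lim: "(\<lambda>n. v (s n)) \<longlonglongrightarrow> v t" if "continuous_on {0..T} v" for v :: "real \<Rightarrow> 'a"
      using continuous_on_tendsto_compose[OF that, of s t sequentially] t by auto
    have "continuous_on {0..T} (\<lambda>t. u 0 + integral {0..t} G)"
      using G_int by (intro continuous_intros indefinite_integral_continuous_1 set_lebesgue_integral_eq_integral(1))
    then have "(\<lambda>n. u 0 + integral {0..s n} G) \<longlonglongrightarrow> u 0 + integral {0..t} G"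
      by (rule lim)
    moreover have "u 0 + integral {0..s n} G = u (s n)" for n
    proof -
      have "s n \<le> T" using sn(2)[of n] t by auto
      then show ?thesis unfolding s_def by (rule G_grid[symmetric])
    qed
    ultimately have "(\<lambda>n. u (s n)) \<longlonglongrightarrow> u 0 + integral {0..t} G" by simp
    with lim[OF u] show ?thesis by (rule LIMSEQ_unique)
  qed
  have Gm: "(\<lambda>t. (norm (G t))\<^sup>2) \<in> borel_measurable (lebesgue_on {0..T})"
    using absolutely_integrable_imp_borel_measurable[OF G_int] by auto
  have fatou: "(\<integral>\<^sup>+t. ennreal ((norm (G t))\<^sup>2) \<partial>lebesgue_on {0..T}) \<le> ennreal M"
  proof -
    have "(\<integral>\<^sup>+t. ennreal ((norm (G t))\<^sup>2) \<partial>lebesgue_on {0..T}) =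
          (\<integral>\<^sup>+t. liminf (\<lambda>K. ennreal ((norm (g (r K) t))\<^sup>2)) \<partial>lebesgue_on {0..T})"
    proof (rule nn_integral_cong_AE)
      have "AE t in lebesgue_on {0..T}. (\<lambda>K. g (r K) t) \<longlonglongrightarrow> G t"
        using Z(1) G_lim by (auto simp: AE_lebesgue_on_iff_negligible)
      then show "AE t in lebesgue_on {0..T}. ennreal ((norm (G t))\<^sup>2) = liminf (\<lambda>K. ennreal ((norm (g (r K) t))\<^sup>2))"
      proof eventually_elim
        case (elim t)
        then have "(\<lambda>K. ennreal ((norm (g (r K) t))\<^sup>2)) \<longlonglongrightarrow> ennreal ((norm (G t))\<^sup>2)"
          by (intro tendsto_ennrealI tendsto_intros)
        from lim_imp_Liminf[OF _ this] show ?case by simp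
      qed
    qed
    also have "\<dots> \<le> liminf (\<lambda>K. \<integral>\<^sup>+t. ennreal ((norm (g (r K) t))\<^sup>2) \<partial>lebesgue_on {0..T})"
      using absolutely_integrable_imp_borel_measurable[OF g_int] by (intro nn_integral_liminf) auto
    also have "(\<lambda>K. \<integral>\<^sup>+t. ennreal ((norm (g (r K) t))\<^sup>2) \<partial>lebesgue_on {0..T}) = (\<lambda>K. ennreal (S (r K)))"
    proof
      fix K
      have i: "integrable (lebesgue_on {0..T}) (\<lambda>t. (norm (g (r K) t))\<^sup>2)"
        using gsq_int by (simp add: set_integrable_def integrable_restrict_space)
      then show "(\<integral>\<^sup>+t. ennreal ((norm (g (r K) t))\<^sup>2) \<partial>lebesgue_on {0..T}) = ennreal (S (r K))"
        using gsq[of "r K"] by (subst nn_integral_eq_integral) (auto simp: lebesgue_integral_eq_integral)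
    qed
    also have "liminf (\<lambda>K. ennreal (S (r K))) \<le> liminf (\<lambda>K. ennreal M)"
      by (intro Liminf_mono always_eventually allI ennreal_leI SM)
    finally show ?thesis by (simp add: Liminf_const)
  qed
  have M0: "0 \<le> M" using SM[of 0] d(1)[of 0] by (auto simp: S_def intro: order_trans[rotated])
  have Gsq: "integrable (lebesgue_on {0..T}) (\<lambda>t. (norm (G t))\<^sup>2)"
    using fatou Gm by (intro integrableI_bounded) (auto simp: le_less_trans)
  have "(\<lambda>t. (norm (G t))\<^sup>2) absolutely_integrable_on {0..T}"
    using Gsq by (simp add: set_integrable_def integrable_restrict_space)
  with G_int have "G \<in> L2 T" by (simp add: L2_iff_absolutely_integrable)
  moreover have "integral {0..T} (\<lambda>t. (norm (G t))\<^sup>2) \<le> M"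
    using fatou nn_integral_eq_integral[OF Gsq] M0 lebesgue_integral_eq_integral[OF Gsq] by simp
  ultimately show ?thesis using that G_prim by blast
qed

section \<open>Subgradients of finite convex functions\<close>

definition is_subgradient :: "('a::real_inner \<Rightarrow> real) \<Rightarrow> 'a \<Rightarrow> 'a \<Rightarrow> bool" where
  "is_subgradient \<phi> x \<eta> \<longleftrightarrow> (\<forall>z. \<phi> x + \<eta> \<bullet> (z - x) \<le> \<phi> z)"

lemma subdifferential_ereal_iff:
  "\<eta> \<in> subdifferential (\<lambda>z. ereal (\<phi> z)) x \<longleftrightarrow> is_subgradient \<phi> x \<eta>"
  by (auto simp: subdifferential_def is_subgradient_def algebra_simps)

text \<open>Separate the strict epigraph of \<open>\<phi>\<close> from the graph of the affine minorant over the affine subspace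
\<open>x + range A\<close>. The separating hyperplane is not vertical because \<open>\<phi>\<close> is finite everywhere. The
lemma is used for \<open>A = 0\<close>, where it gives subgradients, and for a coordinate projection, where it
says that each subgradient of the restricted function is the projection of a full one.\<close>

lemma Hahn_Banach_subgradient:
  fixes \<phi> :: "'a::euclidean_space \<Rightarrow> real" and A :: "'b::euclidean_space \<Rightarrow> 'a"
  assumes \<phi>: "convex_on UNIV \<phi>" and A: "linear A"
    and c: "\<And>y. \<phi> x + c \<bullet> y \<le> \<phi> (x + A y)"
  obtains \<eta> where "is_subgradient \<phi> x \<eta>" "\<And>y. \<eta> \<bullet> A y = c \<bullet> y"
proof -
  let ?E = "{(z, r). \<phi> z < r}" and ?F = "range (\<lambda>y. (x + A y, \<phi> x + c \<bullet> y))"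
  have "convex ?E"
  proof (rule convexI)
    fix p q :: "'a \<times> real" and u v :: real
    assume pq: "p \<in> ?E" "q \<in> ?E" and uv: "0 \<le> u" "0 \<le> v" "u + v = 1"
    obtain z r z' r' where [simp]: "p = (z, r)" "q = (z', r')" by (cases p, cases q) auto
    have "\<phi> (u *\<^sub>R z + v *\<^sub>R z') \<le> u * \<phi> z + v * \<phi> z'"
      using \<phi> uv by (auto simp: convex_on_def)
    also have "\<dots> < u * r + v * r'"
    proof (cases "u = 0")
      case True
      then show ?thesis using pq uv by simp
    next
      case False
      then show ?thesis using pq uv by (intro add_less_le_mono mult_strict_left_mono mult_left_mono) auto
    qed
    finally show "u *\<^sub>R p + v *\<^sub>R q \<in> ?E" by simp
  qed
  moreover have "convex ?F"
  proof (rule convexI)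
    fix p q and u v :: real
    assume "p \<in> ?F" "q \<in> ?F" and uv: "0 \<le> u" "0 \<le> v" "u + v = 1"
    then obtain y y' where pq: "p = (x + A y, \<phi> x + c \<bullet> y)" "q = (x + A y', \<phi> x + c \<bullet> y')" by auto
    have "u *\<^sub>R x + v *\<^sub>R x = x" "u * \<phi> x + v * \<phi> x = \<phi> x"
      using uv by (simp_all flip: scaleR_add_left distrib_right)
    then have "u *\<^sub>R p + v *\<^sub>R q = (x + A (u *\<^sub>R y + v *\<^sub>R y'), \<phi> x + c \<bullet> (u *\<^sub>R y + v *\<^sub>R y'))"
      using A by (simp add: pq linear_add linear_scale inner_add_right scaleR_add_right distrib_left add_ac)
    then show "u *\<^sub>R p + v *\<^sub>R q \<in> ?F" by blast
  qed
  moreover have "?E \<inter> ?F = {}" by (auto elim: notE[OF leD[OF c]])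
  moreover have "(x, \<phi> x + 1) \<in> ?E" by simp
  then have "?E \<noteq> {}" by blast
  ultimately obtain n b where n: "n \<noteq> 0" and sep: "\<And>p. p \<in> ?E \<Longrightarrow> n \<bullet> p \<le> b" "\<And>p. p \<in> ?F \<Longrightarrow> b \<le> n \<bullet> p"
    using separating_hyperplane_sets[of ?E ?F] by blast
  obtain a \<alpha> where na: "n = (a, \<alpha>)" by (cases n)
  have E: "a \<bullet> z + \<alpha> * r \<le> b" if "\<phi> z < r" for z r
    using sep(1)[of "(z, r)"] that by (simp add: na)
  have F: "b \<le> a \<bullet> (x + A y) + \<alpha> * (\<phi> x + c \<bullet> y)" for y
    using sep(2)[of "(x + A y, \<phi> x + c \<bullet> y)"] by (auto simp: na)
  have key: "a \<bullet> z + \<alpha> * \<phi> z \<le> a \<bullet> (x + A y) + \<alpha> * (\<phi> x + c \<bullet> y)" for z y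
  proof -
    have lim: "((\<lambda>r. a \<bullet> z + \<alpha> * r) \<longlongrightarrow> a \<bullet> z + \<alpha> * \<phi> z) (at_right (\<phi> z))"
      by (intro tendsto_intros)
    have "\<forall>\<^sub>F r in at_right (\<phi> z). a \<bullet> z + \<alpha> * r \<le> b"
      using eventually_at_right_less by eventually_elim (rule E)
    from tendsto_upperbound[OF lim this] have "a \<bullet> z + \<alpha> * \<phi> z \<le> b" by simp
    then show ?thesis using F by (rule order_trans)
  qed
  have A0: "A 0 = 0" using A by (rule linear_0)
  have "\<alpha> \<le> 0"
    using E[of x "\<phi> x + 1"] F[of 0] by (simp add: A0 algebra_simps)
  moreover have "\<alpha> \<noteq> 0"
  proof
    assume "\<alpha> = 0"
    with key[of "x + a" 0] have "a \<bullet> a \<le> 0" by (simp add: A0 inner_add_right)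
    then have "a = 0" by (metis inner_ge_zero inner_eq_zero_iff order_antisym)
    then show False using n na \<open>\<alpha> = 0\<close> by (simp add: zero_prod_def)
  qed
  ultimately have \<beta>: "0 < - \<alpha>" by simp
  define \<eta> where "\<eta> = (1 / (- \<alpha>)) *\<^sub>R a"
  have a: "a = (- \<alpha>) *\<^sub>R \<eta>" using \<beta> by (simp add: \<eta>_def)
  have key': "\<eta> \<bullet> (z - x - A y) \<le> \<phi> z - \<phi> x - c \<bullet> y" for z y
  proof -
    have "(- \<alpha>) * (\<eta> \<bullet> (z - x - A y)) \<le> (- \<alpha>) * (\<phi> z - \<phi> x - c \<bullet> y)"
      using key[of z y] by (simp add: a inner_diff_right inner_add_right algebra_simps)
    then show ?thesis using \<beta> by (rule mult_left_le_imp_le)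
  qed
  show ?thesis
  proof (rule that)
    show "is_subgradient \<phi> x \<eta>"
      unfolding is_subgradient_def using key'[of _ 0] by (auto simp: A0 algebra_simps)
    show "\<eta> \<bullet> A y = c \<bullet> y" for y
      using key'[of x y] key'[of x "- y"] A by (simp add: linear_neg)
  qed
qed

lemma subgradient_exists:
  fixes \<phi> :: "'a::euclidean_space \<Rightarrow> real"
  assumes "convex_on UNIV \<phi>"
  shows "\<exists>\<eta>. is_subgradient \<phi> x \<eta>"
  by (rule Hahn_Banach_subgradient[OF assms, of "\<lambda>_::real. 0" x 0]) (auto intro: linearI)

lemma Lipschitz_subgradient_bound:
  fixes \<phi> :: "'a::real_inner \<Rightarrow> real"
  assumes "is_subgradient \<phi> x \<eta>" and lip: "\<And>y. \<bar>\<phi> y - \<phi> x\<bar> \<le> L * norm (y - x)"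
    and "0 \<le> L"
  shows "norm \<eta> \<le> L"
proof (cases "\<eta> = 0")
  case True
  then show ?thesis using \<open>0 \<le> L\<close> by simp
next
  case False
  have "\<phi> x + \<eta> \<bullet> (x + \<eta> - x) \<le> \<phi> (x + \<eta>)" using assms(1) unfolding is_subgradient_def by blast
  then have "(norm \<eta>)\<^sup>2 \<le> \<phi> (x + \<eta>) - \<phi> x" by (simp add: power2_norm_eq_inner)
  also have "\<dots> \<le> L * norm \<eta>" using lip[of "x + \<eta>"] by simp
  finally show ?thesis using False by (simp add: power2_eq_square)
qed

lemma convex_imp_continuous:
  fixes \<phi> :: "'a::euclidean_space \<Rightarrow> real"
  assumes "convex_on UNIV \<phi>" shows "continuous_on UNIV \<phi>"
  using convex_on_continuous[OF open_UNIV assms] .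

lemma continuous_bounded_cball:
  fixes \<phi> :: "'a::euclidean_space \<Rightarrow> real"
  assumes "continuous_on UNIV \<phi>"
  obtains B where "0 \<le> B" "\<And>x. norm x \<le> R \<Longrightarrow> \<bar>\<phi> x\<bar> \<le> B"
proof -
  have "compact (\<phi> ` cball 0 R)"
    by (intro compact_continuous_image continuous_on_subset[OF assms]) auto
  then obtain B where "\<And>y. y \<in> \<phi> ` cball 0 R \<Longrightarrow> norm y \<le> B"
    using compact_imp_bounded bounded_iff by metis
  then have "\<bar>\<phi> x\<bar> \<le> max 0 B" if "norm x \<le> R" for x
  proof -
    have "\<phi> x \<in> \<phi> ` cball 0 R" using that by (intro imageI) simp
    then have "norm (\<phi> x) \<le> B" by fact
    then show ?thesis by simp
  qed
  then show ?thesis using that[of "max 0 B"] by simp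
qed

lemma subgradient_locally_bounded:
  fixes \<phi> :: "'a::euclidean_space \<Rightarrow> real"
  assumes "convex_on UNIV \<phi>"
  obtains L where "0 \<le> L" "\<And>x \<eta>. norm x \<le> R \<Longrightarrow> is_subgradient \<phi> x \<eta> \<Longrightarrow> norm \<eta> \<le> L"
proof -
  obtain B where B: "0 \<le> B" "\<And>x. norm x \<le> R + 1 \<Longrightarrow> \<bar>\<phi> x\<bar> \<le> B"
    using continuous_bounded_cball[OF convex_imp_continuous[OF assms]] by blast
  have "norm \<eta> \<le> 2 * B" if "norm x \<le> R" "is_subgradient \<phi> x \<eta>" for x \<eta>
  proof -
    have "\<phi> x + \<eta> \<bullet> (x + sgn \<eta> - x) \<le> \<phi> (x + sgn \<eta>)"
      using that(2) unfolding is_subgradient_def by blast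
    moreover have "\<eta> \<bullet> sgn \<eta> = norm \<eta>"
      by (cases "\<eta> = 0") (simp_all add: sgn_div_norm power2_norm_eq_inner[symmetric] power2_eq_square)
    moreover have "norm (x + sgn \<eta>) \<le> R + 1"
      using norm_triangle_ineq[of x "sgn \<eta>"] that(1) by (simp add: norm_sgn split: if_splits)
    then have "\<bar>\<phi> (x + sgn \<eta>)\<bar> \<le> B" by (rule B)
    moreover have "\<bar>\<phi> x\<bar> \<le> B" using that(1) by (intro B) simp
    ultimately show ?thesis by simp
  qed
  then show ?thesis using that[of "2 * B"] B(1) by simp
qed

text \<open>The energy need not be globally Lipschitz when the exponent exceeds 1. The supremum of the tangent affine
functions at the points of a ball, together with 0, is Lipschitz and agrees with \<open>\<phi>\<close> on the ball.
Since it lies below \<open>\<phi>\<close> everywhere, its subgradients at points of the ball are subgradients of \<open>\<phi>\<close>.\<close>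

lemma Lipschitz_convex_minorant:
  fixes \<phi> :: "'a::euclidean_space \<Rightarrow> real"
  assumes \<phi>: "convex_on UNIV \<phi>" and nonneg: "\<And>x. 0 \<le> \<phi> x"
  obtains \<psi> L where "convex_on UNIV \<psi>" "\<And>x. 0 \<le> \<psi> x" "\<And>x. \<psi> x \<le> \<phi> x"
    "\<And>x. norm x \<le> R \<Longrightarrow> \<psi> x = \<phi> x" "0 \<le> L" "\<And>x y. \<bar>\<psi> x - \<psi> y\<bar> \<le> L * norm (x - y)"
proof -
  define \<eta> where "\<eta> z = (SOME v. is_subgradient \<phi> z v)" for z
  have \<eta>: "is_subgradient \<phi> z (\<eta> z)" for z
    unfolding \<eta>_def by (rule someI_ex[OF subgradient_exists[OF \<phi>]])
  obtain L where L: "0 \<le> L" "\<And>x v. norm x \<le> R \<Longrightarrow> is_subgradient \<phi> x v \<Longrightarrow> norm v \<le> L"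
    using subgradient_locally_bounded[OF \<phi>] by blast
  define F where "F = insert (\<lambda>_. 0) ((\<lambda>z x. \<phi> z + \<eta> z \<bullet> (x - z)) ` cball 0 R)"
  define \<psi> where "\<psi> x = (SUP f\<in>F. f x)" for x
  have F0: "F \<noteq> {}" by (simp add: F_def)
  have Fle: "f x \<le> \<phi> x" if "f \<in> F" for f x
    using that nonneg \<eta> by (auto simp: F_def is_subgradient_def)
  have bdd: "bdd_above ((\<lambda>f. f x) ` F)" for x
    using Fle by (intro bdd_aboveI2)
  have up: "f x \<le> \<psi> x" if "f \<in> F" for f x
    unfolding \<psi>_def using that bdd by (rule cSUP_upper)
  have least: "\<psi> x \<le> b" if "\<And>f. f \<in> F \<Longrightarrow> f x \<le> b" for x b
    unfolding \<psi>_def using F0 that by (rule cSUP_least)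
  have affine: "f ((1 - t) *\<^sub>R x + t *\<^sub>R y) = (1 - t) * f x + t * f y" if "f \<in> F" for f t x y
    using that by (auto simp: F_def inner_add_right inner_diff_right algebra_simps)
  have lip: "f x \<le> f y + L * norm (x - y)" if f: "f \<in> F" for f x y
  proof (cases "f = (\<lambda>_. 0)")
    case True
    then show ?thesis using L(1) by simp
  next
    case False
    with f obtain z where z: "norm z \<le> R" "f = (\<lambda>x. \<phi> z + \<eta> z \<bullet> (x - z))" by (auto simp: F_def)
    have "f x - f y = \<eta> z \<bullet> (x - y)" by (simp add: z inner_diff_right)
    also have "\<dots> \<le> norm (\<eta> z) * norm (x - y)" by (rule norm_cauchy_schwarz)
    also have "\<dots> \<le> L * norm (x - y)" using L(2)[OF z(1) \<eta>] by (intro mult_right_mono) auto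
    finally show ?thesis by simp
  qed
  show ?thesis
  proof (rule that)
    show "convex_on UNIV \<psi>"
    proof (rule convex_onI)
      fix t :: real and x y :: 'a assume "0 < t" "t < 1"
      then show "\<psi> ((1 - t) *\<^sub>R x + t *\<^sub>R y) \<le> (1 - t) * \<psi> x + t * \<psi> y"
        by (intro least) (auto simp: affine intro!: add_mono mult_left_mono up)
    qed simp
    show "0 \<le> \<psi> x" for x using up[of "\<lambda>_. 0" x] by (simp add: F_def)
    show "\<psi> x \<le> \<phi> x" for x using Fle by (rule least)
    then show "\<psi> x = \<phi> x" if "norm x \<le> R" for x
      using up[of "\<lambda>y. \<phi> x + \<eta> x \<bullet> (y - x)" x] that by (intro antisym) (auto simp: F_def)
    show "0 \<le> L" by fact
    have "\<psi> x \<le> \<psi> y + L * norm (x - y)" for x y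
      using lip up by (intro least) (meson add_right_mono order_trans)
    from this[of x y for x y] this[of y x for x y] show "\<bar>\<psi> x - \<psi> y\<bar> \<le> L * norm (x - y)" for x y
      by (smt (verit) norm_minus_commute)
  qed
qed

section \<open>The hypergraph energy\<close>

lemma powr_convex_nonneg:
  assumes p: "1 \<le> p" and t: "0 \<le> t" "t \<le> (1::real)" and xy: "0 \<le> x" "0 \<le> y"
  shows "((1 - t) * x + t * y) powr p \<le> (1 - t) * x powr p + t * y powr p"
proof -
  have scale: "(s * z) powr p \<le> s * z powr p" if "0 \<le> s" "s \<le> 1" "0 \<le> z" for s z :: real
  proof -
    have "s powr p \<le> s"
    proof (cases "s = 0")
      case False
      then show ?thesis using that p powr_mono'[of 1 p s] by simp
    qed simp
    then have "s powr p * z powr p \<le> s * z powr p" by (intro mult_right_mono) auto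
    then show ?thesis using that by (simp add: powr_mult)
  qed
  show ?thesis
  proof (cases "x = 0 \<or> y = 0")
    case True
    then show ?thesis using scale[of t y] scale[of "1 - t" x] t xy by auto
  next
    case False
    then show ?thesis using convex_onD[OF powr_convex[OF p], of t x y] t xy by simp
  qed
qed

lemma edge_diff_props:
  fixes e :: "'v::finite set" and x :: "real^'v"
  assumes "e \<noteq> {}"
  shows edge_diff_attained: "\<exists>i\<in>e. \<exists>j\<in>e. edge_diff e x = \<bar>x $ i - x $ j\<bar>"
    and edge_diff_upper: "\<And>i j. i \<in> e \<Longrightarrow> j \<in> e \<Longrightarrow> \<bar>x $ i - x $ j\<bar> \<le> edge_diff e x"
proof -
  let ?S = "{\<bar>x $ i - x $ j\<bar> | i j. i \<in> e \<and> j \<in> e}"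
  have "?S = (\<lambda>(i, j). \<bar>x $ i - x $ j\<bar>) ` (e \<times> e)" by auto
  then have S: "finite ?S" "?S \<noteq> {}" using assms by auto
  from Max_in[OF S] show "\<exists>i\<in>e. \<exists>j\<in>e. edge_diff e x = \<bar>x $ i - x $ j\<bar>"
    unfolding edge_diff_def by auto
  show "\<bar>x $ i - x $ j\<bar> \<le> edge_diff e x" if "i \<in> e" "j \<in> e" for i j
    unfolding edge_diff_def using S(1) that by (intro Max_ge) auto
qed

lemma edge_diff_nonneg: "e \<noteq> {} \<Longrightarrow> 0 \<le> edge_diff e x"
  using edge_diff_attained[of e x] by auto

lemma edge_diff_convex:
  assumes e: "e \<noteq> {}" and t: "0 \<le> t" "t \<le> 1"
  shows "edge_diff e ((1 - t) *\<^sub>R x + t *\<^sub>R y) \<le> (1 - t) * edge_diff e x + t * edge_diff e y"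
proof -
  let ?z = "(1 - t) *\<^sub>R x + t *\<^sub>R y"
  obtain i j where ij: "i \<in> e" "j \<in> e" "edge_diff e ?z = \<bar>?z $ i - ?z $ j\<bar>"
    using edge_diff_attained[OF e] by blast
  have "?z $ i - ?z $ j = (1 - t) * (x $ i - x $ j) + t * (y $ i - y $ j)"
    by (simp add: algebra_simps)
  then have "edge_diff e ?z \<le> \<bar>(1 - t) * (x $ i - x $ j)\<bar> + \<bar>t * (y $ i - y $ j)\<bar>"
    unfolding ij(3) by (metis abs_triangle_ineq)
  also have "\<dots> = (1 - t) * \<bar>x $ i - x $ j\<bar> + t * \<bar>y $ i - y $ j\<bar>"
    using t by (simp add: abs_mult)
  also have "\<dots> \<le> (1 - t) * edge_diff e x + t * edge_diff e y"
    using t ij e by (intro add_mono mult_left_mono edge_diff_upper) auto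
  finally show ?thesis .
qed

lemma hypergraph_energy_convex:
  assumes G: "weighted_hypergraph E w" and p: "1 \<le> p"
  shows "convex_on UNIV (hypergraph_energy E w p)"
proof (rule convex_onI)
  fix t :: real and x y :: "real^'a" assume t: "0 < t" "t < 1"
  let ?z = "(1 - t) *\<^sub>R x + t *\<^sub>R y"
  have "(\<Sum>e\<in>E. w e * edge_diff e ?z powr p) \<le>
        (\<Sum>e\<in>E. w e * ((1 - t) * edge_diff e x powr p + t * edge_diff e y powr p))"
  proof (intro sum_mono mult_left_mono)
    fix e assume "e \<in> E"
    then have e: "e \<noteq> {}" "0 < w e" using G by (auto simp: weighted_hypergraph_def)
    show "0 \<le> w e" using e by simp
    have "edge_diff e ?z powr p \<le> ((1 - t) * edge_diff e x + t * edge_diff e y) powr p"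
      using p t e by (intro powr_mono2 edge_diff_convex edge_diff_nonneg) auto
    also have "\<dots> \<le> (1 - t) * edge_diff e x powr p + t * edge_diff e y powr p"
      using p t e by (intro powr_convex_nonneg edge_diff_nonneg) auto
    finally show "edge_diff e ?z powr p \<le> (1 - t) * edge_diff e x powr p + t * edge_diff e y powr p" .
  qed
  also have "\<dots> = (1 - t) * (\<Sum>e\<in>E. w e * edge_diff e x powr p) + t * (\<Sum>e\<in>E. w e * edge_diff e y powr p)"
    by (simp add: sum_distrib_left sum.distrib[symmetric] algebra_simps)
  finally have "(1 / p) * (\<Sum>e\<in>E. w e * edge_diff e ?z powr p) \<le>
     (1 / p) * ((1 - t) * (\<Sum>e\<in>E. w e * edge_diff e x powr p) + t * (\<Sum>e\<in>E. w e * edge_diff e y powr p))"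
    using p by (intro mult_left_mono) auto
  then show "hypergraph_energy E w p ?z \<le> (1 - t) * hypergraph_energy E w p x + t * hypergraph_energy E w p y"
    by (simp add: hypergraph_energy_def distrib_left mult.left_commute)
qed simp

lemma hypergraph_energy_nonneg:
  assumes "weighted_hypergraph E w" and "1 \<le> p"
  shows "0 \<le> hypergraph_energy E w p x"
  unfolding hypergraph_energy_def using assms
  by (intro mult_nonneg_nonneg sum_nonneg) (auto simp: weighted_hypergraph_def less_imp_le)

section \<open>Gradient flows of time-dependent convex functions\<close>

lemma primitive_shift:
  fixes g :: "real \<Rightarrow> 'a::euclidean_space"
  assumes g: "g integrable_on {0..T}"
    and u: "\<And>t. t \<in> {0..T} \<Longrightarrow> u t = u 0 + integral {0..t} g"
    and st: "0 \<le> s" "s \<le> t" "t \<le> T"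
  shows "u t = u s + integral {s..t} g"
  using integral_Icc_diff[OF g st] u[of s] u[of t] st by (simp add: algebra_simps)

lemma primitive_inner_rule:
  fixes u v f g :: "real \<Rightarrow> 'a::euclidean_space"
  assumes f: "f \<in> L2 T" and g: "g \<in> L2 T"
    and u: "\<And>t. t \<in> {0..T} \<Longrightarrow> u t = u 0 + integral {0..t} f"
    and v: "\<And>t. t \<in> {0..T} \<Longrightarrow> v t = v 0 + integral {0..t} g"
    and st: "0 \<le> s" "s \<le> t" "t \<le> T"
  shows "integral {s..t} (\<lambda>r. f r \<bullet> v r + u r \<bullet> g r) = u t \<bullet> v t - u s \<bullet> v s"
proof (rule primitive_product_rule(2)[OF bounded_bilinear_inner])
  show "s \<le> t" by fact
  show "f absolutely_integrable_on {s..t}" "g absolutely_integrable_on {s..t}"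
    using absolutely_integrable_on_sub_Icc[OF L2_D(1)[OF f]] absolutely_integrable_on_sub_Icc[OF L2_D(1)[OF g]] st by auto
  show "u r = u s + integral {s..r} f" "v r = v s + integral {s..r} g" if "r \<in> {s..t}" for r
    using that st by (auto intro!: primitive_shift[OF L2_integrable[OF f] u] primitive_shift[OF L2_integrable[OF g] v])
qed

lemma primitive_norm_sq:
  fixes u g :: "real \<Rightarrow> 'a::euclidean_space"
  assumes g: "g \<in> L2 T"
    and u: "\<And>t. t \<in> {0..T} \<Longrightarrow> u t = u 0 + integral {0..t} g"
    and t: "t \<in> {0..T}"
  shows "(norm (u t))\<^sup>2 = (norm (u 0))\<^sup>2 + 2 * integral {0..t} (\<lambda>r. g r \<bullet> u r)"
proof -
  have "integral {0..t} (\<lambda>r. g r \<bullet> u r + u r \<bullet> g r) = u t \<bullet> u t - u 0 \<bullet> u 0"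
    using t by (intro primitive_inner_rule[OF g g u u]) auto
  then show ?thesis by (simp add: inner_commute power2_norm_eq_inner flip: mult_2)
qed

lemma Cauchy_uniform_limit:
  fixes y :: "nat \<Rightarrow> real \<Rightarrow> 'a::euclidean_space"
  assumes "\<And>e. 0 < e \<Longrightarrow> \<exists>K. \<forall>k\<ge>K. \<forall>l\<ge>K. \<forall>t\<in>S. norm (y k t - y l t) \<le> e"
    and cont: "\<And>k. continuous_on S (y k)"
  obtains z where "continuous_on S z" "\<And>e. 0 < e \<Longrightarrow> \<exists>K. \<forall>k\<ge>K. \<forall>t\<in>S. norm (y k t - z t) \<le> e"
proof -
  have "uniformly_Cauchy_on S y"
    unfolding uniformly_Cauchy_on_def
  proof (intro allI impI)
    fix e :: real assume "0 < e"
    then obtain K where K: "\<And>k l t. k \<ge> K \<Longrightarrow> l \<ge> K \<Longrightarrow> t \<in> S \<Longrightarrow> norm (y k t - y l t) \<le> e / 2"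
      using assms(1)[of "e / 2"] by auto
    have "dist (y m x) (y n x) < e" if "x \<in> S" "m \<ge> K" "n \<ge> K" for x m n
      using K[OF that(2,3,1)] \<open>0 < e\<close> by (simp add: dist_norm)
    then show "\<exists>M. \<forall>x\<in>S. \<forall>m\<ge>M. \<forall>n\<ge>M. dist (y m x) (y n x) < e"
      by blast
  qed
  then obtain z where z: "uniform_limit S y z sequentially"
    using Cauchy_uniformly_convergent uniformly_convergent_on_def by blast
  show ?thesis
  proof (rule that)
    show "continuous_on S z"
      by (rule uniform_limit_theorem[OF _ z]) (use cont in auto)
    fix e :: real assume "0 < e"
    with z obtain K where "\<And>k. k \<ge> K \<Longrightarrow> \<forall>t\<in>S. dist (y k t) (z t) < e"
      unfolding uniform_limit_iff eventually_sequentially by blast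
    then show "\<exists>K. \<forall>k\<ge>K. \<forall>t\<in>S. norm (y k t - z t) \<le> e"
      by (intro exI[of _ K]) (auto simp: dist_norm intro: less_imp_le)
  qed
qed

lemma integral_lower_bound:
  fixes f :: "real \<Rightarrow> real"
  assumes "f integrable_on {s..t}" "s \<le> t" "\<And>r. r \<in> {s..t} \<Longrightarrow> c \<le> f r"
  shows "c * (t - s) \<le> integral {s..t} f"
proof -
  have "integral {s..t} (\<lambda>_. c) \<le> integral {s..t} f"
    by (rule integral_le[OF _ assms(1,3)]) auto
  then show ?thesis using assms(2) by (simp add: mult.commute)
qed

lemma integral_upper_bound:
  fixes f :: "real \<Rightarrow> real"
  assumes "f integrable_on {s..t}" "s \<le> t" "\<And>r. r \<in> {s..t} \<Longrightarrow> f r \<le> c"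
  shows "integral {s..t} f \<le> c * (t - s)"
proof -
  have "integral {s..t} f \<le> integral {s..t} (\<lambda>_. c)"
    by (rule integral_le[OF assms(1) _ assms(3)]) auto
  then show ?thesis using assms(2) by (simp add: mult.commute)
qed

text \<open>The explicit Euler scheme: on each cell the velocity is \<open>h\<close> minus a subgradient chosen at the left
endpoint of the cell. The polygon moves little within a cell, uniformly in its position because the
subgradients are bounded by \<open>L\<close>; so the frozen subgradient is an \<open>e\<close>-subgradient at the current
point and time.\<close>

lemma approximate_flow_exists:
  fixes \<psi> :: "real \<Rightarrow> 'a::euclidean_space \<Rightarrow> real"
  assumes T: "0 < T"
    and conv: "\<And>t. t \<in> {0..T} \<Longrightarrow> convex_on UNIV (\<psi> t)"
    and L: "0 \<le> L" and lip: "\<And>t x y. t \<in> {0..T} \<Longrightarrow> \<bar>\<psi> t x - \<psi> t y\<bar> \<le> L * norm (x - y)"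
    and time: "\<And>e. 0 < e \<Longrightarrow> \<exists>d>0. \<forall>s\<in>{0..T}. \<forall>t\<in>{0..T}. \<bar>s - t\<bar> < d \<longrightarrow> (\<forall>x. \<bar>\<psi> s x - \<psi> t x\<bar> \<le> e)"
    and h: "h \<in> L2 T" and e: "0 < e"
  shows "\<exists>\<sigma> y. \<sigma> absolutely_integrable_on {0..T} \<and> (\<forall>t\<in>{0..T}. norm (\<sigma> t) \<le> L) \<and>
    (\<forall>t. y t = y0 + integral {0..t} (\<lambda>r. h r - \<sigma> r)) \<and>
    (\<forall>t\<in>{0..T}. \<forall>z. \<psi> t (y t) + \<sigma> t \<bullet> (z - y t) \<le> \<psi> t z + e)"
proof -
  \<comment> \<open>the tolerance \<open>e\<close> is spent on two changes of time and two changes of position, the latter weighted by \<open>L\<close>\<close>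
  define e' where "e' = e / (2 * L + 2)"
  have e': "0 < e'" "(2 * L + 2) * e' = e" using e L by (auto simp: e'_def)
  obtain d1 where d1: "0 < d1" "\<And>s t x. s \<in> {0..T} \<Longrightarrow> t \<in> {0..T} \<Longrightarrow> \<bar>s - t\<bar> < d1 \<Longrightarrow> \<bar>\<psi> s x - \<psi> t x\<bar> \<le> e'"
    using time[OF e'(1)] by blast
  define N where "N t = integral {0..t} (\<lambda>r. norm (h r) + L)" for t
  have Nint: "(\<lambda>r. norm (h r) + L) integrable_on {0..T}"
    by (intro integrable_add set_lebesgue_integral_eq_integral(1)[OF set_integrable_norm[OF L2_D(1)[OF h]]]) auto
  have "uniformly_continuous_on {0..T} N"
    unfolding N_def[abs_def] by (intro compact_uniformly_continuous indefinite_integral_continuous_1 Nint) auto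
  then obtain d2 where d2: "0 < d2" "\<And>s t. s \<in> {0..T} \<Longrightarrow> t \<in> {0..T} \<Longrightarrow> \<bar>s - t\<bar> < d2 \<Longrightarrow> \<bar>N s - N t\<bar> < e'"
    using e'(1) unfolding uniformly_continuous_on_def dist_real_def by blast
  obtain n where n: "T / min d1 d2 < real n" using reals_Archimedean2 by blast
  define d where "d = T / real n"
  have n0: "0 < n" using n T d1 d2 by (metis divide_pos_pos min_less_iff_conj less_trans of_nat_0_less_iff)
  have "0 < min d1 d2" using d1(1) d2(1) by simp
  with n n0 have "d < min d1 d2" by (simp add: d_def field_simps del: min_less_iff_conj min_less_iff_disj)
  then have d: "0 < d" "real n * d = T" "d < d1" "d < d2"
    using n0 T by (auto simp: d_def)
  define sg where "sg t x = (SOME v. is_subgradient (\<psi> t) x v)" for t x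
  have sg: "is_subgradient (\<psi> t) x (sg t x)" if "t \<in> {0..T}" for t x
    unfolding sg_def by (rule someI_ex[OF subgradient_exists[OF conv[OF that]]])
  have sg_le: "norm (sg t x) \<le> L" if "t \<in> {0..T}" for t x
    using sg[OF that] lip[OF that] L by (rule Lipschitz_subgradient_bound)
  define v where "v = rec_nat y0 (\<lambda>i vi. vi + (integral {real i * d..real (Suc i) * d} h - d *\<^sub>R sg (real i * d) vi))"
  have v: "v 0 = y0" "v (Suc i) = v i + (integral {real i * d..real (Suc i) * d} h - d *\<^sub>R sg (real i * d) (v i))" for i
    by (simp_all add: v_def)
  \<comment> \<open>the left endpoint of the cell that contains \<open>t\<close>\<close>
  define \<tau> where "\<tau> t = real (nat \<lfloor>t / d\<rfloor>) * d" for t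
  define \<sigma> where "\<sigma> t = sg (\<tau> t) (v (nat \<lfloor>t / d\<rfloor>))" for t
  define y where "y t = y0 + integral {0..t} (\<lambda>r. h r - \<sigma> r)" for t
  have \<tau>: "0 \<le> \<tau> t" "\<tau> t \<le> t" "t - \<tau> t < d" if "0 \<le> t" for t
  proof -
    have "0 \<le> t / d" using that d(1) by simp
    then have "real (nat \<lfloor>t / d\<rfloor>) \<le> t / d" "t / d - 1 < real (nat \<lfloor>t / d\<rfloor>)" by linarith+
    then show "0 \<le> \<tau> t" "\<tau> t \<le> t" "t - \<tau> t < d" using d(1) by (auto simp: \<tau>_def field_simps)
  qed
  have \<tau>T: "\<tau> t \<in> {0..T}" if "t \<in> {0..T}" for t using \<tau>[of t] that by auto
  let ?c = "\<lambda>i. sg (real i * d) (v i)"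
  have \<sigma>_eq: "\<sigma> = (\<lambda>t. ?c (nat \<lfloor>t / d\<rfloor>))" by (auto simp: \<sigma>_def \<tau>_def)
  have \<sigma>_int: "\<sigma> absolutely_integrable_on {0..T}"
    using cellwise_absolutely_integrable(1)[OF d(1), of n "\<lambda>i t. ?c i"]
    unfolding d(2) \<sigma>_eq by auto
  have \<sigma>_le: "norm (\<sigma> t) \<le> L" if "t \<in> {0..T}" for t
    unfolding \<sigma>_def using \<tau>T[OF that] by (rule sg_le)
  have hint: "h integrable_on {0..T}" and \<sigma>int: "\<sigma> integrable_on {0..T}"
    using h L2_integrable \<sigma>_int by (auto dest: set_lebesgue_integral_eq_integral(1))
  have node: "y (real i * d) = v i" if "i \<le> n" for i
  proof -
    have le: "real i * d \<le> T" if "i \<le> n" for i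
      using that d(1) unfolding d(2)[symmetric] by (intro mult_right_mono) auto
    have \<sigma>sum: "integral {0..real i * d} \<sigma> = (\<Sum>j<i. d *\<^sub>R ?c j)" for i
      using cellwise_absolutely_integrable(2)[OF d(1), of i "\<lambda>i t. ?c i"] d(1)
      unfolding \<sigma>_eq by (auto simp: algebra_simps)
    have "v i = y0 + integral {0..real i * d} h - (\<Sum>j<i. d *\<^sub>R ?c j)"
      using that
    proof (induction i)
      case (Suc i)
      have "integral {0..real (Suc i) * d} h - integral {0..real i * d} h = integral {real i * d..real (Suc i) * d} h"
        using d(1) le[OF Suc.prems] by (intro integral_Icc_diff[OF hint]) (auto intro: mult_right_mono)
      then show ?case using Suc by (simp add: v algebra_simps del: of_nat_Suc)
    qed (simp add: v)
    moreover have "h integrable_on {0..real i * d}" "\<sigma> integrable_on {0..real i * d}"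
      by (rule integrable_subinterval_real[OF hint], use le[OF that] in simp)
         (rule integrable_subinterval_real[OF \<sigma>int], use le[OF that] in simp)
    ultimately show ?thesis by (simp add: y_def integral_diff \<sigma>sum)
  qed
  have y\<tau>: "y (\<tau> t) = v (nat \<lfloor>t / d\<rfloor>)" if "t \<in> {0..T}" for t
  proof -
    have "t / d \<le> real n" using that d(1,2) by (simp add: divide_le_eq)
    then have "nat \<lfloor>t / d\<rfloor> \<le> n" by linarith
    then show ?thesis unfolding \<tau>_def by (rule node)
  qed
  have close: "norm (y t - y (\<tau> t)) \<le> e'" if t: "t \<in> {0..T}" for t
  proof -
    note tt = \<tau>[of t] and tT = \<tau>T[OF t]
    have i: "(\<lambda>r. h r - \<sigma> r) integrable_on {0..T}" using hint \<sigma>int by (rule integrable_diff)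
    have "y t - y (\<tau> t) = integral {\<tau> t..t} (\<lambda>r. h r - \<sigma> r)"
      using integral_Icc_diff[OF i, of "\<tau> t" t] tt t by (simp add: y_def)
    also have "norm \<dots> \<le> integral {\<tau> t..t} (\<lambda>r. norm (h r) + L)"
    proof (rule Henstock_Kurzweil_Integration.integral_norm_bound_integral)
      show "(\<lambda>r. h r - \<sigma> r) integrable_on {\<tau> t..t}" "(\<lambda>r. norm (h r) + L) integrable_on {\<tau> t..t}"
        by (rule integrable_subinterval_real[OF i], use tt t in simp)
           (rule integrable_subinterval_real[OF Nint], use tt t in simp)
      fix r assume "r \<in> {\<tau> t..t}"
      then have "r \<in> {0..T}" using tt t by auto
      then show "norm (h r - \<sigma> r) \<le> norm (h r) + L"
        using norm_triangle_ineq4[of "h r" "\<sigma> r"] \<sigma>_le[of r] by simp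
    qed
    also have "\<dots> = N t - N (\<tau> t)"
      using integral_Icc_diff[OF Nint, of "\<tau> t" t] tt t by (simp add: N_def)
    also have "\<dots> \<le> e'"
      using d2(2)[OF t tT] tt t d(4) by auto
    finally show ?thesis .
  qed
  show ?thesis
  proof (rule exI[of _ \<sigma>], rule exI[of _ y], intro conjI ballI allI \<sigma>_int)
    show "norm (\<sigma> t) \<le> L" if "t \<in> {0..T}" for t using that by (rule \<sigma>_le)
    show "y t = y0 + integral {0..t} (\<lambda>r. h r - \<sigma> r)" for t by (rule y_def)
    fix t z assume t: "t \<in> {0..T}"
    let ?s = "\<tau> t"
    have st: "\<bar>\<psi> ?s x - \<psi> t x\<bar> \<le> e'" for x
      using \<tau>[of t] t d(3) \<tau>T[OF t] by (intro d1(2)) auto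
    have sub: "\<psi> ?s (y ?s) + \<sigma> t \<bullet> (z - y ?s) \<le> \<psi> ?s z"
      using sg[OF \<tau>T[OF t], of "y ?s"] unfolding is_subgradient_def \<sigma>_def y\<tau>[OF t] by blast
    have "\<psi> ?s (y t) - \<psi> ?s (y ?s) \<le> L * norm (y t - y ?s)"
      using lip[OF \<tau>T[OF t], of "y t" "y ?s"] by simp
    also have "\<dots> \<le> L * e'" using close[OF t] L by (rule mult_left_mono)
    finally have 1: "\<psi> ?s (y t) \<le> \<psi> ?s (y ?s) + L * e'" by simp
    have "\<sigma> t \<bullet> (y ?s - y t) \<le> norm (\<sigma> t) * norm (y ?s - y t)" by (rule norm_cauchy_schwarz)
    also have "\<dots> \<le> L * e'"
      using \<sigma>_le[OF t] close[OF t] L by (intro mult_mono) (auto simp: norm_minus_commute)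
    finally have 2: "\<sigma> t \<bullet> (z - y t) \<le> \<sigma> t \<bullet> (z - y ?s) + L * e'"
      by (simp add: inner_diff_right)
    have "(2 * L + 2) * e' = L * e' + L * e' + e' + e'" by (simp add: algebra_simps)
    with sub 1 2 st[of "y t"] st[of z] show "\<psi> t (y t) + \<sigma> t \<bullet> (z - y t) \<le> \<psi> t z + e"
      unfolding e'(2) by linarith
  qed
qed

text \<open>Approximate flows with tolerances tending to 0 form a Cauchy sequence in the uniform norm, because
approximate subgradients are approximately monotone. The limit \<open>Y\<close> minus the primitive of \<open>h\<close> is
Lipschitz, so the quadratic variation criterion supplies an integrand \<open>g\<close> of \<open>Y\<close>. For a fixed
comparison point \<open>z\<close> the subgradient inequality integrates over a time interval to a statement in
which the velocities occur only through the curves, by the product rule, and there the uniform limit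
can be taken. Localising in time, for \<open>z\<close> in a countable dense set, gives the inclusion.\<close>

theorem gradient_flow_exists:
  fixes \<psi> :: "real \<Rightarrow> 'a::euclidean_space \<Rightarrow> real"
  assumes T: "0 < T"
    and conv: "\<And>t. t \<in> {0..T} \<Longrightarrow> convex_on UNIV (\<psi> t)"
    and L: "0 \<le> L" and lip: "\<And>t x y. t \<in> {0..T} \<Longrightarrow> \<bar>\<psi> t x - \<psi> t y\<bar> \<le> L * norm (x - y)"
    and time: "\<And>e. 0 < e \<Longrightarrow> \<exists>d>0. \<forall>s\<in>{0..T}. \<forall>t\<in>{0..T}. \<bar>s - t\<bar> < d \<longrightarrow> (\<forall>x. \<bar>\<psi> s x - \<psi> t x\<bar> \<le> e)"
    and h: "h \<in> L2 T"
  obtains y g Z where "g \<in> L2 T" "y 0 = y0" "\<forall>t\<in>{0..T}. y t = y 0 + integral {0..t} g"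
    "negligible Z" "\<forall>t\<in>{0..T} - Z. is_subgradient (\<psi> t) (y t) (h t - g t)"
proof -
  define euler where "euler k \<sigma> y \<longleftrightarrow>
    \<sigma> absolutely_integrable_on {0..T} \<and> (\<forall>t\<in>{0..T}. norm (\<sigma> t) \<le> L) \<and>
    (\<forall>t. y t = y0 + integral {0..t} (\<lambda>r. h r - \<sigma> r)) \<and>
    (\<forall>t\<in>{0..T}. \<forall>z. \<psi> t (y t) + \<sigma> t \<bullet> (z - y t) \<le> \<psi> t z + 1 / real (Suc k))" for k \<sigma> y
  have "\<exists>\<sigma> y. euler k \<sigma> y" for k
  proof -
    have pos: "0 < 1 / real (Suc k)" by simp
    show ?thesis
      unfolding euler_def by (rule approximate_flow_exists[OF T conv L lip time h pos])
  qed
  then obtain \<sigma> y where "\<And>k. euler k (\<sigma> k) (y k)" by metis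
  then have \<sigma>: "\<And>k. \<sigma> k absolutely_integrable_on {0..T}" "\<And>k t. t \<in> {0..T} \<Longrightarrow> norm (\<sigma> k t) \<le> L"
    and y: "\<And>k t. y k t = y0 + integral {0..t} (\<lambda>r. h r - \<sigma> k r)"
    and sub: "\<And>k t z. t \<in> {0..T} \<Longrightarrow> \<psi> t (y k t) + \<sigma> k t \<bullet> (z - y k t) \<le> \<psi> t z + 1 / real (Suc k)"
    unfolding euler_def by blast+
  have \<sigma>L2: "\<sigma> k \<in> L2 T" for k by (rule L2_bounded[OF \<sigma>])
  have gk: "(\<lambda>r. h r - \<sigma> k r) \<in> L2 T" for k by (rule L2_diff[OF h \<sigma>L2])
  have yk: "y k t = y k 0 + integral {0..t} (\<lambda>r. h r - \<sigma> k r)" for k t by (simp add: y)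
  have ycont: "continuous_on {0..T} (y k)" for k
    by (rule primitive_continuous[OF L2_integrable[OF gk] yk])
  have inv: "\<exists>K. \<forall>k\<ge>K. 1 / real (Suc k) \<le> e" if "0 < e" for e :: real
  proof -
    obtain K where K: "1 / e < real K" using reals_Archimedean2 by blast
    have "1 / real (Suc k) \<le> e" if "k \<ge> K" for k
    proof -
      have "1 / e \<le> real (Suc k)" using K that by linarith
      then show ?thesis using \<open>0 < e\<close> by (simp add: field_simps)
    qed
    then show ?thesis by blast
  qed
  have cauchy: "\<exists>K. \<forall>k\<ge>K. \<forall>l\<ge>K. \<forall>t\<in>{0..T}. norm (y k t - y l t) \<le> e" if e: "0 < e" for e
  proof -
    define \<epsilon> where "\<epsilon> = e\<^sup>2 / (4 * T)"
    have "0 < \<epsilon>" using e T by (simp add: \<epsilon>_def)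
    then obtain K where K: "\<And>k. k \<ge> K \<Longrightarrow> 1 / real (Suc k) \<le> \<epsilon>" using inv by blast
    have "norm (y k t - y l t) \<le> e" if kl: "k \<ge> K" "l \<ge> K" and t: "t \<in> {0..T}" for k l t
    proof -
      let ?g = "\<lambda>r. (h r - \<sigma> k r) - (h r - \<sigma> l r)" and ?u = "\<lambda>r. y k r - y l r"
      have g: "?g \<in> L2 T" by (rule L2_diff[OF gk gk])
      have i: "(\<lambda>r. h r - \<sigma> k r) integrable_on {0..t}" if "t \<in> {0..T}" for k t
        by (rule integrable_subinterval_real[OF L2_integrable[OF gk]]) (use that in auto)
      have u: "?u t = ?u 0 + integral {0..t} ?g" if "t \<in> {0..T}" for t
        unfolding integral_diff[OF i[OF that] i[OF that]] by (simp add: y)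
      have u0: "?u 0 = 0" by (simp add: y)
      have "(\<lambda>r. ?g r \<bullet> ?u r) integrable_on {0..T}"
        by (intro set_lebesgue_integral_eq_integral(1) L2_inner g L2_diff L2_continuous ycont)
      then have gi: "(\<lambda>r. ?g r \<bullet> ?u r) integrable_on {0..t}"
        by (rule integrable_subinterval_real) (use t in auto)
      have le: "?g r \<bullet> ?u r \<le> 2 * \<epsilon>" if "r \<in> {0..t}" for r
      proof -
        have r: "r \<in> {0..T}" using that t by auto
        have "\<sigma> k r \<bullet> (y l r - y k r) + \<sigma> l r \<bullet> (y k r - y l r) \<le> 2 * \<epsilon>"
          using sub[OF r, of k "y l r"] sub[OF r, of l "y k r"] K[OF kl(1)] K[OF kl(2)] by linarith
        then show ?thesis by (simp add: inner_diff_left inner_diff_right)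
      qed
      have "(norm (?u t))\<^sup>2 = (norm (?u 0))\<^sup>2 + 2 * integral {0..t} (\<lambda>r. ?g r \<bullet> ?u r)"
        by (rule primitive_norm_sq[OF g u t])
      also have "\<dots> \<le> 2 * (2 * \<epsilon> * (t - 0))"
        using integral_upper_bound[OF gi _ le] t by (simp add: u0)
      also have "\<dots> \<le> 2 * (2 * \<epsilon> * T)" using t \<open>0 < \<epsilon>\<close> by simp
      also have "\<dots> = e\<^sup>2" using T by (simp add: \<epsilon>_def)
      finally show ?thesis using e by (simp add: power2_le_iff_abs_le)
    qed
    then show ?thesis by blast
  qed
  obtain Y where Ycont: "continuous_on {0..T} Y"
    and Ylim: "\<And>e. 0 < e \<Longrightarrow> \<exists>K. \<forall>k\<ge>K. \<forall>t\<in>{0..T}. norm (y k t - Y t) \<le> e"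
    using Cauchy_uniform_limit[OF cauchy ycont] by blast
  have Ytend: "(\<lambda>k. y k t) \<longlonglongrightarrow> Y t" if "t \<in> {0..T}" for t
    unfolding LIMSEQ_iff
  proof (intro allI impI)
    fix e :: real assume "0 < e"
    then obtain K where "\<And>k. k \<ge> K \<Longrightarrow> norm (y k t - Y t) \<le> e / 2"
      using Ylim[of "e / 2"] \<open>t \<in> {0..T}\<close> half_gt_zero by blast
    moreover have "e / 2 < e" using \<open>0 < e\<close> by simp
    ultimately show "\<exists>K. \<forall>k\<ge>K. norm (y k t - Y t) < e"
      by (intro exI[of _ K] allI impI) (rule le_less_trans)
  qed
  have Y0: "Y 0 = y0"
    using Ytend[of 0] T by (simp add: y LIMSEQ_const_iff)
  define H where "H t = integral {0..t} h" for t
  have hi: "h integrable_on {0..T}" by (rule L2_integrable[OF h])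
  have Hcont: "continuous_on {0..T} H"
    unfolding H_def[abs_def] by (rule indefinite_integral_continuous_1[OF hi])
  have Lip: "norm ((Y t - H t) - (Y s - H s)) \<le> L * (t - s)" if st: "0 \<le> s" "s \<le> t" "t \<le> T" for s t
  proof -
    have "norm ((y k t - H t) - (y k s - H s)) \<le> L * (t - s)" for k
    proof -
      have si: "\<sigma> k integrable_on {0..T}" by (rule L2_integrable[OF \<sigma>L2])
      have sub: "f integrable_on {s..t}" if "f integrable_on {0..T}" for f :: "real \<Rightarrow> 'a"
        by (rule integrable_subinterval_real[OF that]) (use st in auto)
      have "y k t - y k s = integral {s..t} (\<lambda>r. h r - \<sigma> k r)"
        using primitive_shift[OF L2_integrable[OF gk] yk st] by simp
      also have "\<dots> = (H t - H s) - integral {s..t} (\<sigma> k)"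
        using integral_diff[OF sub[OF hi] sub[OF si]] integral_Icc_diff[OF hi st] by (simp add: H_def)
      finally have "(y k t - H t) - (y k s - H s) = - integral {s..t} (\<sigma> k)" by (simp add: algebra_simps)
      then have "norm ((y k t - H t) - (y k s - H s)) = norm (integral {s..t} (\<sigma> k))" by simp
      also have "\<dots> \<le> integral {s..t} (\<lambda>_. L)"
        using st \<sigma>(2) by (intro Henstock_Kurzweil_Integration.integral_norm_bound_integral sub[OF si]) auto
      finally show ?thesis using st by (simp add: mult.commute)
    qed
    moreover have "(\<lambda>k. norm ((y k t - H t) - (y k s - H s))) \<longlonglongrightarrow> norm ((Y t - H t) - (Y s - H s))"
      using st by (intro tendsto_intros Ytend) auto
    ultimately show ?thesis by (intro LIMSEQ_le_const2) auto
  qed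
  \<comment> \<open>bounded quadratic variation, with constant \<open>L\<^sup>2 * T\<close>, from the Lipschitz bound\<close>
  obtain g0 where g0: "g0 \<in> L2 T" "\<And>t. t \<in> {0..T} \<Longrightarrow> Y t - H t = (Y 0 - H 0) + integral {0..t} g0"
  proof (rule Riesz_bounded_quadratic_variation[OF T, of "\<lambda>t. Y t - H t" "L\<^sup>2 * T"])
    show "continuous_on {0..T} (\<lambda>t. Y t - H t)" by (intro continuous_intros Ycont Hcont)
    fix N :: nat assume N: "0 < N"
    let ?d = "T / real N" and ?u = "\<lambda>t. Y t - H t"
    have "(\<Sum>i<N. (norm (?u (real (Suc i) * ?d) - ?u (real i * ?d)))\<^sup>2) \<le> (\<Sum>i<N. (L * ?d)\<^sup>2)"
    proof (intro sum_mono power_mono norm_ge_zero)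
      fix i assume "i \<in> {..<N}"
      then have "real (Suc i) * ?d \<le> real N * ?d" using T by (intro mult_right_mono of_nat_mono) auto
      moreover have "real N * ?d = T" using N by simp
      moreover have "0 \<le> real i * ?d" "real i * ?d \<le> real (Suc i) * ?d"
        using T by (intro mult_nonneg_nonneg mult_right_mono of_nat_mono; simp)+
      ultimately have le: "0 \<le> real i * ?d" "real i * ?d \<le> real (Suc i) * ?d" "real (Suc i) * ?d \<le> T"
        by simp_all
      have "real (Suc i) * ?d - real i * ?d = ?d" unfolding of_nat_Suc distrib_right by simp
      with Lip[OF le] show "norm (?u (real (Suc i) * ?d) - ?u (real i * ?d)) \<le> L * ?d" by simp
    qed
    also have "\<dots> = L\<^sup>2 * T * ?d" using N by (simp add: power2_eq_square field_simps)
    finally show "(\<Sum>i<N. (norm (?u (real (Suc i) * ?d) - ?u (real i * ?d)))\<^sup>2) \<le> L\<^sup>2 * T * ?d" .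
  qed blast
  define g where "g t = h t + g0 t" for t
  have gL2: "g \<in> L2 T" unfolding g_def[abs_def] by (rule L2_add[OF h g0(1)])
  have Yprim: "Y t = Y 0 + integral {0..t} g" if t: "t \<in> {0..T}" for t
  proof -
    have "h integrable_on {0..t}" "g0 integrable_on {0..t}"
      by (rule integrable_subinterval_real[OF hi], use t in simp)
         (rule integrable_subinterval_real[OF L2_integrable[OF g0(1)]], use t in simp)
    then have "integral {0..t} g = H t + integral {0..t} g0"
      unfolding g_def[abs_def] by (simp add: integral_add H_def)
    then show ?thesis using g0(2)[OF t] by (simp add: H_def algebra_simps)
  qed
  define F where "F z r = \<psi> r z - \<psi> r (Y r) - (h r - g r) \<bullet> (z - Y r)" for z r
  have \<psi>cont: "continuous_on {0..T} (\<lambda>r. \<psi> r (v r))" if v: "continuous_on {0..T} v" for v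
    unfolding continuous_on_iff
  proof (intro ballI allI impI)
    fix r e :: real assume r: "r \<in> {0..T}" and e: "0 < e"
    obtain d1 where d1: "0 < d1" "\<And>s t x. s \<in> {0..T} \<Longrightarrow> t \<in> {0..T} \<Longrightarrow> \<bar>s - t\<bar> < d1 \<Longrightarrow> \<bar>\<psi> s x - \<psi> t x\<bar> \<le> e/3"
      using time[of "e/3"] e by auto
    have "0 < e / (3 * (L + 1))" using e L by simp
    then obtain d2 where d2: "0 < d2" "\<And>s. s \<in> {0..T} \<Longrightarrow> dist s r < d2 \<Longrightarrow> dist (v s) (v r) < e / (3 * (L + 1))"
      using v r unfolding continuous_on_iff by metis
    have "dist (\<psi> s (v s)) (\<psi> r (v r)) < e" if s: "s \<in> {0..T}" "dist s r < min d1 d2" for s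
    proof -
      have "\<bar>\<psi> s (v s) - \<psi> r (v s)\<bar> \<le> e/3" using s r by (intro d1(2)) (auto simp: dist_real_def)
      moreover have "\<bar>\<psi> r (v s) - \<psi> r (v r)\<bar> \<le> L * norm (v s - v r)" by (rule lip[OF r])
      moreover have "L * norm (v s - v r) \<le> L * (e / (3 * (L + 1)))"
        using d2(2)[OF s(1)] s(2) L by (intro mult_left_mono) (auto simp: dist_norm)
      moreover have "L * (e / (3 * (L + 1))) \<le> e/3" using L e by (simp add: field_simps)
      ultimately show ?thesis using e unfolding dist_real_def by linarith
    qed
    then show "\<exists>d>0. \<forall>s\<in>{0..T}. dist s r < d \<longrightarrow> dist (\<psi> s (v s)) (\<psi> r (v r)) < e"
      using d1(1) d2(1) by (intro exI[of _ "min d1 d2"]) auto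
  qed
  have zY: "continuous_on {0..T} (\<lambda>r. z - Y r)" for z by (intro continuous_intros Ycont)
  have Fint: "F z absolutely_integrable_on {0..T}" for z
    unfolding F_def[abs_def]
    by (intro set_integral_diff(1) absolutely_integrable_continuous_real \<psi>cont continuous_intros Ycont
        L2_inner L2_diff h gL2 L2_continuous zY)
  have Fpos: "0 \<le> integral {s..t} (F z)" if st: "0 \<le> s" "s \<le> t" "t \<le> T" for s t z
  proof -
    have sub_int: "f integrable_on {s..t}" if "f integrable_on {0..T}" for f :: "real \<Rightarrow> real"
      by (rule integrable_subinterval_real[OF that]) (use st in auto)
    have gn: "(\<lambda>r. norm (g r)) integrable_on {s..t}"
      by (intro sub_int set_lebesgue_integral_eq_integral(1) set_integrable_norm L2_D gL2)
    define C where "C = norm (z - Y t) + norm (z - Y s) + integral {s..t} (\<lambda>r. norm (g r)) + (2 * L + 1) * (t - s)"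
    have C0: "0 \<le> C"
      unfolding C_def using L st by (intro add_nonneg_nonneg mult_nonneg_nonneg integral_nonneg gn) auto
    have est: "- (e * C) \<le> integral {s..t} (F z)" if e: "0 < e" for e
    proof -
      obtain K1 where K1: "\<And>k t. k \<ge> K1 \<Longrightarrow> t \<in> {0..T} \<Longrightarrow> norm (y k t - Y t) \<le> e" using Ylim[OF e] by blast
      obtain K2 where K2: "\<And>k. k \<ge> K2 \<Longrightarrow> 1 / real (Suc k) \<le> e" using inv[OF e] by blast
      define k where "k = max K1 K2"
      have k: "\<And>t. t \<in> {0..T} \<Longrightarrow> norm (y k t - Y t) \<le> e" "1 / real (Suc k) \<le> e"
        using K1 K2 by (auto simp: k_def)
      let ?gk = "\<lambda>r. h r - \<sigma> k r"
      \<comment> \<open>the error of replacing the velocity of the polygon by \<open>g\<close>, which is small only after integration\<close>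
      let ?E = "\<lambda>r. (g r - ?gk r) \<bullet> (z - Y r)"
      have pt: "- (e * (2 * L + 1)) \<le> F z r - ?E r" if "r \<in> {s..t}" for r
      proof -
        have r: "r \<in> {0..T}" using that st by auto
        have 1: "\<psi> r (y k r) + \<sigma> k r \<bullet> (z - y k r) \<le> \<psi> r z + e"
          using sub[OF r, of k z] k(2) by simp
        have "\<psi> r (Y r) - \<psi> r (y k r) \<le> L * norm (Y r - y k r)" using lip[OF r, of "Y r" "y k r"] by simp
        also have "\<dots> \<le> L * e" using k(1)[OF r] L by (intro mult_left_mono) (auto simp: norm_minus_commute)
        finally have 2: "\<psi> r (Y r) \<le> \<psi> r (y k r) + L * e" by simp
        have "\<sigma> k r \<bullet> (y k r - Y r) \<le> norm (\<sigma> k r) * norm (y k r - Y r)" by (rule norm_cauchy_schwarz)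
        also have "\<dots> \<le> L * e" using \<sigma>(2)[OF r] k(1)[OF r] L by (intro mult_mono) auto
        finally have 3: "\<sigma> k r \<bullet> (z - Y r) \<le> \<sigma> k r \<bullet> (z - y k r) + L * e" by (simp add: inner_diff_right)
        have "F z r - ?E r = \<psi> r z - \<psi> r (Y r) - \<sigma> k r \<bullet> (z - Y r)"
          by (simp add: F_def inner_diff_left)
        moreover have "e * (2 * L + 1) = L * e + L * e + e" by (simp add: algebra_simps)
        ultimately show ?thesis using 1 2 3 by linarith
      qed
      have gd: "(\<lambda>r. g r - ?gk r) \<in> L2 T" by (rule L2_diff[OF gL2 gk])
      have Ei: "?E integrable_on {s..t}"
        by (intro sub_int set_lebesgue_integral_eq_integral(1) L2_inner gd L2_continuous zY)
      have Fi: "F z integrable_on {s..t}"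
        by (intro sub_int set_lebesgue_integral_eq_integral(1) Fint)
      have "- (e * (2 * L + 1)) * (t - s) \<le> integral {s..t} (\<lambda>r. F z r - ?E r)"
        by (rule integral_lower_bound[OF integrable_diff[OF Fi Ei] st(2) pt])
      then have A: "- (e * (2 * L + 1)) * (t - s) \<le> integral {s..t} (F z) - integral {s..t} ?E"
        using integral_diff[OF Fi Ei] by simp
      let ?w = "\<lambda>r. Y r - y k r"
      have gki: "?gk integrable_on {0..t}" "g integrable_on {0..t}" if "t \<in> {0..T}" for t
        by (rule integrable_subinterval_real[OF L2_integrable[OF gk]], use that in simp)
           (rule integrable_subinterval_real[OF L2_integrable[OF gL2]], use that in simp)
      have w: "?w r = ?w 0 + integral {0..r} (\<lambda>r. g r - ?gk r)" if "r \<in> {0..T}" for r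
        unfolding integral_diff[OF gki(2)[OF that] gki(1)[OF that]] using Yprim[OF that] yk[of k r] by (simp add: algebra_simps)
      have mg: "(\<lambda>r. (-1) *\<^sub>R g r) \<in> L2 T" by (rule L2_scaleR[OF gL2])
      have zp: "z - Y r = (z - Y 0) + integral {0..r} (\<lambda>r. (-1) *\<^sub>R g r)" if "r \<in> {0..T}" for r
        using Yprim[OF that] by simp
      have "integral {s..t} (\<lambda>r. (g r - ?gk r) \<bullet> (z - Y r) + ?w r \<bullet> ((-1) *\<^sub>R g r)) =
            ?w t \<bullet> (z - Y t) - ?w s \<bullet> (z - Y s)"
        by (rule primitive_inner_rule[OF gd mg w zp st])
      moreover have wg: "(\<lambda>r. ?w r \<bullet> g r) integrable_on {s..t}"
        by (intro sub_int set_lebesgue_integral_eq_integral(1) L2_inner gL2 L2_diff L2_continuous Ycont ycont)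
      ultimately have Eeq: "integral {s..t} ?E - integral {s..t} (\<lambda>r. ?w r \<bullet> g r) =
            ?w t \<bullet> (z - Y t) - ?w s \<bullet> (z - Y s)"
        using integral_diff[OF Ei wg] by simp
      have wle: "norm (?w r) \<le> e" if "r \<in> {0..T}" for r using k(1)[OF that] by (simp add: norm_minus_commute)
      have inner_le: "\<bar>?w r \<bullet> x\<bar> \<le> e * norm x" if "r \<in> {0..T}" for r x
      proof -
        have "\<bar>?w r \<bullet> x\<bar> \<le> norm (?w r) * norm x" by (rule Cauchy_Schwarz_ineq2)
        also have "\<dots> \<le> e * norm x" using wle[OF that] by (rule mult_right_mono) simp
        finally show ?thesis .
      qed
      have "norm (integral {s..t} (\<lambda>r. ?w r \<bullet> g r)) \<le> integral {s..t} (\<lambda>r. e * norm (g r))"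
        using st by (intro Henstock_Kurzweil_Integration.integral_norm_bound_integral wg integrable_on_mult_right gn)
          (use inner_le in auto)
      then have B: "\<bar>integral {s..t} (\<lambda>r. ?w r \<bullet> g r)\<bar> \<le> e * integral {s..t} (\<lambda>r. norm (g r))" by simp
      have ts: "t \<in> {0..T}" "s \<in> {0..T}" using st by auto
      have lin: "- c \<le> F'" if "c = a1 + a2 + a3 + X" "- X \<le> F' - E'" "E' - W = p - q" "\<bar>W\<bar> \<le> a3" "\<bar>p\<bar> \<le> a1" "\<bar>q\<bar> \<le> a2"
        for c a1 a2 a3 X F' E' W p q :: real
        using that by linarith
      have "e * C = e * norm (z - Y t) + e * norm (z - Y s) + e * integral {s..t} (\<lambda>r. norm (g r)) + (e * (2 * L + 1)) * (t - s)"
        by (simp add: C_def algebra_simps)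
      then show ?thesis
        by (rule lin[OF _ A[unfolded mult_minus_left] Eeq B inner_le[OF ts(1)] inner_le[OF ts(2)]])
    qed
    show ?thesis
    proof (rule ccontr)
      assume neg: "\<not> 0 \<le> integral {s..t} (F z)"
      define I where "I = integral {s..t} (F z)"
      have I: "I < 0" using neg by (simp add: I_def)
      define q where "q = - I / (2 * (C + 1))"
      have q: "0 < q" using I C0 by (simp add: q_def divide_neg_pos)
      have "- (q * C) \<le> I" unfolding I_def by (rule est[OF q])
      moreover have "q * (2 * (C + 1)) = - I" using C0 by (simp add: q_def)
      then have "2 * (q * C) + 2 * q = - I" by (simp add: algebra_simps)
      ultimately show False using I q by linarith
    qed
  qed
  have neg: "negligible {t \<in> {0..T}. F z t < 0}" for z
    using Fpos by (intro AE_nonneg_if_interval_integrals_nonneg[OF T Fint]) auto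
  obtain D :: "'a set" where D: "countable D" "\<And>X. open X \<Longrightarrow> X \<noteq> {} \<Longrightarrow> \<exists>d\<in>D. d \<in> X"
    using countable_dense_exists by metis
  define Z where "Z = (\<Union>z\<in>D. {t \<in> {0..T}. F z t < 0})"
  show ?thesis
  proof (rule that[of g Y Z, OF gL2 Y0])
    show "\<forall>t\<in>{0..T}. Y t = Y 0 + integral {0..t} g" using Yprim by blast
    show "negligible Z" unfolding Z_def using D(1) neg by (intro negligible_countable_Union) auto
    show "\<forall>t\<in>{0..T} - Z. is_subgradient (\<psi> t) (Y t) (h t - g t)"
    proof
      fix t assume t: "t \<in> {0..T} - Z"
      have FD: "0 \<le> F z t" if "z \<in> D" for z using t that by (force simp: Z_def not_less)
      have cont: "continuous_on UNIV (\<lambda>z. F z t)"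
        unfolding F_def using conv[of t] t
        by (intro continuous_intros convex_imp_continuous) auto
      have "0 \<le> F z t" for z
      proof (rule ccontr)
        assume "\<not> 0 \<le> F z t"
        then have "z \<in> {z. F z t < 0}" by (simp add: not_le)
        then have "{z. F z t < 0} \<noteq> {}" by blast
        moreover have "open {z. F z t < 0}"
          by (intro open_Collect_less cont continuous_intros)
        ultimately show False using D(2) FD by (metis mem_Collect_eq not_less)
      qed
      then show "is_subgradient (\<psi> t) (Y t) (h t - g t)"
        unfolding is_subgradient_def F_def by (auto simp: algebra_simps)
    qed
  qed
qed

section \<open>Reduction to the free coordinates\<close>

definition coord_proj :: "'v::finite set \<Rightarrow> real^'v \<Rightarrow> real^'v" where
  "coord_proj I x = (\<chi> v. if v \<in> I then x $ v else 0)"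

lemma coord_proj_nth [simp]: "coord_proj I x $ v = (if v \<in> I then x $ v else 0)"
  by (simp add: coord_proj_def)

lemma linear_coord_proj: "linear (coord_proj I)"
  by (rule linearI) (auto simp: vec_eq_iff)

lemma bounded_linear_coord_proj: "bounded_linear (coord_proj I)"
  by (rule linear_conv_bounded_linear[THEN iffD1, OF linear_coord_proj])

lemma coord_proj_simps [simp]:
  "coord_proj I (x + y) = coord_proj I x + coord_proj I y"
  "coord_proj I (x - y) = coord_proj I x - coord_proj I y"
  "coord_proj I (coord_proj I x) = coord_proj I x"
  "coord_proj I 0 = 0"
  by (auto simp: vec_eq_iff)

lemma coord_proj_inner: "coord_proj I x \<bullet> y = x \<bullet> coord_proj I y"
  unfolding inner_vec_def by (intro sum.cong) auto

lemma norm_coord_proj_le: "norm (coord_proj I x) \<le> norm x"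
  by (rule norm_le_componentwise_cart) auto

lemma integral_coord_proj:
  assumes "g integrable_on {s..t}"
  shows "integral {s..t} (\<lambda>r. coord_proj I (g r)) = coord_proj I (integral {s..t} g)"
  using integral_linear[OF assms bounded_linear_coord_proj] by (simp add: o_def)

text \<open>A state obeying the constraint is \<open>a t + y t\<close>, where \<open>y\<close> lives on the free coordinates \<open>I\<close>. The
subdifferential of the indicator of the constraint set consists of all vectors whose free part
vanishes; so it absorbs the other coordinates of the inclusion, and only the projected inclusion for
\<open>y\<close>, with integrand \<open>g\<close>, is left.\<close>

definition reduced_solution ::
    "(real^'v::finite \<Rightarrow> real) \<Rightarrow> 'v set \<Rightarrow> real \<Rightarrow> (real \<Rightarrow> real^'v) \<Rightarrow> (real \<Rightarrow> real^'v) \<Rightarrow>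
     (real \<Rightarrow> real^'v) \<Rightarrow> (real \<Rightarrow> real^'v) \<Rightarrow> bool" where
  "reduced_solution \<phi> I T h a y g \<longleftrightarrow> g \<in> L2 T \<and>
     (\<forall>t\<in>{0..T}. y t = y 0 + integral {0..t} g \<and> coord_proj I (y t) = y t) \<and>
     (\<exists>Z. negligible Z \<and> (\<forall>t\<in>{0..T} - Z. \<exists>\<eta>. is_subgradient \<phi> (a t + y t) \<eta> \<and>
        g t + coord_proj I \<eta> = coord_proj I (h t)))"

lemma reduced_solutionD:
  assumes "reduced_solution \<phi> I T h a y g"
  shows "g \<in> L2 T" "\<And>t. t \<in> {0..T} \<Longrightarrow> y t = y 0 + integral {0..t} g"
    "\<And>t. t \<in> {0..T} \<Longrightarrow> coord_proj I (y t) = y t" "continuous_on {0..T} y"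
proof -
  show 1: "g \<in> L2 T" "\<And>t. t \<in> {0..T} \<Longrightarrow> y t = y 0 + integral {0..t} g"
    "\<And>t. t \<in> {0..T} \<Longrightarrow> coord_proj I (y t) = y t"
    using assms unfolding reduced_solution_def by blast+
  show "continuous_on {0..T} y" by (rule primitive_continuous[OF L2_integrable[OF 1(1)] 1(2)])
qed

lemma integral_le_AE:
  fixes f g :: "real \<Rightarrow> real"
  assumes "f integrable_on S" "g integrable_on S" "negligible Z" "\<And>r. r \<in> S - Z \<Longrightarrow> f r \<le> g r"
  shows "integral S f \<le> integral S g"
proof -
  let ?f = "\<lambda>r. if r \<in> Z then g r else f r"
  have "integral S f = integral S ?f" by (rule integral_spike[OF assms(3)]) auto
  moreover have "?f integrable_on S" by (rule integrable_spike[OF assms(1,3)]) auto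
  then have "integral S ?f \<le> integral S g" using assms by (intro integral_le) auto
  ultimately show ?thesis by simp
qed

text \<open>Compare with the state \<open>y = 0\<close>: for a nonnegative energy the subgradient inequality gives
\<open>g \<bullet> y \<le> norm h * norm y + \<phi> a\<close>. Evaluated up to the time where \<open>norm y\<close> is maximal, the product
rule yields a quadratic inequality for the maximum. The bound depends on \<open>\<phi>\<close> only through its values along the control.\<close>

lemma reduced_solution_bound:
  assumes T: "0 < T" and h: "h \<in> L2 T" and nonneg: "\<And>x. 0 \<le> \<phi> x"
    and \<Phi>: "\<And>t. t \<in> {0..T} \<Longrightarrow> \<phi> (a t) \<le> \<Phi>"
    and sol: "reduced_solution \<phi> I T h a y g" and t: "t \<in> {0..T}"
  shows "norm (y t) \<le> 1 + (norm (y 0))\<^sup>2 + 2 * integral {0..T} (\<lambda>r. norm (h r)) + 2 * \<Phi> * T"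
proof -
  note D = reduced_solutionD[OF sol]
  obtain Z where Z: "negligible Z" "\<And>r. r \<in> {0..T} - Z \<Longrightarrow> \<exists>\<eta>. is_subgradient \<phi> (a r + y r) \<eta> \<and>
        g r + coord_proj I \<eta> = coord_proj I (h r)"
    using sol unfolding reduced_solution_def by blast
  have hn: "(\<lambda>r. norm (h r)) integrable_on {0..T}"
    by (intro set_lebesgue_integral_eq_integral(1) set_integrable_norm L2_D h)
  have \<Phi>0: "0 \<le> \<Phi>" using \<Phi>[of 0] nonneg[of "a 0"] T by simp
  define H where "H = integral {0..T} (\<lambda>r. norm (h r))"
  have H0: "0 \<le> H" unfolding H_def by (intro integral_nonneg hn) auto
  have "compact {0..T}" "{0..T} \<noteq> {}" using T by auto
  moreover have "continuous_on {0..T} (\<lambda>t. norm (y t))" by (intro continuous_intros D)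
  ultimately obtain m where m: "m \<in> {0..T}" "\<And>t. t \<in> {0..T} \<Longrightarrow> norm (y t) \<le> norm (y m)"
    using continuous_attains_sup by metis
  define Y where "Y = norm (y m)"
  have pt: "g r \<bullet> y r \<le> norm (h r) * Y + \<Phi>" if r: "r \<in> {0..m} - Z" for r
  proof -
    have r': "r \<in> {0..T}" using r m by auto
    obtain \<eta> where \<eta>: "is_subgradient \<phi> (a r + y r) \<eta>" "g r + coord_proj I \<eta> = coord_proj I (h r)"
      using Z(2)[of r] r r' by blast
    have "g r \<bullet> y r = coord_proj I (h r - \<eta>) \<bullet> y r"
      using \<eta>(2) by (simp add: eq_diff_eq flip: \<eta>(2))
    also have "\<dots> = h r \<bullet> y r - \<eta> \<bullet> y r"
      by (simp only: coord_proj_inner D(3)[OF r'] inner_diff_left)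
    also have "- (\<eta> \<bullet> y r) \<le> \<phi> (a r) - \<phi> (a r + y r)"
      using \<eta>(1)[unfolded is_subgradient_def, rule_format, of "a r"] by simp
    then have "h r \<bullet> y r - \<eta> \<bullet> y r \<le> h r \<bullet> y r + \<Phi>"
      using \<Phi>[OF r'] nonneg[of "a r + y r"] by simp
    also have "h r \<bullet> y r \<le> norm (h r) * norm (y r)" by (rule norm_cauchy_schwarz)
    also have "\<dots> \<le> norm (h r) * Y" unfolding Y_def by (intro mult_left_mono m(2)[OF r']) simp
    finally show ?thesis by simp
  qed
  have hn': "(\<lambda>r. norm (h r)) integrable_on {0..m}"
    by (rule integrable_subinterval_real[OF hn]) (use m in auto)
  have gy: "(\<lambda>r. g r \<bullet> y r) integrable_on {0..m}"
    by (rule integrable_subinterval_real[OF set_lebesgue_integral_eq_integral(1)[OF L2_inner[OF D(1) L2_continuous[OF D(4)]]]])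
      (use m in auto)
  have "integral {0..m} (\<lambda>r. g r \<bullet> y r) \<le> integral {0..m} (\<lambda>r. norm (h r) * Y + \<Phi>)"
    by (rule integral_le_AE[OF gy _ Z(1) pt]) (auto intro!: integrable_add integrable_on_mult_left hn')
  also have "\<dots> = integral {0..m} (\<lambda>r. norm (h r)) * Y + \<Phi> * m"
    using m by (subst integral_add) (auto intro!: integrable_on_mult_left hn')
  also have "\<dots> \<le> H * Y + \<Phi> * T"
    unfolding H_def Y_def using m \<Phi>0
    by (intro add_mono mult_right_mono mult_left_mono integral_subset_le hn hn') auto
  finally have "Y\<^sup>2 \<le> (norm (y 0))\<^sup>2 + 2 * H * Y + 2 * \<Phi> * T"
    using primitive_norm_sq[OF D(1,2) m(1)] by (simp add: Y_def)
  have "Y \<le> 1 + (norm (y 0))\<^sup>2 + 2 * H + 2 * \<Phi> * T"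
  proof (cases "Y \<le> 1")
    case True
    then show ?thesis using H0 \<Phi>0 T by (smt (verit) mult_nonneg_nonneg zero_le_power2)
  next
    case False
    then have "Y * Y \<le> ((norm (y 0))\<^sup>2 + 2 * H + 2 * \<Phi> * T) * Y"
    proof -
      have "c \<le> c * Y" if "0 \<le> c" for c using False mult_left_mono[of 1 Y c] that by simp
      from this[of "(norm (y 0))\<^sup>2"] this[of "2 * \<Phi> * T"] \<Phi>0 T
      have "(norm (y 0))\<^sup>2 \<le> (norm (y 0))\<^sup>2 * Y" "2 * \<Phi> * T \<le> 2 * \<Phi> * T * Y" by auto
      with \<open>Y\<^sup>2 \<le> _\<close> show ?thesis by (simp add: power2_eq_square distrib_right)
    qed
    then have "Y \<le> (norm (y 0))\<^sup>2 + 2 * H + 2 * \<Phi> * T"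
      using False by (intro mult_right_le_imp_le[of Y Y]) auto
    then show ?thesis by simp
  qed
  then show ?thesis using m(2)[OF t] by (simp add: Y_def H_def)
qed

text \<open>A gradient flow of the time-dependent function \<open>y \<mapsto> \<phi> (a t + coord_proj I y)\<close>. Its subgradients have
no component outside \<open>I\<close>, so the flow stays in the free coordinates.\<close>

lemma reduced_solution_exists_Lipschitz:
  assumes T: "0 < T" and h: "h \<in> L2 T" and a: "continuous_on {0..T} a"
    and conv: "convex_on UNIV \<phi>" and L: "0 \<le> L" and lip: "\<And>x y. \<bar>\<phi> x - \<phi> y\<bar> \<le> L * norm (x - y)"
    and y0: "coord_proj I y0 = y0"
  obtains y g where "reduced_solution \<phi> I T h a y g" "y 0 = y0"
proof -
  let ?P = "coord_proj I" and ?\<psi> = "\<lambda>t y. \<phi> (a t + coord_proj I y)"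
  have Ph: "(\<lambda>t. ?P (h t)) \<in> L2 T" by (rule L2_bounded_linear[OF h bounded_linear_coord_proj])
  have c: "convex_on UNIV (?\<psi> t)" for t
  proof (rule convex_onI)
    fix s :: real and x y assume s: "0 < s" "s < 1"
    have "a t + ?P ((1 - s) *\<^sub>R x + s *\<^sub>R y) = (1 - s) *\<^sub>R (a t + ?P x) + s *\<^sub>R (a t + ?P y)"
      by (auto simp: vec_eq_iff algebra_simps)
    then show "\<phi> (a t + ?P ((1 - s) *\<^sub>R x + s *\<^sub>R y)) \<le> (1 - s) * \<phi> (a t + ?P x) + s * \<phi> (a t + ?P y)"
      using convex_onD[OF conv, of s "a t + ?P x" "a t + ?P y"] s by simp
  qed simp
  have l: "\<bar>?\<psi> t x - ?\<psi> t y\<bar> \<le> L * norm (x - y)" for t x y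
  proof -
    have "\<bar>?\<psi> t x - ?\<psi> t y\<bar> \<le> L * norm (?P (x - y))" using lip[of "a t + ?P x" "a t + ?P y"] by simp
    also have "\<dots> \<le> L * norm (x - y)" using L by (intro mult_left_mono norm_coord_proj_le)
    finally show ?thesis .
  qed
  have time: "\<exists>d>0. \<forall>s\<in>{0..T}. \<forall>t\<in>{0..T}. \<bar>s - t\<bar> < d \<longrightarrow> (\<forall>x. \<bar>?\<psi> s x - ?\<psi> t x\<bar> \<le> e)" if e: "0 < e" for e
  proof -
    have "uniformly_continuous_on {0..T} a" using a by (intro compact_uniformly_continuous) auto
    moreover have "0 < e / (L + 1)" using e L by simp
    ultimately obtain d where d: "0 < d"
      "\<And>s t. s \<in> {0..T} \<Longrightarrow> t \<in> {0..T} \<Longrightarrow> \<bar>s - t\<bar> < d \<Longrightarrow> norm (a s - a t) < e / (L + 1)"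
      unfolding uniformly_continuous_on_def dist_real_def dist_norm by blast
    have "\<bar>?\<psi> s x - ?\<psi> t x\<bar> \<le> e" if "s \<in> {0..T}" "t \<in> {0..T}" "\<bar>s - t\<bar> < d" for s t x
    proof -
      have "\<bar>?\<psi> s x - ?\<psi> t x\<bar> \<le> L * norm (a s - a t)" using lip[of "a s + ?P x" "a t + ?P x"] by simp
      also have "\<dots> \<le> L * (e / (L + 1))" using d(2)[OF that] L by (intro mult_left_mono) auto
      also have "\<dots> \<le> e" using L e by (simp add: field_simps)
      finally show ?thesis .
    qed
    then show ?thesis using d(1) by blast
  qed
  obtain y g Z where flow: "g \<in> L2 T" "y 0 = y0" "\<forall>t\<in>{0..T}. y t = y 0 + integral {0..t} g"
    "negligible Z" "\<forall>t\<in>{0..T} - Z. is_subgradient (?\<psi> t) (y t) (?P (h t) - g t)"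
    by (rule gradient_flow_exists[OF T c L l time Ph, of y0])
  note g = flow(1) and y = flow(2) bspec[OF flow(3)] and Z = flow(4) bspec[OF flow(5)]
  have lift: "\<exists>\<eta>. is_subgradient \<phi> (a t + ?P (y t)) \<eta> \<and> g t + ?P \<eta> = ?P (h t)" if t: "t \<in> {0..T} - Z" for t
  proof -
    have "\<phi> (a t + ?P (y t)) + (?P (h t) - g t) \<bullet> x \<le> \<phi> (a t + ?P (y t) + ?P x)" for x
      using Z(2)[OF t, unfolded is_subgradient_def, rule_format, of "y t + x"] by (simp add: add.assoc)
    from conv linear_coord_proj this show ?thesis
    proof (rule Hahn_Banach_subgradient)
      fix \<eta> assume \<eta>: "is_subgradient \<phi> (a t + ?P (y t)) \<eta>" "\<And>x. \<eta> \<bullet> ?P x = (?P (h t) - g t) \<bullet> x"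
      have "?P \<eta> \<bullet> x = (?P (h t) - g t) \<bullet> x" for x
        by (rule trans[OF coord_proj_inner \<eta>(2)])
      then have "?P \<eta> = ?P (h t) - g t"
        using vector_eq_rdot by blast
      then show ?thesis using \<eta>(1) by (intro exI[of _ \<eta>]) simp
    qed
  qed
  have Pg: "?P (g t) = g t" if t: "t \<in> {0..T} - Z" for t
  proof -
    obtain \<eta> where "g t + ?P \<eta> = ?P (h t)" using lift[OF t] by blast
    then have "g t = ?P (h t - \<eta>)" by (simp add: eq_diff_eq)
    then show ?thesis by simp
  qed
  have Py: "?P (y t) = y t" if t: "t \<in> {0..T}" for t
  proof -
    have gt: "g integrable_on {0..t}"
      by (rule integrable_subinterval_real[OF L2_integrable[OF g]]) (use t in auto)
    have "?P (integral {0..t} g) = integral {0..t} (\<lambda>r. ?P (g r))" by (simp add: integral_coord_proj[OF gt])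
    also have "\<dots> = integral {0..t} g"
      by (rule integral_spike[OF Z(1)]) (use Pg t in auto)
    finally show ?thesis using y(1) y0 by (simp add: y(2)[OF t])
  qed
  have "reduced_solution \<phi> I T h a y g"
    unfolding reduced_solution_def
  proof (intro conjI ballI exI[of _ Z])
    show "g \<in> L2 T" "negligible Z" by fact+
    show "y t = y 0 + integral {0..t} g" "?P (y t) = y t" if "t \<in> {0..T}" for t
      using that y Py by blast+
    show "\<exists>\<eta>. is_subgradient \<phi> (a t + y t) \<eta> \<and> g t + ?P \<eta> = ?P (h t)" if "t \<in> {0..T} - Z" for t
      using lift[OF that] Py[of t] that by simp
  qed
  then show ?thesis using that y(1) by blast
qed

text \<open>Solve first for a Lipschitz convex minorant that agrees with \<open>\<phi>\<close> on a large ball. The a priori bound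
is the same for \<open>\<phi>\<close> and for the minorant, whatever the radius; so the ball can be chosen in advance
such that the solution never leaves it.\<close>

lemma reduced_solution_exists:
  assumes T: "0 < T" and h: "h \<in> L2 T" and a: "continuous_on {0..T} a"
    and conv: "convex_on UNIV \<phi>" and nonneg: "\<And>x. 0 \<le> \<phi> x"
    and y0: "coord_proj I y0 = y0"
  obtains y g where "reduced_solution \<phi> I T h a y g" "y 0 = y0"
proof -
  have "compact (a ` {0..T})" using a by (intro compact_continuous_image) auto
  then obtain A where A: "\<And>t. t \<in> {0..T} \<Longrightarrow> norm (a t) \<le> A"
    using compact_imp_bounded bounded_iff by (metis imageI)
  obtain \<Phi> where \<Phi>: "0 \<le> \<Phi>" "\<And>x. norm x \<le> A \<Longrightarrow> \<bar>\<phi> x\<bar> \<le> \<Phi>"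
    using continuous_bounded_cball[OF convex_imp_continuous[OF conv]] by blast
  define B where "B = 1 + (norm y0)\<^sup>2 + 2 * integral {0..T} (\<lambda>r. norm (h r)) + 2 * \<Phi> * T"
  obtain \<psi> L where \<psi>: "convex_on UNIV \<psi>" "\<And>x. 0 \<le> \<psi> x" "\<And>x. \<psi> x \<le> \<phi> x"
    "\<And>x. norm x \<le> A + B \<Longrightarrow> \<psi> x = \<phi> x" "0 \<le> L" "\<And>x y. \<bar>\<psi> x - \<psi> y\<bar> \<le> L * norm (x - y)"
    using Lipschitz_convex_minorant[OF conv nonneg] by metis
  obtain y g where sol: "reduced_solution \<psi> I T h a y g" and y: "y 0 = y0"
    by (rule reduced_solution_exists_Lipschitz[OF T h a \<psi>(1,5,6) y0])
  have "\<psi> (a t) \<le> \<Phi>" if "t \<in> {0..T}" for t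
    using \<psi>(3)[of "a t"] \<Phi>(2)[OF A[OF that]] by simp
  then have bound: "norm (y t) \<le> B" if "t \<in> {0..T}" for t
    using reduced_solution_bound[OF T h \<psi>(2) _ sol that, of \<Phi>] by (simp add: B_def y)
  have "is_subgradient \<phi> (a t + y t) \<eta>" if "t \<in> {0..T}" "is_subgradient \<psi> (a t + y t) \<eta>" for t \<eta>
  proof -
    have "norm (a t + y t) \<le> A + B"
      using norm_triangle_ineq[of "a t" "y t"] A[OF that(1)] bound[OF that(1)] by linarith
    then have "\<psi> (a t + y t) = \<phi> (a t + y t)" by (rule \<psi>(4))
    then show ?thesis using that(2) \<psi>(3) unfolding is_subgradient_def by (metis order_trans)
  qed
  then have "reduced_solution \<phi> I T h a y g"
    using sol unfolding reduced_solution_def by (metis Diff_iff)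
  then show ?thesis using that y by blast
qed

text \<open>Adding the two subgradient inequalities, each at the state that combines its own control with the
other free part, leaves only the change of \<open>\<phi>\<close> caused by exchanging the controls. For \<open>a = b\<close> this
is uniqueness.\<close>

lemma reduced_solution_difference:
  assumes T: "0 < T"
    and sola: "reduced_solution \<phi> I T h a y f" and solb: "reduced_solution \<phi> I T h b z g"
    and init: "y 0 = z 0"
    and close: "\<And>r. r \<in> {0..T} \<Longrightarrow> \<bar>\<phi> (a r + y r) - \<phi> (b r + y r)\<bar> \<le> e"
      "\<And>r. r \<in> {0..T} \<Longrightarrow> \<bar>\<phi> (a r + z r) - \<phi> (b r + z r)\<bar> \<le> e"
    and t: "t \<in> {0..T}"
  shows "(norm (y t - z t))\<^sup>2 \<le> 4 * e * T"
proof -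
  note Da = reduced_solutionD[OF sola] and Db = reduced_solutionD[OF solb]
  obtain Z1 where Z1: "negligible Z1" "\<And>r. r \<in> {0..T} - Z1 \<Longrightarrow> \<exists>\<eta>. is_subgradient \<phi> (a r + y r) \<eta> \<and>
        f r + coord_proj I \<eta> = coord_proj I (h r)"
    using sola unfolding reduced_solution_def by blast
  obtain Z2 where Z2: "negligible Z2" "\<And>r. r \<in> {0..T} - Z2 \<Longrightarrow> \<exists>\<eta>. is_subgradient \<phi> (b r + z r) \<eta> \<and>
        g r + coord_proj I \<eta> = coord_proj I (h r)"
    using solb unfolding reduced_solution_def by blast
  let ?u = "\<lambda>r. y r - z r" and ?v = "\<lambda>r. f r - g r"
  have v: "?v \<in> L2 T" by (rule L2_diff[OF Da(1) Db(1)])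
  have fg: "f integrable_on {0..r}" "g integrable_on {0..r}" if "r \<in> {0..T}" for r
    by (rule integrable_subinterval_real[OF L2_integrable[OF Da(1)]], use that in simp)
       (rule integrable_subinterval_real[OF L2_integrable[OF Db(1)]], use that in simp)
  have u: "?u r = ?u 0 + integral {0..r} ?v" if "r \<in> {0..T}" for r
    unfolding integral_diff[OF fg[OF that]] using Da(2)[OF that] Db(2)[OF that] by (simp add: algebra_simps)
  have pt: "?v r \<bullet> ?u r \<le> 2 * e" if r: "r \<in> {0..t} - (Z1 \<union> Z2)" for r
  proof -
    have r': "r \<in> {0..T}" using r t by auto
    obtain \<eta> where \<eta>: "is_subgradient \<phi> (a r + y r) \<eta>" "f r + coord_proj I \<eta> = coord_proj I (h r)"
      using Z1(2)[of r] r r' by blast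
    obtain \<zeta> where \<zeta>: "is_subgradient \<phi> (b r + z r) \<zeta>" "g r + coord_proj I \<zeta> = coord_proj I (h r)"
      using Z2(2)[of r] r r' by blast
    have "?v r = coord_proj I (\<zeta> - \<eta>)"
      using \<eta>(2) \<zeta>(2) by (simp add: algebra_simps)
    then have "?v r \<bullet> ?u r = (\<zeta> - \<eta>) \<bullet> ?u r"
      using Da(3)[OF r'] Db(3)[OF r'] by (metis coord_proj_inner coord_proj_simps(2))
    also have "\<dots> = \<zeta> \<bullet> (b r + y r - (b r + z r)) + \<eta> \<bullet> (a r + z r - (a r + y r))"
      by (simp add: inner_diff_left inner_diff_right)
    also have "\<dots> \<le> (\<phi> (b r + y r) - \<phi> (b r + z r)) + (\<phi> (a r + z r) - \<phi> (a r + y r))"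
      using \<eta>(1)[unfolded is_subgradient_def, rule_format, of "a r + z r"]
        \<zeta>(1)[unfolded is_subgradient_def, rule_format, of "b r + y r"] by linarith
    also have "\<dots> \<le> 2 * e" using close(1)[OF r'] close(2)[OF r'] by linarith
    finally show ?thesis .
  qed
  have "(\<lambda>r. ?v r \<bullet> ?u r) integrable_on {0..T}"
    by (intro set_lebesgue_integral_eq_integral(1) L2_inner v L2_diff L2_continuous Da Db)
  then have vu: "(\<lambda>r. ?v r \<bullet> ?u r) integrable_on {0..t}"
    by (rule integrable_subinterval_real) (use t in auto)
  have "(norm (?u t))\<^sup>2 = (norm (?u 0))\<^sup>2 + 2 * integral {0..t} (\<lambda>r. ?v r \<bullet> ?u r)"
    by (rule primitive_norm_sq[OF v u t])
  also have "\<dots> = 2 * integral {0..t} (\<lambda>r. ?v r \<bullet> ?u r)" by (simp add: init)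
  also have "integral {0..t} (\<lambda>r. ?v r \<bullet> ?u r) \<le> integral {0..t} (\<lambda>r. 2 * e)"
    by (rule integral_le_AE[OF vu _ negligible_Un[OF Z1(1) Z2(1)] pt]) auto
  also have "\<dots> = 2 * e * t" using t by simp
  also have "0 \<le> e" using close(1)[OF t] by simp
  then have "2 * (2 * e * t) \<le> 4 * e * T" using t by (simp add: mult_left_mono)
  finally show ?thesis by simp
qed

section \<open>The solution map\<close>

lemma controls_proj_zero:
  assumes "a \<in> controls node n T" "t \<in> {0..T}"
  shows "coord_proj (node ` {1..n}) (a t) = 0"
  using assms by (auto simp: controls_def vec_eq_iff)

lemma constraint_set_iff:
  fixes x :: "real^'v::finite"
  assumes bij: "bij_betw node {1..n + m} UNIV"
  shows "x \<in> constraint_set node n m a t \<longleftrightarrow> (\<forall>v. v \<notin> node ` {1..n} \<longrightarrow> x $ v = a t $ v)"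
proof
  assume x: "x \<in> constraint_set node n m a t"
  show "\<forall>v. v \<notin> node ` {1..n} \<longrightarrow> x $ v = a t $ v"
  proof (intro allI impI)
    fix v assume v: "v \<notin> node ` {1..n}"
    have "v \<in> node ` {1..n + m}" using bij by (simp add: bij_betw_def)
    then obtain k where k: "k \<in> {1..n + m}" "v = node k" by blast
    with v have "n < k" by (meson atLeastAtMost_iff image_eqI not_le)
    then have "k - n \<in> {1..m}" "v = node (n + (k - n))" using k by auto
    then show "x $ v = a t $ v" using x unfolding constraint_set_def by blast
  qed
next
  assume x: "\<forall>v. v \<notin> node ` {1..n} \<longrightarrow> x $ v = a t $ v"
  have "node (n + j) \<notin> node ` {1..n}" if "j \<in> {1..m}" for j
  proof
    assume "node (n + j) \<in> node ` {1..n}"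
    then obtain i where "i \<in> {1..n}" "node (n + j) = node i" by auto
    moreover have "inj_on node {1..n + m}" using bij by (simp add: bij_betw_def)
    ultimately have "n + j = i" using that by (auto dest: inj_onD)
    then show False using \<open>i \<in> {1..n}\<close> that by auto
  qed
  then show "x \<in> constraint_set node n m a t" using x by (auto simp: constraint_set_def)
qed

text \<open>The free part of the initial state, which is the same for all controls.\<close>

definition free_initial :: "(nat \<Rightarrow> 'v::finite) \<Rightarrow> nat \<Rightarrow> nat \<Rightarrow> (nat \<Rightarrow> real) \<Rightarrow> real^'v" where
  "free_initial node n m \<xi> = (\<chi> v. if v \<in> node ` {1..n} then \<xi> (inv_into {1..n + m} node v) else 0)"

lemma coord_proj_free_initial:
  "coord_proj (node ` {1..n}) (free_initial node n m \<xi>) = free_initial node n m \<xi>"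
  by (simp add: free_initial_def vec_eq_iff)

lemma initial_state_eq:
  assumes bij: "bij_betw node {1..n + m} UNIV" and T: "0 < T" and a: "a \<in> controls node n T"
  shows "initial_state node n m \<xi> a = a 0 + free_initial node n m \<xi>"
proof -
  have "initial_state node n m \<xi> a $ v = (a 0 + free_initial node n m \<xi>) $ v" for v
  proof -
    have "v \<in> node ` {1..n + m}" using bij by (simp add: bij_betw_def)
    then obtain k where k: "k \<in> {1..n + m}" "v = node k" by blast
    have inj: "inj_on node {1..n + m}" using bij by (simp add: bij_betw_def)
    have inv: "inv_into {1..n + m} node v = k" using inv_into_f_f[OF inj k(1)] k(2) by simp
    have "v \<in> node ` {1..n} \<longleftrightarrow> k \<le> n"
      using k inj by (auto dest: inj_onD)
    moreover have "a 0 $ v = 0" if "v \<in> node ` {1..n}"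
      using a that T by (auto simp: controls_def)
    ultimately show ?thesis
      using inv unfolding initial_state_def free_initial_def Let_def by simp
  qed
  then show ?thesis by (simp add: vec_eq_iff)
qed

lemma subdifferential_indicator_iff:
  fixes x c :: "real^'v::finite"
  assumes K: "\<And>z. z \<in> K \<longleftrightarrow> (\<forall>v. v \<notin> I \<longrightarrow> z $ v = c $ v)" and x: "x \<in> K"
  shows "\<zeta> \<in> subdifferential (indicator_fun K) x \<longleftrightarrow> coord_proj I \<zeta> = 0"
proof
  assume \<zeta>: "\<zeta> \<in> subdifferential (indicator_fun K) x"
  have "\<zeta> $ v = 0" if v: "v \<in> I" for v
  proof -
    have le: "s * \<zeta> $ v \<le> 0" for s
    proof -
      have "x + s *\<^sub>R axis v 1 \<in> K" using x v by (auto simp: K axis_def)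
      moreover have "ereal (\<zeta> \<bullet> (x + s *\<^sub>R axis v 1 - x)) \<le>
          indicator_fun K (x + s *\<^sub>R axis v 1) - indicator_fun K x"
        using \<zeta> unfolding subdifferential_def by blast
      ultimately have "ereal (\<zeta> \<bullet> (x + s *\<^sub>R axis v 1 - x)) \<le> 0"
        using x by (simp add: indicator_fun_def)
      then show ?thesis by (simp add: inner_axis mult.commute)
    qed
    show ?thesis using le[of 1] le[of "-1"] by simp
  qed
  then show "coord_proj I \<zeta> = 0" by (simp add: vec_eq_iff)
next
  assume 0: "coord_proj I \<zeta> = 0"
  have "\<zeta> \<bullet> (z - x) = 0" if "z \<in> K" for z
  proof -
    have "coord_proj I (z - x) = z - x" using that x by (auto simp: K vec_eq_iff)
    then have "\<zeta> \<bullet> (z - x) = coord_proj I \<zeta> \<bullet> (z - x)" by (metis coord_proj_inner)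
    then show ?thesis by (simp add: 0)
  qed
  then show "\<zeta> \<in> subdifferential (indicator_fun K) x"
    using x by (auto simp: subdifferential_def indicator_fun_def)
qed

lemma is_solution_imp_reduced:
  assumes bij: "bij_betw node {1..n + m} UNIV" and T: "0 < T" and a: "a \<in> controls node n T"
    and sol: "is_solution E w p node n m T h \<xi> a x"
  defines "I \<equiv> node ` {1..n}"
  shows "\<exists>y g. reduced_solution (hypergraph_energy E w p) I T h a y g \<and>
    y 0 = free_initial node n m \<xi> \<and> (\<forall>t\<in>{0..T}. x t = a t + y t)"
proof -
  let ?P = "coord_proj I" and ?\<phi> = "hypergraph_energy E w p"
  have xW: "x \<in> W12 T" and con: "\<And>t. t \<in> {0..T} \<Longrightarrow> x t \<in> constraint_set node n m a t"
    and x0: "x 0 = initial_state node n m \<xi> a"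
    and ae: "AE t in lebesgue_on {0<..<T}.
        \<exists>\<eta> \<in> subdifferential (\<lambda>z. ereal (?\<phi> z)) (x t).
        \<exists>\<zeta> \<in> subdifferential (indicator_fun (constraint_set node n m a t)) (x t).
          weak_deriv T x t + \<eta> + \<zeta> = h t"
    using sol unfolding is_solution_def by auto
  note W = W12_weak_deriv[OF T xW]
  define y where "y t = ?P (x t)" for t
  define g where "g t = ?P (weak_deriv T x t)" for t
  have split: "x t = a t + y t" if "t \<in> {0..T}" for t
  proof (rule vec_eq_iff[THEN iffD2], rule allI)
    fix v
    show "x t $ v = (a t + y t) $ v"
    proof (cases "v \<in> I")
      case True
      then have "a t $ v = 0"
        using arg_cong[OF controls_proj_zero[OF a that], of "\<lambda>x. x $ v"] by (simp add: I_def)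
      then show ?thesis using True by (simp add: y_def)
    next
      case False
      then have "x t $ v = a t $ v"
        using con[OF that] unfolding constraint_set_iff[OF bij] I_def by blast
      then show ?thesis using False by (simp add: y_def)
    qed
  qed
  have gL2: "g \<in> L2 T" unfolding g_def[abs_def] by (rule L2_bounded_linear[OF W(2) bounded_linear_coord_proj])
  have prim: "y t = y 0 + integral {0..t} g" if t: "t \<in> {0..T}" for t
  proof -
    have "weak_deriv T x integrable_on {0..t}"
      by (rule integrable_subinterval_real[OF L2_integrable[OF W(2)]]) (use t in auto)
    then show ?thesis using arg_cong[OF W(3)[OF t], of ?P] by (simp add: y_def g_def[abs_def] integral_coord_proj)
  qed
  obtain N where N: "negligible N" "\<And>t. t \<in> {0<..<T} - N \<Longrightarrow>
        \<exists>\<eta> \<in> subdifferential (\<lambda>z. ereal (?\<phi> z)) (x t).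
        \<exists>\<zeta> \<in> subdifferential (indicator_fun (constraint_set node n m a t)) (x t).
          weak_deriv T x t + \<eta> + \<zeta> = h t"
    using ae by (subst (asm) AE_lebesgue_on_iff_negligible) auto
  have "negligible (N \<union> {0, T})" using N(1) by simp
  moreover have incl: "\<exists>\<eta>. is_subgradient ?\<phi> (a t + y t) \<eta> \<and> g t + ?P \<eta> = ?P (h t)"
    if t: "t \<in> {0..T} - (N \<union> {0, T})" for t
  proof -
    have t': "t \<in> {0<..<T} - N" "t \<in> {0..T}" using t by auto
    obtain \<eta> \<zeta> where \<eta>: "\<eta> \<in> subdifferential (\<lambda>z. ereal (?\<phi> z)) (x t)"
      and \<zeta>: "\<zeta> \<in> subdifferential (indicator_fun (constraint_set node n m a t)) (x t)"
      and eq: "weak_deriv T x t + \<eta> + \<zeta> = h t" using N(2)[OF t'(1)] by blast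
    have "?P \<zeta> = 0"
      using \<zeta> subdifferential_indicator_iff[OF constraint_set_iff[OF bij] con[OF t'(2)]] by (simp add: I_def)
    then have "g t + ?P \<eta> = ?P (h t)" unfolding eq[symmetric] by (simp add: g_def)
    then show ?thesis using \<eta> by (auto simp: subdifferential_ereal_iff split[OF t'(2)])
  qed
  ultimately have red: "reduced_solution ?\<phi> I T h a y g"
    unfolding reduced_solution_def
  proof (intro conjI ballI exI[of _ "N \<union> {0, T}"])
    show "y t = y 0 + integral {0..t} g" if "t \<in> {0..T}" for t using that by (rule prim)
    show "?P (y t) = y t" for t by (simp add: y_def)
  qed (use gL2 in auto)
  have "y 0 = free_initial node n m \<xi>"
    using controls_proj_zero[OF a, of 0] T coord_proj_free_initial[of node n m \<xi>]
    unfolding y_def x0 initial_state_eq[OF bij T a] by (simp add: I_def)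
  with red split show ?thesis by (intro exI[of _ y] exI[of _ g]) simp
qed

lemma reduced_imp_is_solution:
  assumes bij: "bij_betw node {1..n + m} UNIV" and T: "0 < T" and a: "a \<in> controls node n T"
    and red: "reduced_solution (hypergraph_energy E w p) (node ` {1..n}) T h a y g"
    and y0: "y 0 = free_initial node n m \<xi>"
  shows "is_solution E w p node n m T h \<xi> a (\<lambda>t. a t + y t)"
proof -
  let ?I = "node ` {1..n}"
  let ?P = "coord_proj ?I" and ?\<phi> = "hypergraph_energy E w p" and ?x = "\<lambda>t. a t + y t"
  note D = reduced_solutionD[OF red]
  have aW: "a \<in> W12 T" using a by (simp add: controls_def)
  note W = W12_weak_deriv[OF T aW]
  let ?a' = "weak_deriv T a"
  have i: "?a' integrable_on {0..t}" "g integrable_on {0..t}" if "t \<in> {0..T}" for t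
    by (rule integrable_subinterval_real[OF L2_integrable[OF W(2)]], use that in simp)
       (rule integrable_subinterval_real[OF L2_integrable[OF D(1)]], use that in simp)
  have xL2: "(\<lambda>t. ?a' t + g t) \<in> L2 T" by (rule L2_add[OF W(2) D(1)])
  have xprim: "?x t = ?x 0 + integral {0..t} (\<lambda>t. ?a' t + g t)" if "t \<in> {0..T}" for t
    unfolding integral_add[OF i[OF that]] using W(3)[OF that] D(2)[OF that] by (simp add: algebra_simps)
  note X = primitive_W12[OF T xL2 xprim]
  have con: "?x t \<in> constraint_set node n m a t" if "t \<in> {0..T}" for t
    unfolding constraint_set_iff[OF bij] using D(3)[OF that] by (auto simp: vec_eq_iff) metis
  \<comment> \<open>a control vanishes on the free coordinates, hence so does its derivative almost everywhere\<close>
  have Pa: "negligible {t \<in> {0..T}. ?P (?a' t) \<noteq> 0}"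
  proof (rule primitive_density_unique[OF T])
    show "(\<lambda>t. ?P (?a' t)) absolutely_integrable_on {0..T}"
      by (rule L2_D(1)[OF L2_bounded_linear[OF W(2) bounded_linear_coord_proj]])
    fix t assume t: "t \<in> {0..T}"
    have "?P (a t) = ?P (a 0) + ?P (integral {0..t} ?a')" using arg_cong[OF W(3)[OF t], of ?P] by simp
    then show "integral {0..t} (\<lambda>t. ?P (?a' t)) = integral {0..t} (\<lambda>_. 0)"
      using controls_proj_zero[OF a t] controls_proj_zero[OF a, of 0] T
      by (simp add: integral_coord_proj[OF i(1)[OF t]])
  qed simp
  obtain Z where Z: "negligible Z" "\<And>t. t \<in> {0..T} - Z \<Longrightarrow> \<exists>\<eta>. is_subgradient ?\<phi> (a t + y t) \<eta> \<and>
        g t + ?P \<eta> = ?P (h t)"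
    using red unfolding reduced_solution_def by blast
  define N where "N = Z \<union> {t \<in> {0..T}. ?P (?a' t) \<noteq> 0} \<union> {t \<in> {0..T}. weak_deriv T ?x t \<noteq> ?a' t + g t}"
  have N: "negligible N" unfolding N_def using Z(1) Pa X(2) by auto
  have "\<exists>\<eta> \<in> subdifferential (\<lambda>z. ereal (?\<phi> z)) (?x t).
        \<exists>\<zeta> \<in> subdifferential (indicator_fun (constraint_set node n m a t)) (?x t).
          weak_deriv T ?x t + \<eta> + \<zeta> = h t" if t: "t \<in> {0<..<T} - N" for t
  proof -
    have t': "t \<in> {0..T}" "t \<in> {0..T} - Z" using t by (auto simp: N_def)
    have wd: "weak_deriv T ?x t = ?a' t + g t" and Pa't: "?P (?a' t) = 0" using t by (auto simp: N_def)
    obtain \<eta> where \<eta>: "is_subgradient ?\<phi> (a t + y t) \<eta>" "g t + ?P \<eta> = ?P (h t)"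
      using Z(2)[OF t'(2)] by blast
    define \<zeta> where "\<zeta> = h t - weak_deriv T ?x t - \<eta>"
    have "g t = ?P (h t - \<eta>)" using \<eta>(2) by (simp add: eq_diff_eq)
    then have "?P (g t) = g t" by simp
    then have "?P \<zeta> = 0" using \<eta>(2) Pa't by (simp add: \<zeta>_def wd algebra_simps)
    then have "\<zeta> \<in> subdifferential (indicator_fun (constraint_set node n m a t)) (?x t)"
      using subdifferential_indicator_iff[OF constraint_set_iff[OF bij] con[OF t'(1)]] by simp
    moreover have "\<eta> \<in> subdifferential (\<lambda>z. ereal (?\<phi> z)) (?x t)"
      using \<eta>(1) by (simp add: subdifferential_ereal_iff)
    moreover have "weak_deriv T ?x t + \<eta> + \<zeta> = h t" by (simp add: \<zeta>_def)
    ultimately show ?thesis by blast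
  qed
  then have "AE t in lebesgue_on {0<..<T}. \<exists>\<eta> \<in> subdifferential (\<lambda>z. ereal (?\<phi> z)) (?x t).
        \<exists>\<zeta> \<in> subdifferential (indicator_fun (constraint_set node n m a t)) (?x t).
          weak_deriv T ?x t + \<eta> + \<zeta> = h t"
    using N by (subst AE_lebesgue_on_iff_negligible) auto
  then show ?thesis
    unfolding is_solution_def using X(1) con initial_state_eq[OF bij T a] y0 by auto
qed

text \<open>Only because a solution exists does the choice in the definition of the solution map return one.\<close>

lemma solution_map_reduced:
  assumes bij: "bij_betw node {1..n + m} UNIV" and G: "weighted_hypergraph E w" and p: "1 \<le> p"
    and T: "0 < T" and h: "h \<in> L2 T" and a: "a \<in> controls node n T"
  shows "\<exists>y g. reduced_solution (hypergraph_energy E w p) (node ` {1..n}) T h a y g \<and>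
    y 0 = free_initial node n m \<xi> \<and> (\<forall>t\<in>{0..T}. solution_map E w p node n m T h \<xi> a t = a t + y t)"
proof -
  have "a \<in> W12 T" using a by (simp add: controls_def)
  then have "continuous_on {0..T} a" by (rule W12_weak_deriv(1)[OF T])
  then obtain y g where "reduced_solution (hypergraph_energy E w p) (node ` {1..n}) T h a y g"
    "y 0 = free_initial node n m \<xi>"
    by (rule reduced_solution_exists[OF T h _ hypergraph_energy_convex[OF G p] hypergraph_energy_nonneg[OF G p]
          coord_proj_free_initial])
  then have "is_solution E w p node n m T h \<xi> a (\<lambda>t. a t + y t)"
    by (rule reduced_imp_is_solution[OF bij T a])
  then have "is_solution E w p node n m T h \<xi> a (solution_map E w p node n m T h \<xi> a)"
    unfolding solution_map_def by (rule someI[where P = "is_solution E w p node n m T h \<xi> a"])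
  then show ?thesis by (rule is_solution_imp_reduced[OF bij T a])
qed

text \<open>The states belonging to the controls stay in one ball, by the a priori bound, and there the energy is
uniformly continuous; so uniformly close controls have uniformly close states.\<close>

lemma solution_map_continuous:
  assumes bij: "bij_betw node {1..n + m} UNIV" and G: "weighted_hypergraph E w" and p: "1 \<le> p"
    and T: "0 < T" and h: "h \<in> L2 T"
    and ak: "\<And>k. a k \<in> controls node n T" and b: "b \<in> controls node n T"
    and lim: "\<And>e. 0 < e \<Longrightarrow> \<exists>K. \<forall>k\<ge>K. \<forall>t\<in>{0..T}. norm (a k t - b t) \<le> e"
    and e: "0 < e"
  shows "\<exists>K. \<forall>k\<ge>K. \<forall>t\<in>{0..T}. norm (solution_map E w p node n m T h \<xi> (a k) t -
           solution_map E w p node n m T h \<xi> b t) \<le> e"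
proof -
  let ?\<phi> = "hypergraph_energy E w p" and ?I = "node ` {1..n}" and ?\<Lambda> = "solution_map E w p node n m T h \<xi>"
  note conv = hypergraph_energy_convex[OF G p] and nonneg = hypergraph_energy_nonneg[OF G p]
  have cont: "continuous_on UNIV ?\<phi>" by (rule convex_imp_continuous[OF conv])
  obtain z f where z: "reduced_solution ?\<phi> ?I T h b z f" "z 0 = free_initial node n m \<xi>"
    "\<And>t. t \<in> {0..T} \<Longrightarrow> ?\<Lambda> b t = b t + z t"
    using solution_map_reduced[OF bij G p T h b] by blast
  have "b \<in> W12 T" using b by (simp add: controls_def)
  then have "continuous_on {0..T} b" by (rule W12_weak_deriv(1)[OF T])
  then have "compact (b ` {0..T})" by (intro compact_continuous_image) auto
  then obtain A0 where A0: "\<And>t. t \<in> {0..T} \<Longrightarrow> norm (b t) \<le> A0"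
    using compact_imp_bounded bounded_iff by (metis imageI)
  define A where "A = A0 + 1"
  obtain \<Phi> where \<Phi>: "0 \<le> \<Phi>" "\<And>x. norm x \<le> A \<Longrightarrow> \<bar>?\<phi> x\<bar> \<le> \<Phi>"
    using continuous_bounded_cball[OF cont] by blast
  define B where "B = 1 + (norm (free_initial node n m \<xi>))\<^sup>2 + 2 * integral {0..T} (\<lambda>r. norm (h r)) + 2 * \<Phi> * T"
  have bound: "norm (y t) \<le> B"
    if "reduced_solution ?\<phi> ?I T h c y g" "y 0 = free_initial node n m \<xi>"
      "\<And>t. t \<in> {0..T} \<Longrightarrow> norm (c t) \<le> A" "t \<in> {0..T}" for c y g t
  proof -
    have "?\<phi> (c t) \<le> \<Phi>" if "t \<in> {0..T}" for t using \<Phi>(2)[of "c t"] \<open>\<And>t. t \<in> {0..T} \<Longrightarrow> norm (c t) \<le> A\<close>[OF that] by simp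
    from reduced_solution_bound[OF T h nonneg this that(1,4)] show ?thesis by (simp add: B_def that(2))
  qed
  have bA: "norm (b t) \<le> A" if "t \<in> {0..T}" for t using A0[OF that] by (simp add: A_def)
  have zB: "norm (z t) \<le> B" if "t \<in> {0..T}" for t using bound[OF z(1,2) bA that] .
  \<comment> \<open>half of \<open>e\<close> is for the free parts of the states, the other half for the controls themselves\<close>
  define \<epsilon> where "\<epsilon> = (e / 2)\<^sup>2 / (4 * T)"
  have \<epsilon>: "0 < \<epsilon>" "4 * \<epsilon> * T = (e / 2)\<^sup>2" using e T by (auto simp: \<epsilon>_def)
  have "uniformly_continuous_on (cball 0 (A + B)) ?\<phi>"
    by (intro compact_uniformly_continuous continuous_on_subset[OF cont]) auto
  then obtain d where d: "0 < d" "\<And>x x'. norm x \<le> A + B \<Longrightarrow> norm x' \<le> A + B \<Longrightarrow> norm (x - x') < d \<Longrightarrow> \<bar>?\<phi> x - ?\<phi> x'\<bar> < \<epsilon>"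
    using \<epsilon>(1) unfolding uniformly_continuous_on_def dist_norm real_norm_def Ball_def mem_cball_0
    by (metis norm_minus_commute)
  have "0 < min (min (d / 2) (e / 2)) 1" using d(1) e by simp
  then obtain K where "\<forall>k\<ge>K. \<forall>t\<in>{0..T}. norm (a k t - b t) \<le> min (min (d / 2) (e / 2)) 1"
    using lim by blast
  then have K: "norm (a k t - b t) \<le> d / 2" "norm (a k t - b t) \<le> e / 2" "norm (a k t - b t) \<le> 1"
    if "k \<ge> K" "t \<in> {0..T}" for k t using that by (auto simp: min.bounded_iff)
  have "norm (?\<Lambda> (a k) t - ?\<Lambda> b t) \<le> e" if k: "k \<ge> K" and t: "t \<in> {0..T}" for k t
  proof -
    obtain y g where y: "reduced_solution ?\<phi> ?I T h (a k) y g" "y 0 = free_initial node n m \<xi>"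
      "\<And>t. t \<in> {0..T} \<Longrightarrow> ?\<Lambda> (a k) t = a k t + y t"
      using solution_map_reduced[OF bij G p T h ak] by blast
    have aA: "norm (a k t) \<le> A" if "t \<in> {0..T}" for t
      using K(3)[OF k that] A0[OF that] norm_triangle_sub[of "a k t" "b t"] by (simp add: A_def)
    have yB: "norm (y t) \<le> B" if "t \<in> {0..T}" for t using bound[OF y(1,2) aA that] .
    have close: "\<bar>?\<phi> (a k r + v) - ?\<phi> (b r + v)\<bar> \<le> \<epsilon>" if "r \<in> {0..T}" "norm v \<le> B" for r v
    proof -
      have "norm (a k r + v) \<le> A + B" "norm (b r + v) \<le> A + B"
        using aA[OF that(1)] bA[OF that(1)] that(2) by (auto intro: norm_triangle_le)
      moreover have "norm (a k r + v - (b r + v)) < d" using K(1)[OF k that(1)] d(1) by simp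
      ultimately show ?thesis using d(2) by (simp add: less_imp_le)
    qed
    have "(norm (y t - z t))\<^sup>2 \<le> 4 * \<epsilon> * T"
      by (rule reduced_solution_difference[OF T y(1) z(1) _ _ _ t]) (use y z close yB zB in auto)
    then have "norm (y t - z t) \<le> e / 2"
      unfolding \<epsilon>(2) using e by (simp add: power2_le_iff_abs_le)
    then show ?thesis
      using y(3)[OF t] z(3)[OF t] K(2)[OF k t] norm_triangle_ineq[of "a k t - b t" "y t - z t"]
      by (simp add: add_diff_add)
  qed
  then show ?thesis by blast
qed

section \<open>Compactness of the admissible controls\<close>

text \<open>The Cauchy-Schwarz inequality, in the form that the mean \<open>c\<close> of \<open>g\<close> satisfies
\<open>0 \<le> \<integral> (norm (g - c))\<^sup>2\<close>.\<close>

lemma increment_sq_le: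
  fixes g :: "real \<Rightarrow> 'a::euclidean_space"
  assumes g: "g \<in> L2 T" and u: "\<And>t. t \<in> {0..T} \<Longrightarrow> u t = u 0 + integral {0..t} g"
    and st: "0 \<le> s" "s \<le> t" "t \<le> T"
  shows "(norm (u t - u s))\<^sup>2 \<le> (t - s) * integral {s..t} (\<lambda>r. (norm (g r))\<^sup>2)"
proof (cases "s = t")
  case False
  \<comment> \<open>the mean of \<open>g\<close> over the interval\<close>
  define c where "c = (1 / (t - s)) *\<^sub>R (u t - u s)"
  have ts: "0 < t - s" using False st by simp
  have g': "g integrable_on {s..t}" "(\<lambda>r. (norm (g r))\<^sup>2) integrable_on {s..t}"
    by (rule integrable_subinterval_real[OF L2_integrable[OF g]], use st in simp)
       (rule integrable_subinterval_real[OF L2_norm_sq_integrable[OF g]], use st in simp)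
  have inc: "integral {s..t} g = u t - u s" using primitive_shift[OF L2_integrable[OF g] u st] by simp
  have gc: "(\<lambda>r. g r \<bullet> c) integrable_on {s..t}" "integral {s..t} (\<lambda>r. g r \<bullet> c) = (u t - u s) \<bullet> c"
    using integrable_linear[OF g'(1) bounded_linear_inner_left[of c]] integral_linear[OF g'(1) bounded_linear_inner_left[of c]]
    by (auto simp: o_def inc)
  have "2 * (g r \<bullet> c) - (norm c)\<^sup>2 \<le> (norm (g r))\<^sup>2" for r
    using zero_le_power2[of "norm (g r - c)"] by (simp add: power2_norm_eq_inner inner_diff inner_commute)
  then have "integral {s..t} (\<lambda>r. 2 * (g r \<bullet> c) - (norm c)\<^sup>2) \<le> integral {s..t} (\<lambda>r. (norm (g r))\<^sup>2)"
    by (intro integral_le g' integrable_diff integrable_on_mult_right gc) auto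
  also have "integral {s..t} (\<lambda>r. 2 * (g r \<bullet> c) - (norm c)\<^sup>2) = 2 * ((u t - u s) \<bullet> c) - (t - s) * (norm c)\<^sup>2"
    using ts by (subst integral_diff) (auto intro!: integrable_on_mult_right gc simp: gc(2))
  also have "\<dots> = (norm (u t - u s))\<^sup>2 / (t - s)"
  proof -
    have "u t - u s = (t - s) *\<^sub>R c" using ts by (simp add: c_def)
    then show ?thesis using ts
      by (simp add: dot_square_norm power_mult_distrib power2_eq_square[of "t - s"])
  qed
  finally show ?thesis using ts by (simp add: divide_le_eq mult.commute)
qed simp

lemma quadratic_variation_le:
  fixes g :: "real \<Rightarrow> 'a::euclidean_space"
  assumes T: "0 < T" and g: "g \<in> L2 T" and u: "\<And>t. t \<in> {0..T} \<Longrightarrow> u t = u 0 + integral {0..t} g"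
    and M: "integral {0..T} (\<lambda>r. (norm (g r))\<^sup>2) \<le> M" and N: "0 < N"
  shows "(\<Sum>i<N. (norm (u (real (Suc i) * (T / real N)) - u (real i * (T / real N))))\<^sup>2) \<le> M * (T / real N)"
proof -
  define d where "d = T / real N"
  have d: "0 < d" "real N * d = T" using T N by (auto simp: d_def)
  have cell: "0 \<le> real i * d" "real i * d \<le> real (Suc i) * d" "real (Suc i) * d \<le> T" if "i < N" for i
  proof -
    have "real (Suc i) * d \<le> real N * d" using that d(1) by (intro mult_right_mono of_nat_mono) auto
    then show "0 \<le> real i * d" "real i * d \<le> real (Suc i) * d" "real (Suc i) * d \<le> T"
      using d by (auto simp del: of_nat_Suc intro!: mult_right_mono)
  qed
  have len: "real (Suc i) * d - real i * d = d" for i by (simp add: algebra_simps)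
  have "(\<Sum>i<N. (norm (u (real (Suc i) * d) - u (real i * d)))\<^sup>2) \<le>
        (\<Sum>i<N. d * integral {real i * d..real (Suc i) * d} (\<lambda>r. (norm (g r))\<^sup>2))"
  proof (intro sum_mono)
    fix i assume "i \<in> {..<N}"
    then have "i < N" by simp
    from increment_sq_le[OF g u cell[OF this]]
    show "(norm (u (real (Suc i) * d) - u (real i * d)))\<^sup>2 \<le> d * integral {real i * d..real (Suc i) * d} (\<lambda>r. (norm (g r))\<^sup>2)"
      unfolding len by blast
  qed
  also have "\<dots> = d * integral {0..T} (\<lambda>r. (norm (g r))\<^sup>2)"
    using cellwise_absolutely_integrable(2)[OF d(1), of N "\<lambda>i r. (norm (g r))\<^sup>2"]
      absolutely_integrable_on_sub_Icc[OF L2_D(2)[OF g]] cell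
    unfolding d(2) sum_distrib_left[symmetric] by simp
  also have "\<dots> \<le> M * d" using M d(1) by (simp add: mult.commute)
  finally show ?thesis by (simp add: d_def)
qed

text \<open>Equicontinuity and pointwise boundedness of a set of curves that is bounded in the Sobolev norm.\<close>

lemma W12_norm_bounds:
  fixes u g :: "real \<Rightarrow> 'a::euclidean_space"
  assumes T: "0 < T" and g: "g \<in> L2 T" and u: "\<And>t. t \<in> {0..T} \<Longrightarrow> u t = u 0 + integral {0..t} g"
    and M: "integral {0..T} (\<lambda>r. (norm (g r))\<^sup>2) \<le> M"
  shows "s \<in> {0..T} \<Longrightarrow> t \<in> {0..T} \<Longrightarrow> (norm (u t - u s))\<^sup>2 \<le> \<bar>t - s\<bar> * M"
    and "t \<in> {0..T} \<Longrightarrow> T * (norm (u t))\<^sup>2 \<le> 2 * integral {0..T} (\<lambda>r. (norm (u r))\<^sup>2) + 2 * T * (T * M)"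
proof -
  have ord: "(norm (u t - u s))\<^sup>2 \<le> (t - s) * M" if st: "0 \<le> s" "s \<le> t" "t \<le> T" for s t
  proof -
    have "integral {s..t} (\<lambda>r. (norm (g r))\<^sup>2) \<le> integral {0..T} (\<lambda>r. (norm (g r))\<^sup>2)"
      using st by (intro integral_subset_le L2_norm_sq_integrable[OF g] integrable_subinterval_real[OF L2_norm_sq_integrable[OF g]]) auto
    also note M
    finally have "(t - s) * integral {s..t} (\<lambda>r. (norm (g r))\<^sup>2) \<le> (t - s) * M" using st by (intro mult_left_mono) auto
    with increment_sq_le[OF g u st] show ?thesis by (rule order_trans)
  qed
  show inc: "(norm (u t - u s))\<^sup>2 \<le> \<bar>t - s\<bar> * M" if "s \<in> {0..T}" "t \<in> {0..T}" for s t
    using ord[of s t] ord[of t s] that by (cases "s \<le> t") (auto simp: norm_minus_commute)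
  assume t: "t \<in> {0..T}"
  have "0 \<le> M" using M integral_nonneg[OF L2_norm_sq_integrable[OF g]] by (meson order_trans zero_le_power2)
  have pt: "(norm (u t))\<^sup>2 \<le> 2 * (norm (u r))\<^sup>2 + 2 * (T * M)" if r: "r \<in> {0..T}" for r
  proof -
    have "(norm (u t))\<^sup>2 \<le> 2 * (norm (u r))\<^sup>2 + 2 * (norm (u t - u r))\<^sup>2"
      using zero_le_power2[of "norm (u r - (u t - u r))"]
      unfolding power2_norm_eq_inner by (simp add: inner_diff inner_commute algebra_simps)
    also have "(norm (u t - u r))\<^sup>2 \<le> \<bar>t - r\<bar> * M" by (rule inc[OF r t])
    also have "\<dots> \<le> T * M" using r t \<open>0 \<le> M\<close> by (intro mult_right_mono) auto
    finally show ?thesis by simp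
  qed
  have cont: "continuous_on {0..T} u" by (rule primitive_continuous[OF L2_integrable[OF g] u])
  have i: "(\<lambda>r. 2 * (norm (u r))\<^sup>2) integrable_on {0..T}"
    by (intro integrable_on_mult_right L2_norm_sq_integrable L2_continuous cont)
  have "integral {0..T} (\<lambda>_. (norm (u t))\<^sup>2) \<le> integral {0..T} (\<lambda>r. 2 * (norm (u r))\<^sup>2 + 2 * (T * M))"
    by (rule integral_le[OF _ _ pt]) (auto intro!: integrable_add i)
  also have "\<dots> = 2 * integral {0..T} (\<lambda>r. (norm (u r))\<^sup>2) + 2 * T * (T * M)"
    using T by (subst integral_add[OF i]) auto
  finally show "T * (norm (u t))\<^sup>2 \<le> 2 * integral {0..T} (\<lambda>r. (norm (u r))\<^sup>2) + 2 * T * (T * M)"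
    using T by simp
qed

lemma admissible_controls_iff:
  assumes T: "0 < T"
  shows "a \<in> admissible_controls node n T M \<longleftrightarrow> a \<in> controls node n T \<and>
    integral {0..T} (\<lambda>t. (norm (weak_deriv T a t))\<^sup>2) \<le> M"
proof -
  have "(LINT t|lebesgue_on {0<..<T}. (norm (weak_deriv T a t))\<^sup>2) = integral {0..T} (\<lambda>t. (norm (weak_deriv T a t))\<^sup>2)"
    if "a \<in> controls node n T"
    using that W12_weak_deriv(2)[OF T] by (intro LINT_Ioo_eq_integral L2_D) (auto simp: controls_def)
  then show ?thesis by (auto simp: admissible_controls_def)
qed

lemma admissible_controlsI:
  fixes a :: "real \<Rightarrow> real^'v::finite"
  assumes T: "0 < T" and g: "g \<in> L2 T" and a: "\<And>t. t \<in> {0..T} \<Longrightarrow> a t = a 0 + integral {0..t} g"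
    and M: "integral {0..T} (\<lambda>r. (norm (g r))\<^sup>2) \<le> M"
    and z: "\<And>t i. t \<in> {0..T} \<Longrightarrow> i \<in> {1..n} \<Longrightarrow> a t $ node i = 0"
  shows "a \<in> admissible_controls node n T M"
proof -
  note W = primitive_W12[OF T g a]
  have "integral {0..T} (\<lambda>t. (norm (weak_deriv T a t))\<^sup>2) = integral {0..T} (\<lambda>r. (norm (g r))\<^sup>2)"
    by (rule integral_spike[OF W(2)]) auto
  then show ?thesis using W(1) M z by (auto simp: admissible_controls_iff[OF T] controls_def)
qed

text \<open>The theorem of Arzela and Ascoli gives a uniform limit. That it is again an admissible control
follows from the quadratic variation criterion, because the quadratic variation over each grid is
continuous under pointwise convergence and bounded by \<open>M\<close> times the mesh.\<close>

lemma admissible_controls_compact: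
  fixes a :: "nat \<Rightarrow> real \<Rightarrow> real^'v::finite"
  assumes T: "0 < T" and a: "\<And>k. a k \<in> admissible_controls node n T M"
    and C: "\<And>k. integral {0..T} (\<lambda>t. (norm (a k t))\<^sup>2) \<le> C"
  obtains b r where "b \<in> admissible_controls node n T M" "strict_mono (r :: nat \<Rightarrow> nat)"
    "\<forall>e>0. \<exists>K. \<forall>k\<ge>K. \<forall>t\<in>{0..T}. norm (a (r k) t - b t) \<le> e"
proof -
  let ?g = "\<lambda>k. weak_deriv T (a k)"
  have ctr: "a k \<in> controls node n T" and M: "integral {0..T} (\<lambda>t. (norm (?g k t))\<^sup>2) \<le> M" for k
    using a[of k] by (auto simp: admissible_controls_iff[OF T])
  have aW: "a k \<in> W12 T" for k using ctr[of k] by (simp add: controls_def)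
  note W = W12_weak_deriv[OF T aW]
  note est = W12_norm_bounds[OF T W(2) W(3) M]
  have M0: "0 \<le> M" using M[of 0] integral_nonneg[OF L2_norm_sq_integrable[OF W(2)[of 0]]] by (meson order_trans zero_le_power2)
  define R where "R = (2 * C + 2 * T * (T * M)) / T"
  have bound: "norm (a k t) \<le> 1 + R" if "t \<in> {0..T}" for k t
  proof -
    have "T * (norm (a k t))\<^sup>2 \<le> 2 * C + 2 * T * (T * M)"
      using est(2)[OF _ that, of k] C[of k] by simp
    then have sq: "(norm (a k t))\<^sup>2 \<le> R" using T by (simp add: R_def le_divide_eq mult.commute)
    have "norm (a k t) \<le> 1 + (norm (a k t))\<^sup>2"
      using zero_le_power2[of "norm (a k t) - 1"] norm_ge_zero[of "a k t"]
      unfolding power2_diff power_one mult_1_right by linarith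
    with sq show ?thesis by simp
  qed
  have equi: "\<exists>d>0. \<forall>k s. s \<in> {0..T} \<and> norm (t - s) < d \<longrightarrow> norm (a k t - a k s) < e"
    if t: "t \<in> {0..T}" and e: "0 < e" for t e
  proof -
    define d where "d = e\<^sup>2 / (M + 1)"
    have d: "0 < d" using e M0 by (simp add: d_def)
    have "norm (a k t - a k s) < e" if "s \<in> {0..T}" "norm (t - s) < d" for k s
    proof -
      have "(norm (a k t - a k s))\<^sup>2 \<le> \<bar>t - s\<bar> * M" by (rule est(1)[OF _ that(1) t])
      also have "\<dots> \<le> d * M" using that(2) M0 by (intro mult_right_mono) auto
      also have "\<dots> < d * (M + 1)" using d by simp
      also have "\<dots> = e\<^sup>2" using M0 by (simp add: d_def)
      finally show ?thesis using e by (intro power2_less_imp_less[of _ e]) auto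
    qed
    then show ?thesis using d by blast
  qed
  obtain b r where b: "continuous_on {0..T} b" and r: "strict_mono (r :: nat \<Rightarrow> nat)"
    and lim: "\<And>e. 0 < e \<Longrightarrow> \<exists>K. \<forall>k t. k \<ge> K \<and> t \<in> {0..T} \<longrightarrow> norm (a (r k) t - b t) < e"
    using Arzela_Ascoli[of "{0..T}" a "1 + R", OF compact_Icc bound equi] by blast
  have tend: "(\<lambda>k. a (r k) t) \<longlonglongrightarrow> b t" if "t \<in> {0..T}" for t
    unfolding LIMSEQ_iff using lim that by blast
  have zero: "b t $ node i = 0" if "t \<in> {0..T}" "i \<in> {1..n}" for t i
  proof -
    have "(\<lambda>k. a (r k) t $ node i) \<longlonglongrightarrow> b t $ node i" by (intro tendsto_intros tend that)
    moreover have "a (r k) t $ node i = 0" for k using ctr that by (auto simp: controls_def)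
    ultimately show ?thesis by (simp add: LIMSEQ_const_iff)
  qed
  obtain g where g: "g \<in> L2 T" "integral {0..T} (\<lambda>t. (norm (g t))\<^sup>2) \<le> M"
    "\<And>t. t \<in> {0..T} \<Longrightarrow> b t = b 0 + integral {0..t} g"
  proof (rule Riesz_bounded_quadratic_variation[OF T b])
    fix N :: nat assume N: "0 < N"
    have cell: "real i * (T / real N) \<in> {0..T}" if "i \<le> N" for i
    proof -
      have "real i * (T / real N) \<le> real N * (T / real N)" using that T by (intro mult_right_mono) auto
      then show ?thesis using N T by simp
    qed
    have "(\<lambda>k. \<Sum>i<N. (norm (a (r k) (real (Suc i) * (T / real N)) - a (r k) (real i * (T / real N))))\<^sup>2) \<longlonglongrightarrow>
          (\<Sum>i<N. (norm (b (real (Suc i) * (T / real N)) - b (real i * (T / real N))))\<^sup>2)"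
      using cell by (intro tendsto_sum tendsto_power tendsto_norm tendsto_diff tend) (auto simp del: of_nat_Suc)
    moreover have "(\<Sum>i<N. (norm (a (r k) (real (Suc i) * (T / real N)) - a (r k) (real i * (T / real N))))\<^sup>2) \<le> M * (T / real N)" for k
      by (rule quadratic_variation_le[OF T W(2) W(3) M N])
    ultimately show "(\<Sum>i<N. (norm (b (real (Suc i) * (T / real N)) - b (real i * (T / real N))))\<^sup>2) \<le> M * (T / real N)"
      by (intro LIMSEQ_le_const2) auto
  qed blast
  show ?thesis
  proof (rule that[OF _ r])
    show "b \<in> admissible_controls node n T M" by (rule admissible_controlsI[OF T g(1,3,2) zero])
    show "\<forall>e>0. \<exists>K. \<forall>k\<ge>K. \<forall>t\<in>{0..T}. norm (a (r k) t - b t) \<le> e"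
      using lim by (meson less_imp_le)
  qed
qed

section \<open>Existence of an optimal control\<close>

lemma L2_distance_tendsto:
  fixes u :: "nat \<Rightarrow> real \<Rightarrow> 'a::euclidean_space"
  assumes x: "x \<in> L2 T" and u: "\<And>k. continuous_on {0..T} (u k)" and v: "continuous_on {0..T} v"
    and lim: "\<And>e. 0 < e \<Longrightarrow> \<exists>K. \<forall>k\<ge>K. \<forall>t\<in>{0..T}. norm (u k t - v t) \<le> e"
  shows "(\<lambda>k. integral {0..T} (\<lambda>t. (norm (u k t - x t))\<^sup>2)) \<longlonglongrightarrow> integral {0..T} (\<lambda>t. (norm (v t - x t))\<^sup>2)"
proof -
  obtain K where K: "\<And>k t. k \<ge> K \<Longrightarrow> t \<in> {0..T} \<Longrightarrow> norm (u k t - v t) \<le> 1"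
    using lim[of 1] zero_less_one by blast
  have vx: "(\<lambda>t. v t - x t) \<in> L2 T" by (intro L2_diff L2_continuous v x)
  have "(\<lambda>k. integral {0..T} (\<lambda>t. (norm (u (k + K) t - x t))\<^sup>2)) \<longlonglongrightarrow> integral {0..T} (\<lambda>t. (norm (v t - x t))\<^sup>2)"
  proof (rule dominated_convergence(2))
    show "(\<lambda>t. (norm (u (k + K) t - x t))\<^sup>2) integrable_on {0..T}" for k
      by (intro L2_norm_sq_integrable L2_diff L2_continuous u x)
    show "(\<lambda>t. 2 * (norm (v t - x t))\<^sup>2 + 2) integrable_on {0..T}"
      by (intro integrable_add integrable_on_mult_right L2_norm_sq_integrable[OF vx]) auto
    show "norm ((norm (u (k + K) t - x t))\<^sup>2) \<le> 2 * (norm (v t - x t))\<^sup>2 + 2" if "t \<in> {0..T}" for k t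
    proof -
      have "(norm (c + d))\<^sup>2 \<le> 2 * (norm c)\<^sup>2 + 2 * (norm d)\<^sup>2" for c d :: 'a
        using zero_le_power2[of "norm (c - d)"]
        unfolding power2_norm_eq_inner by (simp add: algebra_simps inner_commute)
      from this[of "v t - x t" "u (k + K) t - v t"]
      have "(norm (u (k + K) t - x t))\<^sup>2 \<le> 2 * (norm (v t - x t))\<^sup>2 + 2 * (norm (u (k + K) t - v t))\<^sup>2" by simp
      also have "(norm (u (k + K) t - v t))\<^sup>2 \<le> 1" using K[of "k + K" t] that by (simp add: power_le_one)
      finally show ?thesis by simp
    qed
    show "(\<lambda>k. (norm (u (k + K) t - x t))\<^sup>2) \<longlonglongrightarrow> (norm (v t - x t))\<^sup>2" if t: "t \<in> {0..T}" for t
    proof -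
      have "(\<lambda>k. u k t) \<longlonglongrightarrow> v t"
        unfolding LIMSEQ_iff
      proof (intro allI impI)
        fix e :: real assume e: "0 < e"
        then obtain K where "\<And>k. k \<ge> K \<Longrightarrow> norm (u k t - v t) \<le> e / 2"
          using lim[of "e / 2"] t half_gt_zero by blast
        moreover have "e / 2 < e" using e by simp
        ultimately show "\<exists>K. \<forall>k\<ge>K. norm (u k t - v t) < e"
          by (intro exI[of _ K] allI impI) (rule le_less_trans)
      qed
      then show ?thesis by (intro tendsto_intros LIMSEQ_ignore_initial_segment)
    qed
  qed
  then show ?thesis by (rule LIMSEQ_offset)
qed

theorem proposition2:
  fixes E :: "'v::finite set set" and w :: "'v set \<Rightarrow> real"
    and node :: "nat \<Rightarrow> 'v" and n m :: nat
    and p T M :: real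
    and h x_target :: "real \<Rightarrow> real^'v" and \<xi> :: "nat \<Rightarrow> real"
  assumes "bij_betw node {1..n + m} UNIV"
    and "weighted_hypergraph E w"
    and "1 \<le> p"
    and "0 < T"
    and "h \<in> L2 T"
    and "x_target \<in> L2 T"
    and "0 < M"
  shows "\<exists>a_star \<in> admissible_controls node n T M.
           \<forall>a \<in> admissible_controls node n T M.
             cost E w p node n m T h \<xi> x_target a_star \<le> cost E w p node n m T h \<xi> x_target a"
proof -
  note T = \<open>0 < T\<close>
  let ?U = "admissible_controls node n T M" and ?J = "cost E w p node n m T h \<xi> x_target"
  let ?\<Lambda> = "solution_map E w p node n m T h \<xi>"
  have ctr: "a \<in> controls node n T" if "a \<in> ?U" for a
    using that by (simp add: admissible_controls_iff[OF T])
  have cont: "continuous_on {0..T} a" if "a \<in> ?U" for a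
    using ctr[OF that] W12_weak_deriv(1)[OF T] by (auto simp: controls_def)
  have \<Lambda>cont: "continuous_on {0..T} (?\<Lambda> a)" if aU: "a \<in> ?U" for a
  proof -
    obtain y g where y: "reduced_solution (hypergraph_energy E w p) (node ` {1..n}) T h a y g"
      "\<And>t. t \<in> {0..T} \<Longrightarrow> ?\<Lambda> a t = a t + y t"
      using solution_map_reduced[OF assms(1-5) ctr[OF aU]] by blast
    have "continuous_on {0..T} (\<lambda>t. a t + y t)"
      by (intro continuous_intros cont[OF aU] reduced_solutionD[OF y(1)])
    then show ?thesis by (rule continuous_on_eq) (use y(2) in simp)
  qed
  have J: "?J a = 1 / 2 * integral {0..T} (\<lambda>t. (norm (?\<Lambda> a t - x_target t))\<^sup>2) +
      1 / 2 * integral {0..T} (\<lambda>t. (norm (a t))\<^sup>2)" if "a \<in> ?U" for a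
    unfolding cost_def LINT_Ioo_eq_integral[OF L2_D(2)[OF L2_continuous[OF cont[OF that]]]]
      LINT_Ioo_eq_integral[OF L2_D(2)[OF L2_diff[OF L2_continuous[OF \<Lambda>cont[OF that]] assms(6)]]] ..
  have sq0: "0 \<le> integral {0..T} (\<lambda>t. (norm (f t))\<^sup>2)" if "f \<in> L2 T" for f :: "real \<Rightarrow> real^'v"
    by (intro integral_nonneg L2_norm_sq_integrable[OF that]) auto
  have norm_le_J: "integral {0..T} (\<lambda>t. (norm (a t))\<^sup>2) \<le> 2 * ?J a" and J0: "0 \<le> ?J a" if "a \<in> ?U" for a
    using sq0[OF L2_diff[OF L2_continuous[OF \<Lambda>cont[OF that]] \<open>x_target \<in> L2 T\<close>]]
      sq0[OF L2_continuous[OF cont[OF that]]] by (auto simp: J[OF that])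
  have "(\<lambda>_. 0) \<in> ?U"
    by (rule admissible_controlsI[OF T, of "\<lambda>_. 0"]) (use \<open>0 < M\<close> in \<open>auto intro: L2_continuous\<close>)
  then have ne: "?J ` ?U \<noteq> {}" by blast
  have bdd: "bdd_below (?J ` ?U)" using J0 by (intro bdd_belowI2)
  define j where "j = Inf (?J ` ?U)"
  have j_le: "j \<le> ?J a" if "a \<in> ?U" for a
    unfolding j_def using that bdd by (intro cInf_lower) auto
  have "\<exists>a. a \<in> ?U \<and> ?J a < j + 1 / real (Suc k)" for k
  proof -
    have "Inf (?J ` ?U) < j + 1 / real (Suc k)" unfolding j_def by simp
    then show ?thesis using cInf_lessD[OF ne] by blast
  qed
  then obtain a where a: "\<And>k. a k \<in> ?U" "\<And>k. ?J (a k) < j + 1 / real (Suc k)" by metis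
  have bounded: "integral {0..T} (\<lambda>t. (norm (a k t))\<^sup>2) \<le> 2 * (j + 1)" for k
  proof -
    have "1 / real (Suc k) \<le> 1" by simp
    then have "j + 1 / real (Suc k) \<le> j + 1" by (rule add_left_mono)
    with a(2)[of k] have "?J (a k) \<le> j + 1" by (rule less_imp_le[OF less_le_trans])
    then have "2 * ?J (a k) \<le> 2 * (j + 1)" by (rule mult_left_mono) simp
    with norm_le_J[OF a(1)[of k]] show ?thesis by (rule order_trans)
  qed
  obtain b r where b: "b \<in> ?U" and r: "strict_mono (r :: nat \<Rightarrow> nat)"
    and unif: "\<forall>e>0. \<exists>K. \<forall>k\<ge>K. \<forall>t\<in>{0..T}. norm (a (r k) t - b t) \<le> e"
    by (rule admissible_controls_compact[OF T a(1) bounded])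
  then have lim: "\<exists>K. \<forall>k\<ge>K. \<forall>t\<in>{0..T}. norm (a (r k) t - b t) \<le> e" if "0 < e" for e
    using that by blast
  have "(\<lambda>k. integral {0..T} (\<lambda>t. (norm (?\<Lambda> (a (r k)) t - x_target t))\<^sup>2)) \<longlonglongrightarrow>
        integral {0..T} (\<lambda>t. (norm (?\<Lambda> b t - x_target t))\<^sup>2)"
    by (rule L2_distance_tendsto[OF \<open>x_target \<in> L2 T\<close> \<Lambda>cont[OF a(1)] \<Lambda>cont[OF b]])
       (rule solution_map_continuous[OF assms(1-5) ctr[OF a(1)] ctr[OF b] lim])
  moreover have "(\<lambda>k. integral {0..T} (\<lambda>t. (norm (a (r k) t))\<^sup>2)) \<longlonglongrightarrow> integral {0..T} (\<lambda>t. (norm (b t))\<^sup>2)"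
    using L2_distance_tendsto[OF L2_continuous[OF continuous_on_const[of _ 0]] cont[OF a(1)] cont[OF b] lim] by simp
  ultimately have J_lim: "(\<lambda>k. ?J (a (r k))) \<longlonglongrightarrow> ?J b"
    unfolding J[OF a(1)] J[OF b] by (intro tendsto_intros)
  have "(\<lambda>k. j + 1 / real (Suc (r k))) \<longlonglongrightarrow> j + 0"
    by (intro tendsto_intros LIMSEQ_subseq_LIMSEQ[OF LIMSEQ_Suc[OF lim_const_over_n[of 1]] r, unfolded o_def])
  then have "?J b \<le> j + 0"
    by (rule LIMSEQ_le[OF J_lim]) (use a(2) in \<open>auto intro: less_imp_le\<close>)
  then show ?thesis using b j_le by (intro bexI[of _ b]) (auto intro: order_trans)
qed

end
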